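(* Let $\Psi^{*}\in\mathcal{T}\mathcal{C}^{1+}$. Then there is a unique non-atomic probability measure $\mu^{*}$ whose support is the whole $\Sigma^{*}$ such that, with respect to the metric $d(\cdot,\cdot)$ induced from $\mu^{*}$ on $\Sigma^{*}$, the right shift $\sigma^{*}$ is $C^{1+}$ differentiable and $\Psi^{*}$ is its derivative: $$\frac{d\sigma^{*}}{dw^{*}}(w^{*})=\Psi^{*}(w^{*})\quad\text{for all } w^{*}\in\Sigma^{*}.$$ Moreover, for the dynamical system $\sigma^{*}:\Sigma^{*}\to\Sigma^{*}$ and the potential $-\log\Psi^{*}$, the measure $\mu^{*}$ is an equilibrium state for $-\log\Psi^{*}$.
   Context: $T$ is the unit circle. A circle endomorphism is an orientation-preserving covering map $f:T\to T$ of degree $d\ge2$ with $f(1)=1$; its lift is the homeomorphism $F:\mathbb{R}\to\mathbb{R}$ with $F(0)=0$, $F(x+1)=F(x)+d$ and $e^{2\pi i F(x)}=f(e^{2\pi i x})$. Fix $d\ge 2$. $\mathcal{C}^{1+}$ is the set of circle endomorphisms of degree $d$ such that $F'$ is $\alpha$-Hölder for some $0<\alpha\le1$ and that are expanding: $(F^n)'(x)\ge C\lambda^n$ for all $x\in\mathbb{R}$, $n\ge1$, for some $C>0,\lambda>1$. $\Sigma^{*}$ is the space of left-infinite sequences $w^{*}=\cdots j_{n-1}\cdots j_1j_0$ over $\{0,\dots,d-1\}$ with the product topology; $[w_n^{*}]$ with $w_n^{*}=j_{n-1}\cdots j_0$ is the right cylinder of sequences ending in $j_{n-1}\cdots j_0$;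 the right shift is $\sigma^{*}(\cdots j_1j_0)=\cdots j_2j_1$. Dual derivative: for a word $w_n=i_0\cdots i_{n-1}$ let $I_{w_n}=F^{-n}([m,m+1])\subset[0,1]$, $m=i_{n-1}+i_{n-2}d+\cdots+i_0d^{n-1}$. Then $D^{*}(f)(w^{*})=\lim_{n\to\infty}|I_{v_{n-1}}|/|I_{w_n}|$, with $w_n=j_{n-1}\cdots j_1j_0$, $v_{n-1}=j_{n-1}\cdots j_1$ read left to right as words; the limit exists for $f\in\mathcal{C}^{1+}$. Here $\mathcal{T}\mathcal{C}^{1+}$ is identified with the set of functions $\{D^{*}(f): f\in\mathcal{C}^{1+}\}$ on $\Sigma^{*}$. The metric induced from a non-atomic probability measure $\mu^{*}$ of full support is $d(w^{*},\tilde w^{*})=\mu^{*}([w_n^{*}])$, with $[w_n^{*}]$ the smallest right cylinder containing both points. Differentiability of $\sigma^{*}$ with respect to $d$ means that $$\frac{d\sigma^{*}}{dw^{*}}(w^{*})=\lim_{n\to\infty}\frac{\mu^{*}(\sigma^{*}([w_n^{*}]))}{\mu^{*}([w_n^{*}])}$$ exists for every $w^{*}=\cdots w_n^*$; it is $C^{1+}$ differentiable if moreover the derivative is Hölder continuous, i.e. values at points sharing the first $n$ digits from the right differ by at most $C\tau^n$ for constants $C>0$, $0<\tau<1$. A $\sigma^{*}$-invariant probability measure $\mu^{*}$ is an equilibrium state for a continuous potential $\phi$ if $h_{\mu^{*}}(\sigma^{*})+\int\phi\,d\mu^{*}=\sup_\nu\{h_\nu(\sigma^{*})+\int\phi\,d\nu\}$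 (the pressure of $\phi$), the supremum being over all $\sigma^{*}$-invariant probability measures $\nu$ and $h_\nu$ denoting measure-theoretic entropy. *)

theory Defs
  imports "HOL-Probability.Probability"
begin

section \<open>Expanding circle endomorphisms\<close>

text \<open>A homeomorphism \<open>F\<close> of the line with \<open>F (x + 1) = F x + d\<close>, \<open>d \<ge> 2\<close>, is increasing, so
  the last clause of \<open>circle_endomorphism\<close> says at once that \<open>f\<close> preserves the orientation and
  has degree \<open>d\<close>; the lift normalised by \<open>F 0 = 0\<close> is unique.\<close>

definition is_lift :: "nat \<Rightarrow> (complex \<Rightarrow> complex) \<Rightarrow> (real \<Rightarrow> real) \<Rightarrow> bool" where
  "is_lift d f F \<longleftrightarrow>
     (\<exists>G. homeomorphism UNIV UNIV F G) \<and> F 0 = 0 \<and>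
     (\<forall>x. F (x + 1) = F x + real d) \<and>
     (\<forall>x. cis (2 * pi * F x) = f (cis (2 * pi * x)))"

definition circle_endomorphism :: "nat \<Rightarrow> (complex \<Rightarrow> complex) \<Rightarrow> bool" where
  "circle_endomorphism d f \<longleftrightarrow>
     2 \<le> d \<and> covering_space (sphere 0 1) f (sphere 0 1) \<and> f 1 = 1 \<and> (\<exists>F. is_lift d f F)"

definition lift :: "nat \<Rightarrow> (complex \<Rightarrow> complex) \<Rightarrow> real \<Rightarrow> real" where
  "lift d f = (THE F. is_lift d f F)"

definition C1_Holder :: "(real \<Rightarrow> real) \<Rightarrow> bool" where
  "C1_Holder F \<longleftrightarrow>
     (\<forall>x. F differentiable (at x)) \<and>
     (\<exists>\<alpha> K. 0 < \<alpha> \<and> \<alpha> \<le> 1 \<and> (\<forall>x y. \<bar>deriv F x - deriv F y\<bar> \<le> K * \<bar>x - y\<bar> powr \<alpha>))"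

definition expanding :: "(real \<Rightarrow> real) \<Rightarrow> bool" where
  "expanding F \<longleftrightarrow>
     (\<exists>C r. 0 < C \<and> 1 < r \<and> (\<forall>n\<ge>1. \<forall>x. C * r ^ n \<le> deriv (F ^^ n) x))"

definition C1_plus :: "nat \<Rightarrow> (complex \<Rightarrow> complex) set" where
  "C1_plus d = {f. circle_endomorphism d f \<and> C1_Holder (lift d f) \<and> expanding (lift d f)}"


section \<open>The dual symbolic space and the right shift\<close>

text \<open>The left-infinite sequence \<open>\<cdots> j\<^sub>2 j\<^sub>1 j\<^sub>0\<close> is the function \<open>w\<close> with \<open>w k = j\<^sub>k\<close>; digit
  positions are counted from the right.\<close>

definition dual_topology :: "nat \<Rightarrow> (nat \<Rightarrow> nat) topology" where
  "dual_topology d = product_topology (\<lambda>_. discrete_topology {..<d}) UNIV"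

abbreviation dual_space :: "nat \<Rightarrow> (nat \<Rightarrow> nat) set" where
  "dual_space d \<equiv> topspace (dual_topology d)"

definition dual_borel :: "nat \<Rightarrow> (nat \<Rightarrow> nat) measure" where
  "dual_borel d = sigma (dual_space d) {U. openin (dual_topology d) U}"

definition right_shift :: "(nat \<Rightarrow> nat) \<Rightarrow> nat \<Rightarrow> nat" where
  "right_shift w = (\<lambda>k. w (Suc k))"

text \<open>\<open>right_cylinder d w n\<close> is the cylinder of the word \<open>j\<^bsub>n-1\<^esub> \<cdots> j\<^sub>0\<close> formed by the last
  \<open>n\<close> digits of \<open>w\<close>.\<close>

definition right_cylinder :: "nat \<Rightarrow> (nat \<Rightarrow> nat) \<Rightarrow> nat \<Rightarrow> (nat \<Rightarrow> nat) set" where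
  "right_cylinder d w n = {v \<in> dual_space d. \<forall>k<n. v k = w k}"


section \<open>Dual derivatives\<close>

text \<open>Words are lists \<open>[i\<^sub>0, \<dots>, i\<^bsub>n-1\<^esub>]\<close>, read from left to right.\<close>

definition word_number :: "nat \<Rightarrow> nat list \<Rightarrow> nat" where
  "word_number d u = (\<Sum>k<length u. u ! k * d ^ (length u - 1 - k))"

definition word_interval :: "nat \<Rightarrow> (complex \<Rightarrow> complex) \<Rightarrow> nat list \<Rightarrow> real set" where
  "word_interval d f u =
     (lift d f ^^ length u) -` {real (word_number d u) .. real (word_number d u) + 1}"

text \<open>\<open>digits w a b\<close> is the word \<open>j\<^bsub>b-1\<^esub> \<cdots> j\<^sub>a\<close>.\<close>

definition digits :: "(nat \<Rightarrow> nat) \<Rightarrow> nat \<Rightarrow> nat \<Rightarrow> nat list" where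
  "digits w a b = map w (rev [a..<b])"

definition dual_derivative :: "nat \<Rightarrow> (complex \<Rightarrow> complex) \<Rightarrow> (nat \<Rightarrow> nat) \<Rightarrow> real" where
  "dual_derivative d f w =
     lim (\<lambda>n. measure lborel (word_interval d f (digits w 1 n)) /
              measure lborel (word_interval d f (digits w 0 n)))"

text \<open>Functions on the dual symbolic space are represented extensionally.\<close>

definition TC1_plus :: "nat \<Rightarrow> ((nat \<Rightarrow> nat) \<Rightarrow> real) set" where
  "TC1_plus d = (\<lambda>f. restrict (dual_derivative d f) (dual_space d)) ` C1_plus d"


section \<open>Measures on the dual symbolic space\<close>

definition is_dual_prob :: "nat \<Rightarrow> (nat \<Rightarrow> nat) measure \<Rightarrow> bool" where
  "is_dual_prob d \<mu> \<longleftrightarrow> prob_space \<mu> \<and> sets \<mu> = sets (dual_borel d)"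

definition atom :: "'a measure \<Rightarrow> 'a set \<Rightarrow> bool" where
  "atom \<mu> A \<longleftrightarrow> A \<in> sets \<mu> \<and> 0 < emeasure \<mu> A \<and>
     (\<forall>B\<in>sets \<mu>. B \<subseteq> A \<longrightarrow> emeasure \<mu> B = 0 \<or> emeasure \<mu> B = emeasure \<mu> A)"

definition non_atomic :: "'a measure \<Rightarrow> bool" where
  "non_atomic \<mu> \<longleftrightarrow> \<not> (\<exists>A. atom \<mu> A)"

definition measure_support :: "'a topology \<Rightarrow> 'a measure \<Rightarrow> 'a set" where
  "measure_support X \<mu> =
     {x \<in> topspace X. \<forall>U. openin X U \<and> x \<in> U \<longrightarrow> 0 < emeasure \<mu> U}"

text \<open>The intersection of the cylinders containing two distinct points is the smallest such
  cylinder. For equal points it is a singleton, which is null when the measure is non-atomic.\<close>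

definition induced_dist ::
  "nat \<Rightarrow> (nat \<Rightarrow> nat) measure \<Rightarrow> (nat \<Rightarrow> nat) \<Rightarrow> (nat \<Rightarrow> nat) \<Rightarrow> real" where
  "induced_dist d \<mu> u v =
     measure \<mu> (\<Inter>{A. \<exists>w\<in>dual_space d. \<exists>n. A = right_cylinder d w n \<and> u \<in> A \<and> v \<in> A})"

text \<open>By \<open>induced_dist_quotient\<close> below, the quotients in the following definitions are the
  difference quotients of the right shift for \<open>induced_dist\<close>.\<close>

definition shift_quotient ::
  "nat \<Rightarrow> (nat \<Rightarrow> nat) measure \<Rightarrow> (nat \<Rightarrow> nat) \<Rightarrow> nat \<Rightarrow> real" where
  "shift_quotient d \<mu> w n =
     measure \<mu> (right_shift ` right_cylinder d w n) / measure \<mu> (right_cylinder d w n)"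

definition shift_derivative ::
  "nat \<Rightarrow> (nat \<Rightarrow> nat) measure \<Rightarrow> (nat \<Rightarrow> nat) \<Rightarrow> real" where
  "shift_derivative d \<mu> w = lim (shift_quotient d \<mu> w)"

definition dual_Holder :: "nat \<Rightarrow> ((nat \<Rightarrow> nat) \<Rightarrow> real) \<Rightarrow> bool" where
  "dual_Holder d \<phi> \<longleftrightarrow>
     (\<exists>C \<tau>. 0 < C \<and> 0 < \<tau> \<and> \<tau> < 1 \<and>
       (\<forall>u\<in>dual_space d. \<forall>v\<in>dual_space d. \<forall>n.
          (\<forall>k<n. u k = v k) \<longrightarrow> \<bar>\<phi> u - \<phi> v\<bar> \<le> C * \<tau> ^ n))"

definition shift_C1_plus :: "nat \<Rightarrow> (nat \<Rightarrow> nat) measure \<Rightarrow> bool" where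
  "shift_C1_plus d \<mu> \<longleftrightarrow>
     (\<forall>w\<in>dual_space d. convergent (shift_quotient d \<mu> w)) \<and>
     dual_Holder d (shift_derivative d \<mu>)"

definition realizes_shift_derivative ::
  "nat \<Rightarrow> ((nat \<Rightarrow> nat) \<Rightarrow> real) \<Rightarrow> (nat \<Rightarrow> nat) measure \<Rightarrow> bool" where
  "realizes_shift_derivative d \<Psi> \<mu> \<longleftrightarrow>
     is_dual_prob d \<mu> \<and> non_atomic \<mu> \<and> measure_support (dual_topology d) \<mu> = dual_space d \<and>
     shift_C1_plus d \<mu> \<and> (\<forall>w\<in>dual_space d. shift_derivative d \<mu> w = \<Psi> w)"


section \<open>Entropy and equilibrium states\<close>

definition invariant_measure :: "('a \<Rightarrow> 'a) \<Rightarrow> 'a measure \<Rightarrow> bool" where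
  "invariant_measure T \<nu> \<longleftrightarrow>
     T \<in> measurable \<nu> \<nu> \<and> (\<forall>A\<in>sets \<nu>. emeasure \<nu> (T -` A \<inter> space \<nu>) = emeasure \<nu> A)"

definition finite_partition :: "'a measure \<Rightarrow> 'a set set \<Rightarrow> bool" where
  "finite_partition \<nu> P \<longleftrightarrow> finite P \<and> P \<subseteq> sets \<nu> \<and> partition_on (space \<nu>) P"

definition partition_entropy :: "'a measure \<Rightarrow> 'a set set \<Rightarrow> real" where
  "partition_entropy \<nu> P = - (\<Sum>A\<in>P. measure \<nu> A * ln (measure \<nu> A))"

text \<open>The join of \<open>P, T\<^sup>-\<^sup>1 P, \<dots>, T\<^bsup>-(n-1)\<^esup> P\<close>.\<close>

definition iterated_join :: "'a measure \<Rightarrow> ('a \<Rightarrow> 'a) \<Rightarrow> 'a set set \<Rightarrow> nat \<Rightarrow> 'a set set" where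
  "iterated_join \<nu> T P n =
     {space \<nu> \<inter> (\<Inter>k<n. (T ^^ k) -` A k) | A. \<forall>k<n. A k \<in> P} - {{}}"

definition entropy_wrt :: "'a measure \<Rightarrow> ('a \<Rightarrow> 'a) \<Rightarrow> 'a set set \<Rightarrow> real" where
  "entropy_wrt \<nu> T P = lim (\<lambda>n. partition_entropy \<nu> (iterated_join \<nu> T P n) / real n)"

definition KS_entropy :: "'a measure \<Rightarrow> ('a \<Rightarrow> 'a) \<Rightarrow> ereal" where
  "KS_entropy \<nu> T = (SUP P\<in>{P. finite_partition \<nu> P}. ereal (entropy_wrt \<nu> T P))"

definition shift_invariant_probs :: "nat \<Rightarrow> (nat \<Rightarrow> nat) measure set" where
  "shift_invariant_probs d = {\<nu>. is_dual_prob d \<nu> \<and> invariant_measure right_shift \<nu>}"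

definition pressure :: "nat \<Rightarrow> ((nat \<Rightarrow> nat) \<Rightarrow> real) \<Rightarrow> ereal" where
  "pressure d \<phi> =
     (SUP \<nu>\<in>shift_invariant_probs d. KS_entropy \<nu> right_shift + ereal (integral\<^sup>L \<nu> \<phi>))"

definition equilibrium_state ::
  "nat \<Rightarrow> ((nat \<Rightarrow> nat) \<Rightarrow> real) \<Rightarrow> (nat \<Rightarrow> nat) measure \<Rightarrow> bool" where
  "equilibrium_state d \<phi> \<mu> \<longleftrightarrow>
     continuous_map (dual_topology d) euclideanreal \<phi> \<and>
     \<mu> \<in> shift_invariant_probs d \<and>
     KS_entropy \<mu> right_shift + ereal (integral\<^sup>L \<mu> \<phi>) = pressure d \<phi>"


section \<open>The induced distance\<close>

lemma in_dual_space_iff: "w \<in> dual_space d \<longleftrightarrow> (\<forall>k. w k < d)"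
  by (auto simp: dual_topology_def)

lemma openin_right_cylinder: "openin (dual_topology d) (right_cylinder d w n)"
proof -
  have eq: "right_cylinder d w n =
      PiE UNIV (\<lambda>k. if k < n then {w k} \<inter> {..<d} else {..<d})"
    by (auto simp: right_cylinder_def in_dual_space_iff PiE_iff split: if_splits) metis
  have "finite {k. (if k < n then {w k} \<inter> {..<d} else {..<d}) \<noteq> {..<d}}"
    by (rule finite_subset[of _ "{..<n}"]) auto
  then show ?thesis
    unfolding eq dual_topology_def
    by (intro product_topology_basis) auto
qed

lemma open_in_dual_borel: "openin (dual_topology d) U \<Longrightarrow> U \<in> sets (dual_borel d)"
  unfolding dual_borel_def
  by (subst sets_measure_of) (auto dest: openin_subset)

lemma smallest_cylinder:
  assumes "u \<in> dual_space d" "v \<in> dual_space d" "\<And>k. k < n \<Longrightarrow> u k = v k" "u n \<noteq> v n"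
  shows "\<Inter>{A. \<exists>w\<in>dual_space d. \<exists>n. A = right_cylinder d w n \<and> u \<in> A \<and> v \<in> A}
           = right_cylinder d u n" (is "\<Inter>?S = _")
proof
  have "right_cylinder d u n \<in> ?S"
    using assms by (auto simp: right_cylinder_def)
  then show "\<Inter>?S \<subseteq> right_cylinder d u n" by blast
next
  show "right_cylinder d u n \<subseteq> \<Inter>?S"
  proof (rule Inter_greatest)
    fix A assume "A \<in> ?S"
    then obtain w m where A: "A = right_cylinder d w m" "u \<in> A" "v \<in> A" by blast
    have "m \<le> n"
      using A assms(4) by (metis (mono_tags, lifting) mem_Collect_eq not_le right_cylinder_def)
    then show "right_cylinder d u n \<subseteq> A"
      using A by (auto simp: right_cylinder_def)
  qed
qed

lemma cylinders_of_point:
  assumes "u \<in> dual_space d"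
  shows "\<Inter>{A. \<exists>w\<in>dual_space d. \<exists>n. A = right_cylinder d w n \<and> u \<in> A \<and> u \<in> A} = {u}"
    (is "\<Inter>?S = _")
proof
  show "\<Inter>?S \<subseteq> {u}"
  proof
    fix v assume v: "v \<in> \<Inter>?S"
    have "v n = u n" for n
    proof -
      have "right_cylinder d u (Suc n) \<in> ?S"
        using assms by (auto simp: right_cylinder_def)
      then have "v \<in> right_cylinder d u (Suc n)"
        using v by (rule InterD[rotated])
      then show ?thesis by (simp add: right_cylinder_def)
    qed
    then show "v \<in> {u}" by auto
  qed
qed auto

lemma null_singleton:
  assumes "is_dual_prob d \<mu>" "non_atomic \<mu>" "u \<in> dual_space d"
  shows "measure \<mu> {u} = 0"
proof -
  have "{u} = (\<Inter>n. right_cylinder d u n)"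
    using assms(3) by (auto simp: right_cylinder_def)
  moreover have "(\<Inter>n. right_cylinder d u n) \<in> sets \<mu>"
  proof (rule sets.countable_INT)
    show "range (right_cylinder d u) \<subseteq> sets \<mu>"
      using assms(1) openin_right_cylinder open_in_dual_borel unfolding is_dual_prob_def by blast
  qed simp
  ultimately have meas: "{u} \<in> sets \<mu>"
    by (simp only:)
  have "\<not> atom \<mu> {u}"
    using assms(2) by (auto simp: non_atomic_def)
  moreover have "emeasure \<mu> B = 0 \<or> emeasure \<mu> B = emeasure \<mu> {u}" if "B \<subseteq> {u}" for B
    using that by (auto simp: subset_singleton_iff)
  ultimately have "emeasure \<mu> {u} = 0"
    using meas by (auto simp: atom_def not_gr_zero)
  then show ?thesis by (simp add: measure_def)
qed

lemma first_mismatch: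
  fixes u v :: "nat \<Rightarrow> nat"
  assumes "u \<noteq> v"
  obtains n where "\<And>k. k < n \<Longrightarrow> u k = v k" "u n \<noteq> v n"
proof -
  define n where "n = (LEAST n. u n \<noteq> v n)"
  have "\<exists>n. u n \<noteq> v n" using assms by auto
  then have "u n \<noteq> v n" unfolding n_def by (rule LeastI_ex)
  moreover have "u k = v k" if "k < n" for k
    using not_less_Least[of k "\<lambda>n. u n \<noteq> v n"] that by (simp add: n_def)
  ultimately show ?thesis using that by blast
qed

lemma Metric_space_induced_dist:
  assumes "is_dual_prob d \<mu>" "non_atomic \<mu>" "measure_support (dual_topology d) \<mu> = dual_space d"
  shows "Metric_space (dual_space d) (induced_dist d \<mu>)"
proof -
  interpret prob_space \<mu> using assms(1) by (simp add: is_dual_prob_def)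
  have cyl: "right_cylinder d u n \<in> sets \<mu>" for u n
    using assms(1) openin_right_cylinder open_in_dual_borel by (auto simp: is_dual_prob_def)
  have refl: "induced_dist d \<mu> u u = 0" if "u \<in> dual_space d" for u
    using null_singleton[OF assms(1,2) that] cylinders_of_point[OF that]
    by (simp add: induced_dist_def)
  have dist: "induced_dist d \<mu> u v = measure \<mu> (right_cylinder d u n)"
    if "u \<in> dual_space d" "v \<in> dual_space d" "\<And>k. k < n \<Longrightarrow> u k = v k" "u n \<noteq> v n" for u v n
    using smallest_cylinder[OF that] by (simp add: induced_dist_def)
  show ?thesis
  proof
    show "0 \<le> induced_dist d \<mu> u v" for u v
      by (simp add: induced_dist_def)
    show "induced_dist d \<mu> u v = induced_dist d \<mu> v u" for u v
      unfolding induced_dist_def by (rule arg_cong[where f = "measure \<mu>"]) blast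
    show "induced_dist d \<mu> u v = 0 \<longleftrightarrow> u = v" if uv: "u \<in> dual_space d" "v \<in> dual_space d" for u v
    proof
      assume 0: "induced_dist d \<mu> u v = 0"
      show "u = v"
      proof (rule ccontr)
        assume "u \<noteq> v"
        then obtain n where n: "\<And>k. k < n \<Longrightarrow> u k = v k" "u n \<noteq> v n"
          using first_mismatch by blast
        have "u \<in> measure_support (dual_topology d) \<mu>" using assms(3) uv by simp
        moreover have "u \<in> right_cylinder d u n" using uv by (simp add: right_cylinder_def)
        ultimately have "0 < emeasure \<mu> (right_cylinder d u n)"
          using openin_right_cylinder unfolding measure_support_def by blast
        then show False
          using 0 dist[OF uv n] by (simp add: emeasure_eq_measure)
      qed
    qed (use refl uv in auto)
    show "induced_dist d \<mu> u z \<le> induced_dist d \<mu> u v + induced_dist d \<mu> v z"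
      if uvz: "u \<in> dual_space d" "v \<in> dual_space d" "z \<in> dual_space d" for u v z
    proof (cases "u = v \<or> v = z \<or> u = z")
      case True
      then show ?thesis using refl uvz by (auto simp: induced_dist_def)
    next
      case False
      obtain a where a: "\<And>k. k < a \<Longrightarrow> u k = v k" "u a \<noteq> v a"
        using False first_mismatch[of u v] by blast
      obtain b where b: "\<And>k. k < b \<Longrightarrow> v k = z k" "v b \<noteq> z b"
        using False first_mismatch[of v z] by blast
      obtain c where c: "\<And>k. k < c \<Longrightarrow> u k = z k" "u c \<noteq> z c"
        using False first_mismatch[of u z] by blast
      have "a \<le> c \<or> b \<le> c" using a(1)[of c] b(1)[of c] c(2) by (metis not_le)
      then show ?thesis
      proof
        assume "a \<le> c"
        then have "right_cylinder d u c \<subseteq> right_cylinder d u a"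
          by (auto simp: right_cylinder_def)
        then have "measure \<mu> (right_cylinder d u c) \<le> measure \<mu> (right_cylinder d u a)"
          by (intro finite_measure_mono cyl)
        then show ?thesis
          using dist[OF uvz(1,3) c] dist[OF uvz(1,2) a] dist[OF uvz(2,3) b]
          by (simp add: add_increasing2)
      next
        assume "b \<le> c"
        then have "right_cylinder d u c \<subseteq> right_cylinder d v b"
          using b(1) c(1) by (auto simp: right_cylinder_def)
        then have "measure \<mu> (right_cylinder d u c) \<le> measure \<mu> (right_cylinder d v b)"
          by (intro finite_measure_mono cyl)
        then show ?thesis
          using dist[OF uvz(1,3) c] dist[OF uvz(1,2) a] dist[OF uvz(2,3) b]
          by (simp add: add_increasing)
      qed
    qed
  qed
qed

lemma right_shift_cylinder:
  assumes "w \<in> dual_space d"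
  shows "right_shift ` right_cylinder d w (Suc n) = right_cylinder d (right_shift w) n"
proof
  show "right_shift ` right_cylinder d w (Suc n) \<subseteq> right_cylinder d (right_shift w) n"
    by (auto simp: right_cylinder_def right_shift_def in_dual_space_iff)
next
  show "right_cylinder d (right_shift w) n \<subseteq> right_shift ` right_cylinder d w (Suc n)"
  proof
    fix v assume v: "v \<in> right_cylinder d (right_shift w) n"
    have "v = right_shift (case_nat (w 0) v)"
      by (simp add: right_shift_def)
    moreover have "case_nat (w 0) v \<in> right_cylinder d w (Suc n)"
      using v assms
      by (auto simp: right_cylinder_def right_shift_def in_dual_space_iff split: nat.split)
    ultimately show "v \<in> right_shift ` right_cylinder d w (Suc n)" by blast
  qed
qed

lemma induced_dist_quotient:
  assumes "w \<in> dual_space d" "u \<in> right_cylinder d w n" "v \<in> right_cylinder d w n"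
    and "u n \<noteq> v n" "0 < n"
  shows "induced_dist d \<mu> (right_shift u) (right_shift v) / induced_dist d \<mu> u v
           = shift_quotient d \<mu> w n"
proof -
  obtain m where m: "n = Suc m" using \<open>0 < n\<close> by (cases n) auto
  have in_dual: "u \<in> dual_space d" "v \<in> dual_space d"
      "right_shift u \<in> dual_space d" "right_shift v \<in> dual_space d"
    using assms by (auto simp: right_cylinder_def in_dual_space_iff right_shift_def)
  have "\<Inter>{A. \<exists>w\<in>dual_space d. \<exists>n. A = right_cylinder d w n \<and> u \<in> A \<and> v \<in> A}
      = right_cylinder d u n"
    by (rule smallest_cylinder[OF in_dual(1,2)]) (use assms in \<open>auto simp: right_cylinder_def\<close>)
  also have "\<dots> = right_cylinder d w n"
    using assms by (auto simp: right_cylinder_def)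
  finally have 1: "induced_dist d \<mu> u v = measure \<mu> (right_cylinder d w n)"
    by (simp add: induced_dist_def)
  have "\<Inter>{A. \<exists>w\<in>dual_space d. \<exists>n. A = right_cylinder d w n \<and> right_shift u \<in> A \<and> right_shift v \<in> A}
      = right_cylinder d (right_shift u) m"
    by (rule smallest_cylinder[OF in_dual(3,4)])
      (use assms m in \<open>auto simp: right_cylinder_def right_shift_def\<close>)
  also have "\<dots> = right_cylinder d (right_shift w) m"
    using assms m by (auto simp: right_cylinder_def right_shift_def)
  also have "\<dots> = right_shift ` right_cylinder d w n"
    using right_shift_cylinder[OF assms(1)] m by simp
  finally have "induced_dist d \<mu> (right_shift u) (right_shift v)
      = measure \<mu> (right_shift ` right_cylinder d w n)"
    by (simp add: induced_dist_def)
  with 1 show ?thesis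
    by (simp add: shift_quotient_def)
qed

end

theory Submission
  imports Defs
begin

text \<open>Put \<open>g = 1 / \<Psi>\<close>. The intervals \<open>I\<^bsub>v j\<^esub>\<close> partition \<open>I\<^sub>v\<close>, so \<open>g\<close> sums to \<open>1\<close> over the
  preimages of a point under the right shift, and bounded distortion of \<open>F\<close> makes \<open>ln g\<close> Hoelder
  continuous. The iterates of the transfer operator of \<open>g\<close> therefore send every Hoelder function
  uniformly to a constant. The constants obtained from cylinders are the cylinder weights of a
  measure whose shift derivative is \<open>\<Psi>\<close>. Conversely, comparing two set functions along a
  descending chain of cylinders shows that a measure with shift derivative \<open>\<Psi>\<close> is fixed by the dual
  transfer operator, so it is shift invariant and its cylinder weights are these constants.

  On cylinders, \<open>ln \<mu>\<close> is a Birkhoff sum of \<open>ln g\<close> up to a bounded error. Gibbs' inequality against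
  \<open>\<mu>\<close> bounds the entropy of any invariant \<open>\<nu>\<close> by \<open>- \<integral>ln g d\<nu>\<close>, with equality for \<open>\<nu> = \<mu>\<close> and the
  partition by the last digit; the pressure is \<open>0\<close>. To treat an arbitrary finite partition in the
  same inequality, its itineraries are predicted by a cylinder labelling with small error.\<close>

section \<open>The dual derivative as a g-function\<close>

text \<open>The hypothesis on a competing measure is only pointwise: the quotients converge at each
  sequence, with no rate uniform in the sequence, so they cannot simply be integrated or multiplied
  along a word. Uniqueness therefore rests on \<open>cylinder_descent\<close>: an inequality with
  slack \<open>1 + e\<close> that fails on some cylinder fails along a whole chain shrinking to one
  sequence, where the pointwise limit contradicts it. All regularity is kept multiplicative, that
  is, stated for \<open>ln g\<close>. On a cylinder of rank n the function g varies by a factor of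
  at most \<open>exp (C * \<tau> ^ n)\<close>, and the exponents have a finite sum over all ranks.
  This is the source of every bound independent of the word length. The entropy is a supremum over
  all finite measurable partitions, whose cells need not be unions of cylinders. A code made of a
  word and an itinerary makes the extra cost per step arbitrarily small and thus reduces them to
  cylinders.\<close>

lemma is_lift_unique:
  assumes "is_lift d f F1" "is_lift d f F2"
  shows "F1 = F2"
proof
  fix x
  have cont: "continuous_on UNIV F1" "continuous_on UNIV F2"
    using assms by (auto simp: is_lift_def homeomorphism_def)
  have int: "F1 x - F2 x \<in> \<int>" for x
  proof -
    have "cis (2 * pi * F1 x) = cis (2 * pi * F2 x)"
      using assms by (simp add: is_lift_def)
    then have "cis (2 * pi * (F1 x - F2 x)) = 1"
      by (simp add: right_diff_distrib flip: cis_divide)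
    then have "cos (2 * pi * (F1 x - F2 x)) = 1"
      by (metis cis.simps(1) one_complex.simps(1))
    then obtain k :: int where "2 * pi * (F1 x - F2 x) = of_int k * 2 * pi"
      using cos_one_2pi_int by metis
    then have "F1 x - F2 x = of_int k" by simp
    then show ?thesis by simp
  qed
  \<comment> \<open>The difference is continuous with integer values on a connected set, hence
    constant; the normalisation at 0 makes it vanish.\<close>
  have "(\<lambda>x. F1 x - F2 x) constant_on UNIV"
  proof (rule continuous_discrete_range_constant)
    show "continuous_on UNIV (\<lambda>x. F1 x - F2 x)"
      using cont by (intro continuous_intros)
    show "\<exists>e>0. \<forall>y. y \<in> UNIV \<and> F1 y - F2 y \<noteq> F1 x - F2 x \<longrightarrow>
        e \<le> norm (F1 y - F2 y - (F1 x - F2 x))" for x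
    proof (intro exI[of _ 1] conjI allI impI)
      fix y assume "y \<in> UNIV \<and> F1 y - F2 y \<noteq> F1 x - F2 x"
      moreover have "F1 y - F2 y - (F1 x - F2 x) \<in> \<int>"
        using Ints_diff[OF int int] .
      ultimately show "1 \<le> norm (F1 y - F2 y - (F1 x - F2 x))"
        by (simp add: Ints_nonzero_abs_ge1)
    qed simp
  qed simp
  then have "F1 x - F2 x = F1 0 - F2 0"
    by (auto simp: constant_on_def)
  then show "F1 x = F2 x" using assms by (simp add: is_lift_def)
qed

lemma is_lift_lift: "circle_endomorphism d f \<Longrightarrow> is_lift d f (lift d f)"
  unfolding circle_endomorphism_def lift_def by (metis is_lift_unique theI)

section \<open>Lengths of the intervals cut out by iterates of the lift\<close>

locale expanding_lift =
  fixes d :: nat and F F' :: "real \<Rightarrow> real" and c r K \<alpha> :: real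
  assumes F_0: "F 0 = 0" and F_surj: "surj F"
    and F_add_1: "\<And>x. F (x + 1) = F x + real d"
    and F_deriv: "\<And>x. (F has_real_derivative F' x) (at x)"
    and c: "0 < c" and r: "1 < r" and \<alpha>: "0 < \<alpha>"
    and expand: "\<And>n x. 1 \<le> n \<Longrightarrow> c * r ^ n \<le> deriv (F ^^ n) x"
    and Holder: "\<And>x y. \<bar>F' x - F' y\<bar> \<le> K * \<bar>x - y\<bar> powr \<alpha>"
begin

lemma F'_ge: "c * r \<le> F' x"
  using expand[of 1 x] F_deriv[of x] by (simp add: DERIV_imp_deriv)

lemma F'_pos: "0 < F' x"
  using F'_ge[of x] c r by (smt (verit) mult_pos_pos)

lemma funpow_deriv: "((F ^^ n) has_real_derivative deriv (F ^^ n) x) (at x)"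
proof -
  have "\<exists>D. ((F ^^ n) has_real_derivative D) (at x)"
  proof (induction n)
    case 0
    show ?case by (auto intro!: exI[of _ 1] derivative_eq_intros simp: id_def)
  next
    case (Suc n)
    then obtain D where "((F ^^ n) has_real_derivative D) (at x)" by blast
    from DERIV_chain[OF F_deriv this] show ?case by (auto simp: o_def)
  qed
  then show ?thesis using DERIV_imp_deriv by blast
qed

lemma funpow_strict_mono: "strict_mono (F ^^ n)"
proof (rule strict_monoI)
  fix x y :: real assume xy: "x < y"
  show "(F ^^ n) x < (F ^^ n) y"
  proof (cases "n = 0")
    case False
    have "0 < deriv (F ^^ n) z" for z
      using expand[of n z] False c r by (smt (verit) One_nat_def Suc_leI bot_nat_0.not_eq_extremum
          mult_pos_pos zero_less_power)
    then show ?thesis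
      using DERIV_pos_imp_increasing[OF xy, of "F ^^ n"] funpow_deriv by blast
  qed (use xy in auto)
qed

lemma funpow_le_iff: "(F ^^ n) x \<le> (F ^^ n) y \<longleftrightarrow> x \<le> y"
  using funpow_strict_mono strict_mono_less_eq by blast

lemma funpow_surj: "surj (F ^^ n)"
  using F_surj by simp

lemma F_add_nat: "F (x + real k) = F x + real k * real d"
proof (induction k)
  case (Suc k)
  have "F (x + real (Suc k)) = F ((x + real k) + 1)" by (simp add: algebra_simps)
  then show ?case using Suc by (simp only: F_add_1) (simp add: algebra_simps)
qed simp

lemma funpow_add_nat: "(F ^^ n) (x + real k) = (F ^^ n) x + real (k * d ^ n)"
proof (induction n arbitrary: k)
  case (Suc n)
  show ?case
    using F_add_nat[of "(F ^^ n) x" "k * d ^ n"] by (simp add: Suc algebra_simps)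
qed simp

text \<open>A word of length n enters only through its number m: its interval runs from
  \<open>endpoint n m\<close> to \<open>endpoint n (Suc m)\<close>. Appending a digit i on the right
  turns m into \<open>m * d + i\<close>, prepending a digit j on the left turns it into
  \<open>m + j * d ^ n\<close>.\<close>

definition endpoint :: "nat \<Rightarrow> nat \<Rightarrow> real" where
  "endpoint n m = inv (F ^^ n) (real m)"

lemma funpow_endpoint: "(F ^^ n) (endpoint n m) = real m"
  unfolding endpoint_def using funpow_surj surj_f_inv_f by metis

lemma endpoint_eqI: "(F ^^ n) x = real m \<Longrightarrow> x = endpoint n m"
  using funpow_endpoint funpow_strict_mono strict_mono_eq by metis

lemma endpoint_le_iff: "endpoint n m \<le> endpoint n k \<longleftrightarrow> m \<le> k"
  using funpow_le_iff[of n "endpoint n m" "endpoint n k"] by (simp add: funpow_endpoint)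

text \<open>The lift sends an integer k to \<open>k * d\<close>, so appending the digit 0 does not
  move the left endpoint. This makes the intervals of successive depths nested.\<close>

lemma endpoint_Suc_mult: "endpoint (Suc n) (m * d) = endpoint n m"
proof (rule endpoint_eqI[symmetric])
  show "(F ^^ Suc n) (endpoint n m) = real (m * d)"
    using F_add_nat[of 0 m] by (simp add: funpow_endpoint F_0)
qed

text \<open>One application of the lift removes the leading digit j, up to translation by the
  integer j.\<close>

lemma F_endpoint: "F (endpoint (Suc n) (m + j * d ^ n)) = endpoint n m + real j"
proof -
  have "(F ^^ n) (F (endpoint (Suc n) (m + j * d ^ n))) = real (m + j * d ^ n)"
    using funpow_endpoint[of "Suc n" "m + j * d ^ n"] by (simp only: funpow_Suc_right o_apply)
  also have "\<dots> = (F ^^ n) (endpoint n m + real j)"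
    by (simp add: funpow_add_nat funpow_endpoint)
  finally show ?thesis using funpow_strict_mono strict_mono_eq by blast
qed

definition len :: "nat \<Rightarrow> nat \<Rightarrow> real" where
  "len n m = endpoint n (Suc m) - endpoint n m"

lemma len_pos: "0 < len n m"
  using endpoint_le_iff[of n "Suc m" m] by (simp add: len_def)

lemma measure_vimage_funpow:
  "measure lborel ((F ^^ n) -` {real m..real m + 1}) = len n m"
proof -
  have "(F ^^ n) -` {real m..real m + 1} = {endpoint n m..endpoint n (Suc m)}"
    using funpow_endpoint[of n m] funpow_endpoint[of n "Suc m"] funpow_le_iff[of n]
    by (auto simp: add.commute) (metis funpow_endpoint add.commute of_nat_Suc)+
  then show ?thesis
    using len_pos[of n m] by (simp add: len_def)
qed

lemma len_le:
  assumes "1 \<le> n"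
  shows "len n m \<le> 1 / (c * r ^ n)"
proof -
  have "\<exists>z. endpoint n m < z \<and> z < endpoint n (Suc m) \<and>
      (F ^^ n) (endpoint n (Suc m)) - (F ^^ n) (endpoint n m)
        = (endpoint n (Suc m) - endpoint n m) * deriv (F ^^ n) z"
    by (rule MVT2) (use len_pos[of n m] funpow_deriv in \<open>auto simp: len_def\<close>)
  then obtain z where "1 = len n m * deriv (F ^^ n) z"
    by (auto simp: funpow_endpoint len_def)
  moreover have "len n m * (c * r ^ n) \<le> len n m * deriv (F ^^ n) z"
    using expand[OF assms] len_pos by (intro mult_left_mono) (auto intro: less_imp_le)
  ultimately show ?thesis
    using c r by (simp add: field_simps)
qed

text \<open>The lengths telescope over consecutive endpoints. Normalising by the right-hand side
  gives the identity that survives as \<open>sum_g\<close> in the limit.\<close>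

lemma sum_len: "(\<Sum>j<d. len (Suc n) (m * d + j)) = len n m"
proof -
  have "(\<Sum>j<d. endpoint (Suc n) (m * d + Suc j) - endpoint (Suc n) (m * d + j))
      = endpoint (Suc n) (m * d + d) - endpoint (Suc n) (m * d + 0)"
    by (rule sum_lessThan_telescope)
  then show ?thesis
    using endpoint_Suc_mult[of n m] endpoint_Suc_mult[of n "Suc m"]
    by (simp add: len_def add.commute)
qed

lemma len_quotient:
  obtains z where "endpoint (Suc n) (m + j * d ^ n) < z" "z < endpoint (Suc n) (Suc m + j * d ^ n)"
    and "len n m = len (Suc n) (m + j * d ^ n) * F' z"
proof -
  let ?a = "endpoint (Suc n) (m + j * d ^ n)" and ?b = "endpoint (Suc n) (Suc m + j * d ^ n)"
  have "\<exists>z. ?a < z \<and> z < ?b \<and> F ?b - F ?a = (?b - ?a) * F' z"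
    by (rule MVT2) (use len_pos[of "Suc n" "m + j * d ^ n"] F_deriv in \<open>auto simp: len_def\<close>)
  then show ?thesis
    using that F_endpoint[of n m j] F_endpoint[of n "Suc m" j] by (auto simp: len_def)
qed

lemma K_nonneg: "0 \<le> K"
  using Holder[of 1 0] by simp

text \<open>The lift carries the interval M and its i-th subinterval onto translates of the interval
  m and its i-th subinterval. By the mean value theorem each length is multiplied by a value of
  \<open>F'\<close>, taken at points y and z that both lie in the interval M. The logarithm of the
  ratio thus changes by \<open>ln (F' y) - ln (F' z)\<close>, which the Hoelder condition and the
  lower bound \<open>c * r\<close> of \<open>F'\<close> control.\<close>

lemma len_ratio_distortion:
  assumes "i < d"
  shows "\<bar>ln (len (Suc (Suc n)) (m * d + i + j * d ^ Suc n) / len (Suc n) (m + j * d ^ n))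
      - ln (len (Suc n) (m * d + i) / len n m)\<bar> \<le> K / (c * r) * len (Suc n) (m + j * d ^ n) powr \<alpha>"
proof -
  define M where "M = m + j * d ^ n"
  have M: "m * d + i + j * d ^ Suc n = M * d + i"
    by (simp add: M_def algebra_simps)
  obtain y where y: "endpoint (Suc n) M < y" "y < endpoint (Suc n) (Suc M)"
    and len_y: "len n m = len (Suc n) M * F' y"
    using len_quotient[of n m j] by (auto simp: M_def)
  obtain z where z: "endpoint (Suc (Suc n)) (M * d + i) < z"
      "z < endpoint (Suc (Suc n)) (Suc (M * d + i))"
    and len_z: "len (Suc n) (m * d + i) = len (Suc (Suc n)) (M * d + i) * F' z"
    using len_quotient[of "Suc n" "m * d + i" j] M by (metis add_Suc)
  have "endpoint (Suc n) M < z"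
    using z(1) endpoint_le_iff[of "Suc (Suc n)" "M * d" "M * d + i"]
    by (simp add: endpoint_Suc_mult)
  moreover have "z < endpoint (Suc n) (Suc M)"
  proof -
    have "Suc (M * d + i) \<le> Suc M * d" using assms by simp
    then have "endpoint (Suc (Suc n)) (Suc (M * d + i)) \<le> endpoint (Suc n) (Suc M)"
      by (metis endpoint_Suc_mult endpoint_le_iff)
    then show ?thesis using z by simp
  qed
  ultimately have yz: "\<bar>y - z\<bar> \<le> len (Suc n) M"
    using y by (simp add: len_def)
  have "ln (len (Suc (Suc n)) (M * d + i) / len (Suc n) M) - ln (len (Suc n) (m * d + i) / len n m)
      = ln (F' y) - ln (F' z)"
    using len_pos F'_pos by (simp add: len_y len_z ln_div ln_mult less_imp_neq[THEN not_sym])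
  moreover have ln_diff: "ln (F' u) - ln (F' v) \<le> \<bar>F' u - F' v\<bar> / (c * r)" for u v
  proof -
    have "ln (F' u) - ln (F' v) \<le> (F' u - F' v) / F' v"
      using F'_pos ln_diff_le by blast
    also have "\<dots> \<le> \<bar>F' u - F' v\<bar> / (c * r)"
      using F'_ge[of v] F'_pos[of v] c r by (intro frac_le) auto
    finally show ?thesis .
  qed
  moreover have "\<bar>F' y - F' z\<bar> / (c * r) \<le> K / (c * r) * len (Suc n) M powr \<alpha>"
  proof -
    have "\<bar>F' y - F' z\<bar> \<le> K * \<bar>y - z\<bar> powr \<alpha>" by (rule Holder)
    also have "\<dots> \<le> K * len (Suc n) M powr \<alpha>"
      using yz K_nonneg \<alpha> by (intro mult_left_mono powr_mono2) auto
    finally show ?thesis using c r by (simp add: divide_right_mono)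
  qed
  ultimately have "\<bar>ln (len (Suc (Suc n)) (M * d + i) / len (Suc n) M)
      - ln (len (Suc n) (m * d + i) / len n m)\<bar> \<le> K / (c * r) * len (Suc n) M powr \<alpha>"
    using ln_diff[of y z] ln_diff[of z y, unfolded abs_minus_commute[of "F' z"]] by linarith
  then show ?thesis unfolding M M_def[symmetric] .
qed

section \<open>Ratios of nested intervals along a left-infinite sequence\<close>

definition number :: "nat \<Rightarrow> (nat \<Rightarrow> nat) \<Rightarrow> nat" where
  "number n w = (\<Sum>k<n. w k * d ^ k)"

lemma number_Suc: "number (Suc n) w = number n w + w n * d ^ n"
  by (simp add: number_def)

lemma number_Suc_shift: "number (Suc n) w = number n (right_shift w) * d + w 0"
  unfolding number_def right_shift_def
  by (simp add: sum.lessThan_Suc_shift sum_distrib_right del: sum.lessThan_Suc)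
    (simp add: algebra_simps)

text \<open>The reciprocal of the quotient in the dual derivative, for the word of length n + 1.
  Inverting it turns the relation between an interval and its parts into a sum of weights equal to
  1.\<close>

definition ratio :: "nat \<Rightarrow> (nat \<Rightarrow> nat) \<Rightarrow> real" where
  "ratio n w = len (Suc n) (number (Suc n) w) / len n (number n (right_shift w))"

lemma ratio_pos: "0 < ratio n w"
  by (simp add: ratio_def len_pos)

lemma ratio_cong: "(\<And>k. k \<le> n \<Longrightarrow> u k = v k) \<Longrightarrow> ratio n u = ratio n v"
  by (simp add: ratio_def number_def right_shift_def)

lemma sum_ratio: "(\<Sum>j<d. ratio n (case_nat j w)) = 1"
proof -
  have "(\<Sum>j<d. ratio n (case_nat j w))
      = (\<Sum>j<d. len (Suc n) (number n w * d + j) / len n (number n w))"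
    by (simp add: ratio_def number_Suc_shift right_shift_def)
  also have "\<dots> = 1"
    using len_pos[of n "number n w"] by (simp add: sum_len flip: sum_divide_distrib)
  finally show ?thesis .
qed

text \<open>With lengths at most \<open>1 / (c * r ^ n)\<close>, the distortion bound
  \<open>K / (c * r) * len powr \<alpha>\<close> becomes \<open>A * \<tau> ^ n\<close>; the next
  definition collects the factors free of n.\<close>

definition \<tau> :: real where "\<tau> = (1 / r) powr \<alpha>"

definition A :: real where "A = K / (c * r) * (1 / c) powr \<alpha>"

lemma \<tau>: "0 < \<tau>" "\<tau> < 1"
  using r \<alpha> powr_less_mono2[of \<alpha> "1 / r" 1] by (simp_all add: \<tau>_def)

lemma A_nonneg: "0 \<le> A"
  using K_nonneg c r by (simp add: A_def)

text \<open>Raising n prepends the digit \<open>w (Suc n)\<close> on the left of both words, which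
  is the situation of \<open>len_ratio_distortion\<close>.\<close>

lemma ratio_Suc:
  assumes "w \<in> dual_space d"
  shows "\<bar>ln (ratio (Suc n) w) - ln (ratio n w)\<bar> \<le> A * \<tau> ^ n"
proof -
  let ?m = "number n (right_shift w)"
  have "w 0 < d" using assms by (simp add: in_dual_space_iff)
  have 1: "number (Suc (Suc n)) w = ?m * d + w 0 + w (Suc n) * d ^ Suc n"
    using number_Suc[of "Suc n" w] by (simp add: number_Suc_shift)
  have 2: "number (Suc n) (right_shift w) = ?m + w (Suc n) * d ^ n"
    using number_Suc[of n "right_shift w"] by (simp add: right_shift_def)
  have "\<bar>ln (ratio (Suc n) w) - ln (ratio n w)\<bar>
      \<le> K / (c * r) * len (Suc n) (?m + w (Suc n) * d ^ n) powr \<alpha>"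
    using len_ratio_distortion[OF \<open>w 0 < d\<close>, of n ?m "w (Suc n)"]
    unfolding ratio_def 1 2 number_Suc_shift[of n w] .
  also have "\<dots> \<le> K / (c * r) * ((1 / c) * (1 / r) ^ n) powr \<alpha>"
  proof (intro mult_left_mono powr_mono2)
    have "len (Suc n) (?m + w (Suc n) * d ^ n) \<le> 1 / (c * r ^ Suc n)"
      by (rule len_le) simp
    also have "\<dots> \<le> 1 / (c * r ^ n)"
      using c r by (intro divide_left_mono mult_left_mono power_increasing) auto
    finally show "len (Suc n) (?m + w (Suc n) * d ^ n) \<le> 1 / c * (1 / r) ^ n"
      by (simp add: power_one_over)
  qed (use K_nonneg c r \<alpha> in \<open>auto intro: less_imp_le len_pos\<close>)
  also have "\<dots> = A * \<tau> ^ n"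
  proof -
    have "((1 / r) ^ n) powr \<alpha> = \<tau> ^ n"
      using r by (simp add: \<tau>_def powr_powr mult.commute flip: powr_realpow)
    moreover have "(1 / c * (1 / r) ^ n) powr \<alpha> = (1 / c) powr \<alpha> * ((1 / r) ^ n) powr \<alpha>"
      by (rule powr_mult)
    ultimately show ?thesis by (simp only: A_def mult.assoc)
  qed
  finally show ?thesis .
qed

definition g :: "(nat \<Rightarrow> nat) \<Rightarrow> real" where
  "g w = lim (\<lambda>n. ratio n w)"

text \<open>The increments of \<open>ln (ratio n w)\<close> are bounded by a geometric sequence, so
  the logarithms converge with a geometric tail. Working with logarithms also keeps the limit away
  from 0.\<close>

lemma ratio_limit:
  assumes w: "w \<in> dual_space d"
  shows "(\<lambda>n. ratio n w) \<longlonglongrightarrow> g w" and "0 < g w"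
    and "\<bar>ln (g w) - ln (ratio n w)\<bar> \<le> A / (1 - \<tau>) * \<tau> ^ n"
proof -
  define a where "a n = ln (ratio n w)" for n
  have bound: "norm (a (Suc k) - a k) \<le> A * \<tau> ^ k" for k
    using ratio_Suc[OF w] by (simp add: a_def)
  have sm: "summable (\<lambda>k. A * \<tau> ^ k)"
    using \<tau> by (intro summable_mult summable_geometric) auto
  have sa: "summable (\<lambda>k. a (Suc k) - a k)"
    by (rule summable_comparison_test'[OF sm]) (rule bound)
  then have "(\<lambda>n. a n - a 0) \<longlonglongrightarrow> (\<Sum>k. a (Suc k) - a k)"
    using summable_LIMSEQ[of "\<lambda>k. a (Suc k) - a k"] by (simp add: sum_lessThan_telescope)
  then obtain l where l: "a \<longlonglongrightarrow> l"
    using tendsto_add[OF _ tendsto_const[of "a 0"]] by fastforce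
  have "(\<lambda>n. exp (a n)) \<longlonglongrightarrow> exp l"
    by (intro tendsto_exp l)
  then have lim: "(\<lambda>n. ratio n w) \<longlonglongrightarrow> exp l"
    by (simp add: a_def ratio_pos)
  then have g: "g w = exp l"
    unfolding g_def by (rule limI)
  show "(\<lambda>n. ratio n w) \<longlonglongrightarrow> g w" "0 < g w"
    using lim by (simp_all add: g)
  have partial: "\<bar>a (n + k) - a n\<bar> \<le> A / (1 - \<tau>) * \<tau> ^ n" for k
  proof -
    have "\<bar>a (n + k) - a n\<bar> = \<bar>\<Sum>i<k. a (Suc (n + i)) - a (n + i)\<bar>"
      using sum_lessThan_telescope[of "\<lambda>i. a (n + i)" k] by simp
    also have "\<dots> \<le> (\<Sum>i<k. A * \<tau> ^ (n + i))"
      using bound by (intro sum_abs[THEN order_trans] sum_mono) simp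
    also have "\<dots> = A * \<tau> ^ n * (\<Sum>i<k. \<tau> ^ i)"
      by (simp add: power_add sum_distrib_left mult.assoc)
    also have "\<dots> \<le> A * \<tau> ^ n * (1 / (1 - \<tau>))"
      using \<tau> A_nonneg sum_le_suminf[of "\<lambda>i. \<tau> ^ i" "{..<k}"] suminf_geometric[of \<tau>]
      by (intro mult_left_mono) (auto simp: summable_geometric)
    finally show ?thesis by (simp add: ac_simps)
  qed
  have "(\<lambda>k. \<bar>a (n + k) - a n\<bar>) \<longlonglongrightarrow> \<bar>l - a n\<bar>"
    using LIMSEQ_ignore_initial_segment[OF l, of n]
    by (intro tendsto_intros) (simp add: add.commute)
  then have "\<bar>l - a n\<bar> \<le> A / (1 - \<tau>) * \<tau> ^ n"
    by (rule LIMSEQ_le_const2) (use partial in auto)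
  then show "\<bar>ln (g w) - ln (ratio n w)\<bar> \<le> A / (1 - \<tau>) * \<tau> ^ n"
    by (simp add: g a_def)
qed

lemma sum_g:
  assumes "w \<in> dual_space d"
  shows "(\<Sum>j<d. g (case_nat j w)) = 1"
proof -
  have "(\<lambda>n. \<Sum>j<d. ratio n (case_nat j w)) \<longlonglongrightarrow> (\<Sum>j<d. g (case_nat j w))"
    using assms by (intro tendsto_sum ratio_limit) (auto simp: in_dual_space_iff split: nat.split)
  then show ?thesis
    by (simp add: sum_ratio LIMSEQ_const_iff)
qed

text \<open>\<open>ratio 0 w\<close> depends only on the digit \<open>w 0\<close>, so finitely many
  values occur; their sum serves as a common bound.\<close>

definition B :: real where
  "B = (\<Sum>j<d. \<bar>ln (ratio 0 (\<lambda>_. j))\<bar>)"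

lemma ln_ratio_0_le:
  assumes "w \<in> dual_space d"
  shows "\<bar>ln (ratio 0 w)\<bar> \<le> B"
proof -
  have "\<bar>ln (ratio 0 w)\<bar> = \<bar>ln (ratio 0 (\<lambda>_. w 0))\<bar>"
    using ratio_cong[of 0 w "\<lambda>_. w 0"] by simp
  also have "\<dots> \<le> B"
    unfolding B_def using assms by (intro member_le_sum) (auto simp: in_dual_space_iff)
  finally show ?thesis .
qed

lemma ln_g_le:
  assumes "w \<in> dual_space d"
  shows "\<bar>ln (g w)\<bar> \<le> A / (1 - \<tau>) + B"
  using ratio_limit(3)[OF assms, of 0] ln_ratio_0_le[OF assms] by simp

text \<open>Since \<open>ratio m\<close> reads m + 1 digits, it agrees on both sequences when
  \<open>n = Suc m\<close>, and each limit is within a geometric tail of that common value. The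
  index lost here accounts for the division by \<tau>. For n = 0 no digit is shared, and the uniform
  bound on \<open>ln g\<close> takes over.\<close>

lemma ln_g_Holder:
  assumes u: "u \<in> dual_space d" and v: "v \<in> dual_space d" and uv: "\<And>k. k < n \<Longrightarrow> u k = v k"
  shows "\<bar>ln (g u) - ln (g v)\<bar> \<le> 2 * (A / (1 - \<tau>) + B) / \<tau> * \<tau> ^ n"
proof (cases n)
  case 0
  have B: "0 \<le> B" by (simp add: B_def sum_nonneg)
  have "\<bar>ln (g u) - ln (g v)\<bar> \<le> 2 * (A / (1 - \<tau>) + B)"
    unfolding mult_2 using ln_g_le[OF u] ln_g_le[OF v] by linarith
  also have "\<dots> \<le> 2 * (A / (1 - \<tau>) + B) / \<tau>"
    using \<tau> A_nonneg B by (simp add: pos_le_divide_eq mult_left_le)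
  finally show ?thesis using 0 by simp
next
  case (Suc m)
  have B: "0 \<le> B" by (simp add: B_def sum_nonneg)
  have "ratio m u = ratio m v" using uv Suc by (intro ratio_cong) auto
  then have "\<bar>ln (g u) - ln (g v)\<bar> \<le> 2 * (A / (1 - \<tau>)) * \<tau> ^ m"
    using ratio_limit(3)[OF u, of m] ratio_limit(3)[OF v, of m] by simp
  also have "\<dots> \<le> 2 * (A / (1 - \<tau>) + B) * \<tau> ^ m"
    using B \<tau> by (intro mult_right_mono) auto
  finally show ?thesis using Suc \<tau> by simp
qed

end

text \<open>Digits are appended on the right, so \<open>case_nat j w\<close> is the sequence \<open>w\<^sup>* j\<close>.\<close>

definition g_function :: "nat \<Rightarrow> ((nat \<Rightarrow> nat) \<Rightarrow> real) \<Rightarrow> real \<Rightarrow> real \<Rightarrow> real \<Rightarrow> bool" where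
  "g_function d g C \<tau> \<delta> \<longleftrightarrow> 0 \<le> C \<and> 0 < \<tau> \<and> \<tau> < 1 \<and> 0 < \<delta> \<and>
     (\<forall>w\<in>dual_space d. \<delta> \<le> g w) \<and>
     (\<forall>w\<in>dual_space d. (\<Sum>j<d. g (case_nat j w)) = 1) \<and>
     (\<forall>u\<in>dual_space d. \<forall>v\<in>dual_space d. \<forall>n. (\<forall>k<n. u k = v k) \<longrightarrow>
        \<bar>ln (g u) - ln (g v)\<bar> \<le> C * \<tau> ^ n)"

text \<open>A word lists its most significant digit first, while positions in w count from the
  right; the two reversals cancel.\<close>

lemma word_number_digits:
  "word_number d (digits w a b) = (\<Sum>k<b - a. w (a + k) * d ^ k)"
proof -
  have len: "length (digits w a b) = b - a" by (simp add: digits_def)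
  have nth: "digits w a b ! k = w (a + (b - a - 1 - k))" if "k < b - a" for k
    using that by (simp add: digits_def rev_nth)
  have "word_number d (digits w a b)
      = (\<Sum>k<b - a. w (a + (b - a - Suc k)) * d ^ (b - a - Suc k))"
    by (simp add: word_number_def len nth)
  also have "\<dots> = (\<Sum>k<b - a. w (a + k) * d ^ k)"
    by (rule sum.nat_diff_reindex)
  finally show ?thesis .
qed

lemma dual_derivative_g_function:
  assumes f: "f \<in> C1_plus d"
  obtains g C \<tau> \<delta> where "g_function d g C \<tau> \<delta>"
    and "\<And>w. w \<in> dual_space d \<Longrightarrow> dual_derivative d f w = 1 / g w"
proof -
  define F where "F = lift d f"
  have lift: "is_lift d f F"
    using f is_lift_lift by (auto simp: C1_plus_def F_def)
  have "C1_Holder F" "expanding F" using f by (auto simp: C1_plus_def F_def)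
  then obtain \<alpha> K c r where diff: "\<And>x. F differentiable (at x)"
    and \<alpha>: "0 < \<alpha>" and Holder: "\<And>x y. \<bar>deriv F x - deriv F y\<bar> \<le> K * \<bar>x - y\<bar> powr \<alpha>"
    and c: "0 < c" and r: "1 < r" and ex: "\<And>n x. 1 \<le> n \<Longrightarrow> c * r ^ n \<le> deriv (F ^^ n) x"
    unfolding C1_Holder_def expanding_def by metis
  interpret expanding_lift d F "deriv F" c r K \<alpha>
  proof
    show "surj F" using lift by (auto simp: is_lift_def homeomorphism_def)
    show "(F has_real_derivative deriv F x) (at x)" for x
      using diff[of x] DERIV_deriv_iff_real_differentiable by blast
  qed (use lift \<alpha> Holder c r ex in \<open>auto simp: is_lift_def\<close>)
  have meas: "measure lborel (word_interval d f (digits w a b))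
      = len (b - a) (\<Sum>k<b - a. w (a + k) * d ^ k)" for w a b
    unfolding word_interval_def word_number_digits
    using measure_vimage_funpow[of "b - a" "\<Sum>k<b - a. w (a + k) * d ^ k"]
    by (simp only: F_def digits_def length_map length_rev length_upt)
  have "dual_derivative d f w = 1 / g w" if w: "w \<in> dual_space d" for w
  proof -
    have "(\<lambda>n. 1 / ratio n w) \<longlonglongrightarrow> 1 / g w"
      using ratio_limit(1,2)[OF w] by (intro tendsto_intros) auto
    \<comment> \<open>The index is shifted by one: \<open>ratio n\<close> belongs to the quotient at
      \<open>Suc n\<close>, so the initial quotient is dropped.\<close>
    also have "(\<lambda>n. 1 / ratio n w) = (\<lambda>n. measure lborel (word_interval d f (digits w 1 (Suc n))) /
        measure lborel (word_interval d f (digits w 0 (Suc n))))"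
      by (simp add: meas ratio_def number_def right_shift_def)
    finally show ?thesis
      unfolding dual_derivative_def by (intro limI) (rule LIMSEQ_imp_Suc)
  qed
  \<comment> \<open>The positive lower bound for g is the exponential of minus the uniform bound on
    \<open>\<bar>ln (g w)\<bar>\<close>.\<close>
  moreover have "g_function d g (2 * (A / (1 - \<tau>) + B) / \<tau>) \<tau> (exp (- (A / (1 - \<tau>) + B)))"
    unfolding g_function_def
  proof (intro conjI ballI allI impI)
    show "0 \<le> 2 * (A / (1 - \<tau>) + B) / \<tau>"
      using A_nonneg \<tau> by (simp add: B_def sum_nonneg)
    show "exp (- (A / (1 - \<tau>) + B)) \<le> g w" if "w \<in> dual_space d" for w
      using ln_g_le[OF that] ratio_limit(2)[OF that]
      by (subst ln_ge_iff[symmetric]) auto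
  qed (use \<tau> sum_g ln_g_Holder in auto)
  ultimately show ?thesis using that by blast
qed

section \<open>Cylinders\<close>

lemma space_dual_borel [simp]: "space (dual_borel d) = dual_space d"
  unfolding dual_borel_def by (rule space_measure_of) (auto dest: openin_subset)

lemma case_nat_in_dual_space: "j < d \<Longrightarrow> w \<in> dual_space d \<Longrightarrow> case_nat j w \<in> dual_space d"
  by (auto simp: in_dual_space_iff split: nat.split)

lemma right_shift_in_dual_space: "w \<in> dual_space d \<Longrightarrow> right_shift w \<in> dual_space d"
  by (auto simp: in_dual_space_iff right_shift_def)

lemma case_nat_right_shift: "case_nat (w 0) (right_shift w) = w"
  by (auto simp: right_shift_def split: nat.split)

lemma openin_dual_topologyD:
  assumes "openin (dual_topology d) U" "w \<in> U"
  obtains n where "right_cylinder d w n \<subseteq> U"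
proof -
  obtain V where V: "finite {i. V i \<noteq> {..<d}}" "w \<in> PiE UNIV V" "PiE UNIV V \<subseteq> U"
  proof -
    from assms obtain V where "finite {i \<in> UNIV. V i \<noteq> topspace (discrete_topology {..<d})}"
      "w \<in> PiE UNIV V" "PiE UNIV V \<subseteq> U"
      unfolding dual_topology_def openin_product_topology_alt by meson
    then show ?thesis using that by simp
  qed
  obtain n where n: "\<And>i. V i \<noteq> {..<d} \<Longrightarrow> i < n"
    using V(1) unfolding finite_nat_set_iff_bounded by auto
  have "right_cylinder d w n \<subseteq> PiE UNIV V"
  proof
    fix v assume v: "v \<in> right_cylinder d w n"
    have "v i \<in> V i" for i
    proof (cases "V i = {..<d}")
      case True
      then show ?thesis using v by (auto simp: right_cylinder_def in_dual_space_iff)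
    next
      case False
      then have "v i = w i" using v n by (auto simp: right_cylinder_def)
      then show ?thesis using V(2) by auto
    qed
    then show "v \<in> PiE UNIV V" by (simp add: PiE_iff)
  qed
  then have "right_cylinder d w n \<subseteq> U" using V(3) by (rule subset_trans)
  then show ?thesis by (rule that)
qed

definition cylinders :: "nat \<Rightarrow> (nat \<Rightarrow> nat) set set" where
  "cylinders d = {right_cylinder d w n | w n. w \<in> dual_space d}"

lemma countable_cylinders: "countable (cylinders d)"
proof -
  have "right_cylinder d w n
      = {v \<in> dual_space d. \<forall>k<length (map w [0..<n]). v k = map w [0..<n] ! k}" for w n
    by (auto simp: right_cylinder_def)
  then have "cylinders d \<subseteq> range (\<lambda>l. {v \<in> dual_space d. \<forall>k<length l. v k = l ! k})"
    unfolding cylinders_def by fast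
  then show ?thesis by (rule countable_subset) simp
qed

lemma cylinders_subset: "cylinders d \<subseteq> Pow (dual_space d)"
  by (auto simp: cylinders_def right_cylinder_def)

text \<open>An open set is the union of the cylinders it contains, and there are only countably many
  cylinders. Measurability and equality of measures may therefore be tested on cylinders.\<close>

lemma sets_dual_borel: "sets (dual_borel d) = sigma_sets (dual_space d) (cylinders d)"
proof
  have "U \<in> sigma_sets (dual_space d) (cylinders d)" if U: "openin (dual_topology d) U" for U
  proof -
    have "U = \<Union>{A \<in> cylinders d. A \<subseteq> U}"
    proof
      show "U \<subseteq> \<Union>{A \<in> cylinders d. A \<subseteq> U}"
      proof
        fix w assume w: "w \<in> U"
        then have wd: "w \<in> dual_space d" using openin_subset[OF U] by blast
        obtain n where "right_cylinder d w n \<subseteq> U" by (rule openin_dual_topologyD[OF U w])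
        moreover have "w \<in> right_cylinder d w n" using wd by (simp add: right_cylinder_def)
        ultimately show "w \<in> \<Union>{A \<in> cylinders d. A \<subseteq> U}"
          using wd unfolding cylinders_def by blast
      qed
    qed blast
    moreover have "\<Union>{A \<in> cylinders d. A \<subseteq> U} \<in> sigma_sets (dual_space d) (cylinders d)"
      by (rule sigma_sets_UNION)
        (auto intro: countable_subset[OF _ countable_cylinders] sigma_sets.Basic)
    ultimately show ?thesis by simp
  qed
  then show "sets (dual_borel d) \<subseteq> sigma_sets (dual_space d) (cylinders d)"
    unfolding dual_borel_def
    by (subst sets_measure_of) (auto dest: openin_subset intro!: sigma_sets_mono)
  show "sigma_sets (dual_space d) (cylinders d) \<subseteq> sets (dual_borel d)"
  proof -
    have "cylinders d \<subseteq> sets (dual_borel d)"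
      using openin_right_cylinder open_in_dual_borel by (auto simp: cylinders_def)
    then show ?thesis
      using sets.sigma_sets_subset[of "cylinders d" "dual_borel d"] by simp
  qed
qed

lemma cylinder_in_sets [measurable, simp]: "right_cylinder d w n \<in> sets (dual_borel d)"
  by (rule open_in_dual_borel[OF openin_right_cylinder])

lemma cylinder_in_sets_prob: "is_dual_prob d \<mu> \<Longrightarrow> right_cylinder d w n \<in> sets \<mu>"
  by (simp add: is_dual_prob_def)

lemma space_dual_prob: "is_dual_prob d \<mu> \<Longrightarrow> space \<mu> = dual_space d"
  unfolding is_dual_prob_def using sets_eq_imp_space_eq[of \<mu> "dual_borel d"] by simp

lemma right_cylinder_0 [simp]: "right_cylinder d w 0 = dual_space d"
  by (simp add: right_cylinder_def)

lemma right_cylinder_cong: "(\<And>k. k < n \<Longrightarrow> u k = v k) \<Longrightarrow> right_cylinder d u n = right_cylinder d v n"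
  by (auto simp: right_cylinder_def)

lemma self_in_cylinder: "w \<in> dual_space d \<Longrightarrow> w \<in> right_cylinder d w n"
  by (simp add: right_cylinder_def)

lemma right_cylinder_split:
  "right_cylinder d w n = (\<Union>j<d. right_cylinder d (w(n := j)) (Suc n))"
  by (auto simp: right_cylinder_def in_dual_space_iff less_Suc_eq)

lemma disjoint_right_cylinder_split:
  "disjoint_family_on (\<lambda>j. right_cylinder d (w(n := j)) (Suc n)) J"
  by (auto simp: disjoint_family_on_def right_cylinder_def)

lemma Int_cylinders:
  assumes "right_cylinder d u n \<inter> right_cylinder d v m \<noteq> {}" "n \<le> m"
  shows "right_cylinder d u n \<inter> right_cylinder d v m = right_cylinder d v m"
proof -
  have "u k = v k" if "k < n" for k
    using assms that by (auto simp: right_cylinder_def)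
  then show ?thesis using assms(2) by (auto simp: right_cylinder_def)
qed

text \<open>Two cylinders are either nested or disjoint; the empty set is added for the second
  case.\<close>

lemma Int_stable_cylinders: "Int_stable (insert {} (cylinders d))"
proof (rule Int_stableI)
  fix A B assume "A \<in> insert {} (cylinders d)" "B \<in> insert {} (cylinders d)"
  then consider "A = {} \<or> B = {}" | "A \<inter> B = {}"
    | u n v m where "A = right_cylinder d u n" "B = right_cylinder d v m"
      "u \<in> dual_space d" "v \<in> dual_space d" "A \<inter> B \<noteq> {}"
    unfolding cylinders_def by blast
  then show "A \<inter> B \<in> insert {} (cylinders d)"
  proof cases
    case (3 u n v m)
    then have "A \<inter> B = right_cylinder d u n \<or> A \<inter> B = right_cylinder d v m"
      using Int_cylinders[of d u n v m] Int_cylinders[of d v m u n]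
      by (metis inf_commute nle_le)
    then show ?thesis using 3 by (auto simp: cylinders_def)
  qed auto
qed

lemma measure_eqI_cylinders:
  assumes sets: "sets \<mu> = sets (dual_borel d)" "sets \<nu> = sets (dual_borel d)"
    and fin: "finite_measure \<mu>" "finite_measure \<nu>"
    and eq: "\<And>w n. w \<in> dual_space d \<Longrightarrow> measure \<mu> (right_cylinder d w n) = measure \<nu> (right_cylinder d w n)"
    and d: "0 < d"
  shows "\<mu> = \<nu>"
proof (rule measure_eqI_generator_eq[OF Int_stable_cylinders, of d "dual_space d" \<mu> \<nu> "\<lambda>_. dual_space d"])
  have gen: "sigma_sets (dual_space d) (insert {} (cylinders d)) = sigma_sets (dual_space d) (cylinders d)"
    by (rule sigma_sets_eqI) (auto intro: sigma_sets.intros)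
  show "sets \<mu> = sigma_sets (dual_space d) (insert {} (cylinders d))"
    "sets \<nu> = sigma_sets (dual_space d) (insert {} (cylinders d))"
    using sets by (simp_all add: gen sets_dual_borel)
  show "emeasure \<mu> A = emeasure \<nu> A" if "A \<in> insert {} (cylinders d)" for A
    using that eq fin by (auto simp: cylinders_def finite_measure.emeasure_eq_measure)
  have "(\<lambda>_. 0) \<in> dual_space d" using d by (simp add: in_dual_space_iff)
  then show "range (\<lambda>_::nat. dual_space d) \<subseteq> insert {} (cylinders d)"
    unfolding cylinders_def using right_cylinder_0 by blast
  show "emeasure \<mu> (dual_space d) \<noteq> \<infinity>"
    using fin by (simp add: finite_measure.emeasure_finite)
qed (use cylinders_subset in auto)

lemma borel_measurable_continuous_dual:
  assumes "continuous_map (dual_topology d) euclideanreal \<phi>"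
  shows "\<phi> \<in> borel_measurable (dual_borel d)"
proof (rule borel_measurableI)
  fix S :: "real set" assume "open S"
  then have "openin (dual_topology d) {x \<in> dual_space d. \<phi> x \<in> S}"
    using assms by (simp add: continuous_map_def)
  moreover have "{x \<in> dual_space d. \<phi> x \<in> S} = \<phi> -` S \<inter> space (dual_borel d)" by auto
  ultimately show "\<phi> -` S \<inter> space (dual_borel d) \<in> sets (dual_borel d)"
    using open_in_dual_borel by metis
qed

lemma continuous_map_dualI:
  fixes \<phi> :: "(nat \<Rightarrow> nat) \<Rightarrow> real"
  assumes \<tau>: "0 \<le> \<tau>" "\<tau> < 1"
    and \<phi>: "\<And>u v n. u \<in> dual_space d \<Longrightarrow> v \<in> dual_space d \<Longrightarrow> (\<And>k. k < n \<Longrightarrow> u k = v k) \<Longrightarrow>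
      \<bar>\<phi> u - \<phi> v\<bar> \<le> C * \<tau> ^ n"
  shows "continuous_map (dual_topology d) euclideanreal \<phi>"
  unfolding continuous_map_def
proof (intro conjI allI impI)
  fix U :: "real set" assume "openin euclideanreal U"
  then have U: "open U" by simp
  show "openin (dual_topology d) {x \<in> dual_space d. \<phi> x \<in> U}"
  proof (subst openin_subopen, intro ballI)
    fix x assume x: "x \<in> {x \<in> dual_space d. \<phi> x \<in> U}"
    then obtain e where e: "0 < e" "\<And>y. \<bar>y - \<phi> x\<bar> < e \<Longrightarrow> y \<in> U"
      using U by (auto simp: open_dist dist_real_def)
    have "(\<lambda>n. C * \<tau> ^ n) \<longlonglongrightarrow> C * 0"
      using \<tau> by (intro tendsto_intros LIMSEQ_power_zero) auto
    then have "eventually (\<lambda>n. C * \<tau> ^ n < e) sequentially"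
      using e(1) by (intro order_tendstoD) auto
    then obtain n where n: "C * \<tau> ^ n < e"
      using eventually_happens'[OF sequentially_bot] by blast
    have "right_cylinder d x n \<subseteq> {x \<in> dual_space d. \<phi> x \<in> U}"
    proof
      fix v assume v: "v \<in> right_cylinder d x n"
      then have "\<bar>\<phi> v - \<phi> x\<bar> \<le> C * \<tau> ^ n"
        using x by (intro \<phi>) (auto simp: right_cylinder_def)
      then show "v \<in> {x \<in> dual_space d. \<phi> x \<in> U}"
        using n e(2) v by (auto simp: right_cylinder_def)
    qed
    then show "\<exists>T. openin (dual_topology d) T \<and> x \<in> T \<and> T \<subseteq> {x \<in> dual_space d. \<phi> x \<in> U}"
      using x openin_right_cylinder[of d x n] self_in_cylinder[of x d n] by auto
  qed
qed auto

section \<open>Measurability of the shift and of its inverse branches\<close>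

lemma measurable_case_nat [measurable]:
  assumes j: "j < d"
  shows "case_nat j \<in> measurable (dual_borel d) (dual_borel d)"
proof -
  have "case_nat j \<in> measurable (dual_borel d) (sigma (dual_space d) (cylinders d))"
  proof (rule measurable_measure_of[OF cylinders_subset])
    show "case_nat j \<in> space (dual_borel d) \<rightarrow> dual_space d"
      using j by (auto intro!: case_nat_in_dual_space)
    fix A assume "A \<in> cylinders d"
    then obtain w n where A: "A = right_cylinder d w n" by (auto simp: cylinders_def)
    have "case_nat j -` A \<inter> dual_space d
        = (if n = 0 \<or> w 0 = j then right_cylinder d (right_shift w) (n - 1) else {})"
    proof (cases n)
      case 0
      then show ?thesis using j by (auto simp: A intro!: case_nat_in_dual_space)
    next
      case (Suc m)
      then show ?thesis
        using j case_nat_in_dual_space[OF j]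
        by (auto simp: A right_cylinder_def right_shift_def split: nat.split)
    qed
    then show "case_nat j -` A \<inter> space (dual_borel d) \<in> sets (dual_borel d)" by simp
  qed
  moreover have "sets (sigma (dual_space d) (cylinders d)) = sets (dual_borel d)"
    by (simp add: sets_dual_borel sets_measure_of[OF cylinders_subset])
  ultimately show ?thesis using measurable_cong_sets by blast
qed

lemma measurable_right_shift [measurable]:
  "right_shift \<in> measurable (dual_borel d) (dual_borel d)"
proof -
  have "right_shift \<in> measurable (dual_borel d) (sigma (dual_space d) (cylinders d))"
  proof (rule measurable_measure_of[OF cylinders_subset])
    show "right_shift \<in> space (dual_borel d) \<rightarrow> dual_space d"
      by (auto intro!: right_shift_in_dual_space)
    fix A assume "A \<in> cylinders d"
    then obtain w n where A: "A = right_cylinder d w n" by (auto simp: cylinders_def)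
    have "right_shift -` A \<inter> dual_space d = (\<Union>j<d. right_cylinder d (case_nat j w) (Suc n))"
      by (auto simp: A right_cylinder_def right_shift_in_dual_space split: nat.split)
        (auto simp: right_shift_def in_dual_space_iff)
    then show "right_shift -` A \<inter> space (dual_borel d) \<in> sets (dual_borel d)" by simp
  qed
  moreover have "sets (sigma (dual_space d) (cylinders d)) = sets (dual_borel d)"
    by (simp add: sets_dual_borel sets_measure_of[OF cylinders_subset])
  ultimately show ?thesis using measurable_cong_sets by blast
qed

section \<open>The transfer operator\<close>

locale g_system =
  fixes d :: nat and g :: "(nat \<Rightarrow> nat) \<Rightarrow> real" and C \<tau> \<delta> :: real
  assumes d: "2 \<le> d" and g_function: "g_function d g C \<tau> \<delta>"
begin

abbreviation X :: "(nat \<Rightarrow> nat) set" where "X \<equiv> dual_space d"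

lemma C: "0 \<le> C" and \<tau>: "0 < \<tau>" "\<tau> < 1" and \<delta>: "0 < \<delta>"
  and g_ge: "w \<in> X \<Longrightarrow> \<delta> \<le> g w"
  and sum_g: "w \<in> X \<Longrightarrow> (\<Sum>j<d. g (case_nat j w)) = 1"
  using g_function by (auto simp: g_function_def)

lemma g_Holder:
  assumes "u \<in> X" "v \<in> X" "\<And>k. k < n \<Longrightarrow> u k = v k"
  shows "\<bar>ln (g u) - ln (g v)\<bar> \<le> C * \<tau> ^ n"
  using g_function assms by (auto simp: g_function_def)

lemma g_pos: "w \<in> X \<Longrightarrow> 0 < g w"
  using g_ge \<delta> by force

text \<open>Since d is at least 2, \<open>right_shift w\<close> has a second preimage, and it takes
  at least \<delta> of the total weight 1. This gap makes cylinder masses decay geometrically, which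
  excludes atoms.\<close>

lemma g_le:
  assumes "w \<in> X"
  shows "g w \<le> 1 - \<delta>"
proof -
  define j where "j = (if w 0 = 0 then 1 else 0 :: nat)"
  have j: "j < d" "j \<noteq> w 0" "w 0 < d" using d assms by (auto simp: j_def in_dual_space_iff)
  have sh: "right_shift w \<in> X" using assms by (rule right_shift_in_dual_space)
  have "(\<Sum>i\<in>{w 0, j}. g (case_nat i (right_shift w))) \<le> (\<Sum>i<d. g (case_nat i (right_shift w)))"
    using j sh by (intro sum_mono2) (auto intro!: less_imp_le g_pos case_nat_in_dual_space)
  then have "g w + g (case_nat j (right_shift w)) \<le> 1"
    using j sum_g[OF sh] by (simp add: case_nat_right_shift)
  then show ?thesis
    using g_ge[OF case_nat_in_dual_space[OF j(1) sh]] by simp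
qed

lemma \<delta>_less_1: "\<delta> < 1"
proof -
  have "(\<lambda>_. 0) \<in> X" using d by (simp add: in_dual_space_iff)
  from g_le[OF this] g_pos[OF this] show ?thesis by simp
qed

text \<open>As g is at most 1, the logarithm expands distances between its values, so the constants
  for \<open>ln g\<close> also serve for g.\<close>

lemma g_diff:
  assumes "u \<in> X" "v \<in> X" "\<And>k. k < n \<Longrightarrow> u k = v k"
  shows "\<bar>g u - g v\<bar> \<le> C * \<tau> ^ n"
proof -
  have *: "g x - g y \<le> \<bar>ln (g x) - ln (g y)\<bar>" if "x \<in> X" "y \<in> X" for x y
  proof (cases "g y \<le> g x")
    case True
    have "g x - g y = g x * (1 - g y / g x)" using g_pos[OF that(1)] by (simp add: field_simps)
    also have "\<dots> \<le> 1 * (1 - g y / g x)"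
      using True g_le[OF that(1)] g_pos[OF that(1)] \<delta> by (intro mult_right_mono) auto
    also have "\<dots> \<le> - ln (g y / g x)"
      using ln_le_minus_one[of "g y / g x"] g_pos that by simp
    also have "\<dots> \<le> \<bar>ln (g x) - ln (g y)\<bar>"
      using g_pos[OF that(1)] g_pos[OF that(2)] by (simp add: ln_div)
    finally show ?thesis .
  qed simp
  have "\<bar>ln (g u) - ln (g v)\<bar> \<le> C * \<tau> ^ n" using assms by (rule g_Holder)
  then show ?thesis
    using *[OF assms(1,2)] *[OF assms(2,1)] by linarith
qed

definition transfer :: "((nat \<Rightarrow> nat) \<Rightarrow> real) \<Rightarrow> (nat \<Rightarrow> nat) \<Rightarrow> real" where
  "transfer \<phi> x = (\<Sum>j<d. g (case_nat j x) * \<phi> (case_nat j x))"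

text \<open>A ball in the Hoelder functions: b bounds the values, a the Hoelder constant, with the
  same rate \<tau> as for g. Suitable balls are preserved by \<open>transfer\<close>.\<close>

definition regular :: "real \<Rightarrow> real \<Rightarrow> ((nat \<Rightarrow> nat) \<Rightarrow> real) \<Rightarrow> bool" where
  "regular a b \<phi> \<longleftrightarrow> (\<forall>u\<in>X. \<bar>\<phi> u\<bar> \<le> b) \<and>
     (\<forall>u\<in>X. \<forall>v\<in>X. \<forall>n. (\<forall>k<n. u k = v k) \<longrightarrow> \<bar>\<phi> u - \<phi> v\<bar> \<le> a * \<tau> ^ n)"

lemma transfer_mono:
  assumes "\<And>x. x \<in> X \<Longrightarrow> \<phi> x \<le> \<psi> x" "x \<in> X"
  shows "transfer \<phi> x \<le> transfer \<psi> x"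
  unfolding transfer_def
  using assms by (intro sum_mono mult_left_mono) (auto intro: less_imp_le g_pos case_nat_in_dual_space)

lemma transfer_const: "x \<in> X \<Longrightarrow> transfer (\<lambda>_. c) x = c"
  by (simp add: transfer_def sum_g flip: sum_distrib_right)

lemma transfer_pow_mono:
  assumes "\<And>x. x \<in> X \<Longrightarrow> \<phi> x \<le> \<psi> x" "x \<in> X"
  shows "(transfer ^^ n) \<phi> x \<le> (transfer ^^ n) \<psi> x"
  using assms by (induction n arbitrary: x) (auto intro: transfer_mono)

lemma transfer_pow_const: "x \<in> X \<Longrightarrow> (transfer ^^ n) (\<lambda>_. c) x = c"
proof (induction n arbitrary: x)
  case (Suc n)
  then have "transfer ((transfer ^^ n) (\<lambda>_. c)) x = transfer (\<lambda>_. c) x"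
    by (simp add: transfer_def[of _ x] case_nat_in_dual_space)
  then show ?case using Suc.prems by (simp add: transfer_const)
qed simp

lemma transfer_sum: "transfer (\<lambda>x. \<Sum>i\<in>I. \<phi> i x) = (\<lambda>x. \<Sum>i\<in>I. transfer (\<phi> i) x)"
  unfolding transfer_def by (rule ext, subst sum.swap) (simp add: sum_distrib_left)

lemma transfer_pow_sum:
  "(transfer ^^ n) (\<lambda>x. \<Sum>i\<in>I. \<phi> i x) = (\<lambda>x. \<Sum>i\<in>I. (transfer ^^ n) (\<phi> i) x)"
  by (induction n) (simp_all add: transfer_sum)

lemma transfer_scale: "transfer (\<lambda>x. c * \<phi> x) = (\<lambda>x. c * transfer \<phi> x)"
  unfolding transfer_def by (simp add: sum_distrib_left mult.left_commute)

lemma transfer_pow_scale: "(transfer ^^ n) (\<lambda>x. c * \<phi> x) = (\<lambda>x. c * (transfer ^^ n) \<phi> x)"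
  by (induction n) (simp_all add: transfer_scale)

lemma abs_transfer_le:
  assumes "\<And>x. x \<in> X \<Longrightarrow> \<bar>\<phi> x\<bar> \<le> b" "x \<in> X"
  shows "\<bar>transfer \<phi> x\<bar> \<le> b"
proof -
  have "transfer \<phi> x \<le> b" "transfer (\<lambda>_. - b) x \<le> transfer \<phi> x"
    using transfer_mono[of \<phi> "\<lambda>_. b" x] transfer_mono[of "\<lambda>_. - b" \<phi> x] assms
    by (auto simp: transfer_const abs_le_iff) (smt (verit) abs_le_iff)+
  then show ?thesis using assms(2) by (simp add: transfer_const)
qed

text \<open>A Doeblin-Fortet estimate. Corresponding preimages share one more digit, so the Hoelder
  constant a contracts to \<open>a * \<tau>\<close>, while the variation of g adds
  \<open>real d * C * b * \<tau>\<close>. The assumption says that the contraction leaves room for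
  this term.\<close>

lemma regular_transfer:
  assumes reg: "regular a b \<phi>" and a: "real d * C * b * \<tau> \<le> a * (1 - \<tau>)"
  shows "regular a b (transfer \<phi>)"
  unfolding regular_def
proof (intro conjI ballI allI impI)
  have bound: "\<bar>\<phi> x\<bar> \<le> b" if "x \<in> X" for x
    using reg that by (simp add: regular_def)
  show "\<bar>transfer \<phi> u\<bar> \<le> b" if "u \<in> X" for u
    using abs_transfer_le[of \<phi> b u] bound that by blast
  fix u v n assume uv: "u \<in> X" "v \<in> X" "\<forall>k<n. u k = v k"
  have agree: "case_nat j u k = case_nat j v k" if "k < Suc n" for j k
    using uv(3) that by (auto split: nat.split)
  have "\<bar>transfer \<phi> u - transfer \<phi> v\<bar>
      = \<bar>\<Sum>j<d. g (case_nat j u) * (\<phi> (case_nat j u) - \<phi> (case_nat j v))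
          + (g (case_nat j u) - g (case_nat j v)) * \<phi> (case_nat j v)\<bar>"
    by (simp add: transfer_def algebra_simps flip: sum_subtractf)
  also have "\<dots> \<le> (\<Sum>j<d. g (case_nat j u) * (a * \<tau> ^ Suc n) + C * \<tau> ^ Suc n * b)"
  proof (intro sum_abs[THEN order_trans] sum_mono)
    fix j assume "j \<in> {..<d}"
    then have *: "case_nat j u \<in> X" "case_nat j v \<in> X" using uv by (auto intro: case_nat_in_dual_space)
    have 1: "\<bar>\<phi> (case_nat j u) - \<phi> (case_nat j v)\<bar> \<le> a * \<tau> ^ Suc n"
      using reg * agree unfolding regular_def by blast
    have 2: "\<bar>g (case_nat j u) - g (case_nat j v)\<bar> \<le> C * \<tau> ^ Suc n"
      by (rule g_diff[OF * agree])
    show "\<bar>g (case_nat j u) * (\<phi> (case_nat j u) - \<phi> (case_nat j v))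
          + (g (case_nat j u) - g (case_nat j v)) * \<phi> (case_nat j v)\<bar>
        \<le> g (case_nat j u) * (a * \<tau> ^ Suc n) + C * \<tau> ^ Suc n * b"
      using g_pos[OF *(1)] C \<tau> bound[OF *(2)]
      by (intro abs_triangle_ineq[THEN order_trans] add_mono)
        (auto simp: abs_mult simp del: power_Suc intro!: mult_left_mono mult_mono 1 2)
  qed
  also have "\<dots> = (a * \<tau> + real d * C * b * \<tau>) * \<tau> ^ n"
    using sum_g[OF uv(1)]
    by (simp only: sum.distrib sum_distrib_right[symmetric]) (simp add: algebra_simps)
  also have "\<dots> \<le> a * \<tau> ^ n"
    using a \<tau> by (intro mult_right_mono) (auto simp: algebra_simps)
  finally show "\<bar>transfer \<phi> u - transfer \<phi> v\<bar> \<le> a * \<tau> ^ n" .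
qed

lemma regular_transfer_pow:
  assumes "regular a b \<phi>" "real d * C * b * \<tau> \<le> a * (1 - \<tau>)"
  shows "regular a b ((transfer ^^ n) \<phi>)"
  by (induction n) (use assms regular_transfer in auto)

text \<open>The gap \<open>M - transfer \<phi> x\<close> is a weighted sum of nonnegative gaps at
  the preimages; only the i-th is kept, with its weight lowered to \<delta>.\<close>

lemma transfer_le:
  assumes "\<And>x. x \<in> X \<Longrightarrow> \<phi> x \<le> M" "x \<in> X" "i < d"
  shows "transfer \<phi> x \<le> (1 - \<delta>) * M + \<delta> * \<phi> (case_nat i x)"
proof -
  let ?f = "\<lambda>j. g (case_nat j x) * (M - \<phi> (case_nat j x))"
  have nonneg: "0 \<le> ?f j" if "j < d" for j
    using assms(1)[OF case_nat_in_dual_space[OF that assms(2)]]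
      g_pos[OF case_nat_in_dual_space[OF that assms(2)]] by simp
  have "\<delta> * (M - \<phi> (case_nat i x)) \<le> ?f i"
    using assms case_nat_in_dual_space[OF assms(3,2)] by (intro mult_right_mono g_ge) auto
  also have "\<dots> \<le> (\<Sum>j<d. ?f j)"
    using assms(3) nonneg by (intro member_le_sum) auto
  also have "\<dots> = M - transfer \<phi> x"
    using sum_g[OF assms(2)]
    by (simp add: transfer_def right_diff_distrib sum_subtractf flip: sum_distrib_right)
  finally show ?thesis by (simp add: algebra_simps)
qed

text \<open>The preimage of \<open>x\<close> under the \<open>n\<close>-th iterate that shares \<open>n\<close> digits with \<open>y\<close> carries
  weight at least \<open>\<delta> ^ n\<close>.\<close>

lemma transfer_pow_le:
  assumes M: "\<And>x. x \<in> X \<Longrightarrow> \<phi> x \<le> M" and y: "y \<in> X"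
  shows "x \<in> X \<Longrightarrow> (transfer ^^ n) \<phi> x
    \<le> (1 - \<delta> ^ n) * M + \<delta> ^ n * \<phi> (\<lambda>k. if k < n then y k else x (k - n))"
proof (induction n arbitrary: x)
  case (Suc n)
  have yn: "y n < d" using y by (simp add: in_dual_space_iff)
  have le_M: "(transfer ^^ n) \<phi> z \<le> M" if "z \<in> X" for z
    using transfer_pow_mono[of \<phi> "\<lambda>_. M" z n] M that by (simp add: transfer_pow_const)
  have eq: "(\<lambda>k. if k < n then y k else case_nat (y n) x (k - n))
      = (\<lambda>k. if k < Suc n then y k else x (k - Suc n))"
  proof
    fix k
    show "(if k < n then y k else case_nat (y n) x (k - n))
        = (if k < Suc n then y k else x (k - Suc n))"
      by (cases "k \<le> n") (auto simp: not_le Suc_diff_Suc[symmetric] less_Suc_eq)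
  qed
  have "(transfer ^^ Suc n) \<phi> x \<le> (1 - \<delta>) * M + \<delta> * (transfer ^^ n) \<phi> (case_nat (y n) x)"
    using transfer_le[OF le_M Suc.prems yn] by simp
  also have "\<dots> \<le> (1 - \<delta>) * M + \<delta> * ((1 - \<delta> ^ n) * M
      + \<delta> ^ n * \<phi> (\<lambda>k. if k < n then y k else case_nat (y n) x (k - n)))"
    using \<delta> Suc.IH[OF case_nat_in_dual_space[OF yn Suc.prems]] by simp
  also have "\<dots> = (1 - \<delta> ^ Suc n) * M
      + \<delta> ^ Suc n * \<phi> (\<lambda>k. if k < Suc n then y k else x (k - Suc n))"
    unfolding eq by (simp add: algebra_simps)
  finally show ?case .
qed simp

lemma zero_in_X: "(\<lambda>_. 0) \<in> X"
  using d by (simp add: in_dual_space_iff)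

text \<open>The suprema \<open>S m\<close> decrease, because \<open>transfer\<close> averages, and
  converge to some c. If an iterate were far below \<open>S m\<close> at a point y, it would be low
  on a whole cylinder around y; every point has an n-th preimage there of weight at least
  \<open>\<delta> ^ n\<close>, so \<open>S (n + m)\<close> would drop below c. The Hoelder bound
  must be uniform in m for this, hence the assumption from \<open>regular_transfer\<close>.\<close>

lemma transfer_pow_converges:
  assumes reg: "regular a b \<phi>" and a: "0 \<le> a" "real d * C * b * \<tau> \<le> a * (1 - \<tau>)"
  obtains c where "uniform_limit X (\<lambda>n. (transfer ^^ n) \<phi>) (\<lambda>_. c) sequentially"
proof -
  define T where "T m = (transfer ^^ m) \<phi>" for m
  define S where "S m = (SUP x\<in>X. T m x)" for m
  have reg': "regular a b (T m)" for m
    unfolding T_def by (rule regular_transfer_pow[OF reg a(2)])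
  have bound: "\<bar>T m x\<bar> \<le> b" if "x \<in> X" for m x
    using reg'[of m] that by (simp add: regular_def)
  have bdd: "bdd_above (T m ` X)" for m
    using bound by (intro bdd_aboveI2[of _ _ b]) (auto simp: abs_le_iff)
  have T_le: "T m x \<le> S m" if "x \<in> X" for m x
    unfolding S_def by (rule cSUP_upper[OF that bdd])
  have S_ge: "- b \<le> S m" for m
    using T_le[OF zero_in_X, of m] bound[OF zero_in_X, of m] by linarith
  have "decseq S"
  proof (rule decseq_SucI)
    fix m
    show "S (Suc m) \<le> S m"
      unfolding S_def[of "Suc m"]
    proof (rule cSUP_least)
      show "T (Suc m) x \<le> S m" if "x \<in> X" for x
        using transfer_mono[of "T m" "\<lambda>_. S m" x] T_le that by (simp add: T_def transfer_const)
    qed (use zero_in_X in blast)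
  qed
  then obtain c where c: "S \<longlonglongrightarrow> c" "\<And>m. c \<le> S m"
    using decseq_convergent[of S "- b"] S_ge by blast
  have lower: "T m y \<ge> S m - (S m - c) / \<delta> ^ n - a * \<tau> ^ n" if y: "y \<in> X" for m n y
  proof -
    have "S (n + m) \<le> (1 - \<delta> ^ n) * S m + \<delta> ^ n * (T m y + a * \<tau> ^ n)"
      unfolding S_def[of "n + m"]
    proof (rule cSUP_least)
      fix x assume x: "x \<in> X"
      let ?z = "\<lambda>k. if k < n then y k else x (k - n)"
      have "?z \<in> X" using x y by (simp add: in_dual_space_iff)
      then have "\<bar>T m ?z - T m y\<bar> \<le> a * \<tau> ^ n"
        using reg'[of m] y unfolding regular_def by auto
      then have *: "T m ?z \<le> T m y + a * \<tau> ^ n" by linarith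
      have "T (n + m) x \<le> (1 - \<delta> ^ n) * S m + \<delta> ^ n * T m ?z"
        using transfer_pow_le[of "T m" "S m" y x n] T_le y x by (simp add: T_def funpow_add)
      also have "\<dots> \<le> (1 - \<delta> ^ n) * S m + \<delta> ^ n * (T m y + a * \<tau> ^ n)"
        using * \<delta> by (intro add_left_mono mult_left_mono) auto
      finally show "T (n + m) x \<le> (1 - \<delta> ^ n) * S m + \<delta> ^ n * (T m y + a * \<tau> ^ n)" .
    qed (use zero_in_X in blast)
    then have "\<delta> ^ n * (S m - T m y - a * \<tau> ^ n) \<le> S m - c"
      using c(2)[of "n + m"] by (simp add: algebra_simps)
    then have "S m - T m y - a * \<tau> ^ n \<le> (S m - c) / \<delta> ^ n"
      using \<delta> by (simp add: field_simps)
    then show ?thesis by simp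
  qed
  have "uniform_limit X T (\<lambda>_. c) sequentially"
  proof (rule uniform_limitI)
    fix e :: real assume e: "0 < e"
    \<comment> \<open>The order of choices matters: n is fixed before m grows, so that
      \<open>\<delta> ^ n\<close> is a constant in \<open>(S m - c) / \<delta> ^ n\<close>.\<close>
    have "(\<lambda>n. a * \<tau> ^ n) \<longlonglongrightarrow> a * 0"
      using \<tau> by (intro tendsto_intros LIMSEQ_power_zero) auto
    then have "eventually (\<lambda>n. a * \<tau> ^ n < e / 2) sequentially"
      using e by (intro order_tendstoD) auto
    then obtain n where n: "a * \<tau> ^ n < e / 2"
      using eventually_happens'[OF sequentially_bot] by blast
    have "(\<lambda>m. (S m - c) / \<delta> ^ n) \<longlonglongrightarrow> (c - c) / \<delta> ^ n"
      using \<delta> by (intro tendsto_intros c) auto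
    then have "eventually (\<lambda>m. (S m - c) / \<delta> ^ n < e / 2) sequentially"
      using e by (intro order_tendstoD) auto
    moreover have "eventually (\<lambda>m. S m < c + e) sequentially"
      using e c by (intro order_tendstoD) auto
    ultimately show "eventually (\<lambda>m. \<forall>x\<in>X. dist (T m x) c < e) sequentially"
    proof eventually_elim
      case (elim m)
      show ?case
      proof
        fix x assume x: "x \<in> X"
        then show "dist (T m x) c < e"
          using elim n lower[OF x, of m n] T_le[OF x, of m] c(2)[of m]
          unfolding dist_real_def by linarith
      qed
    qed
  qed
  then show ?thesis using that by (simp add: T_def[abs_def])
qed

text \<open>The zero sequence is an arbitrary base point; for regular functions
  \<open>mean_limit\<close> gives the same limit everywhere.\<close>

definition mean :: "((nat \<Rightarrow> nat) \<Rightarrow> real) \<Rightarrow> real" where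
  "mean \<phi> = lim (\<lambda>n. (transfer ^^ n) \<phi> (\<lambda>_. 0))"

lemma mean_limit:
  assumes "regular a b \<phi>"
  shows "uniform_limit X (\<lambda>n. (transfer ^^ n) \<phi>) (\<lambda>_. mean \<phi>) sequentially"
proof -
  \<comment> \<open>Enlarging the Hoelder constant makes it nonnegative and puts the function into a
    ball preserved by \<open>transfer\<close>.\<close>
  define a' where "a' = max (max a 0) (real d * C * b * \<tau> / (1 - \<tau>))"
  have "a \<le> a'" by (simp add: a'_def)
  then have "\<bar>\<phi> u - \<phi> v\<bar> \<le> a' * \<tau> ^ n"
    if "u \<in> X" "v \<in> X" "\<forall>k<n. u k = v k" for u v n
    using assms that \<tau> mult_right_mono[of a a' "\<tau> ^ n"] unfolding regular_def
    by (meson order_trans zero_le_power less_imp_le)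
  then have "regular a' b \<phi>"
    using assms by (simp add: regular_def)
  moreover have "real d * C * b * \<tau> \<le> a' * (1 - \<tau>)"
    using \<tau> by (simp add: a'_def flip: pos_divide_le_eq)
  moreover have "0 \<le> a'" by (simp add: a'_def)
  ultimately obtain c where c: "uniform_limit X (\<lambda>n. (transfer ^^ n) \<phi>) (\<lambda>_. c) sequentially"
    using transfer_pow_converges by blast
  have "(\<lambda>n. (transfer ^^ n) \<phi> (\<lambda>_. 0)) \<longlonglongrightarrow> c"
    by (rule tendsto_uniform_limitI[OF c zero_in_X])
  then have "mean \<phi> = c" unfolding mean_def by (rule limI)
  then show ?thesis using c by simp
qed

end

section \<open>Existence of the measure\<close>

text \<open>The digits are drawn one after another from the right: given the digits below position
  n, digit j has conditional probability \<open>p (w(n := j)) (Suc n) / p w n\<close>. The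
  Ionescu-Tulcea theorem joins these kernels into one measure. Positivity makes the quotients
  meaningful, and \<open>split\<close> makes them sum to 1.\<close>

lemma measure_from_cylinders:
  fixes p :: "(nat \<Rightarrow> nat) \<Rightarrow> nat \<Rightarrow> real"
  assumes d: "0 < d"
    and cong: "\<And>u v n. (\<And>k. k < n \<Longrightarrow> u k = v k) \<Longrightarrow> p u n = p v n"
    and pos: "\<And>w n. (\<And>k. k < n \<Longrightarrow> w k < d) \<Longrightarrow> 0 < p w n"
    and p_0: "\<And>w. p w 0 = 1"
    and split: "\<And>w n. (\<And>k. k < n \<Longrightarrow> w k < d) \<Longrightarrow> p w n = (\<Sum>j<d. p (w(n := j)) (Suc n))"
  obtains \<mu> where "is_dual_prob d \<mu>"
    and "\<And>w n. w \<in> dual_space d \<Longrightarrow> measure \<mu> (right_cylinder d w n) = p w n"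
proof -
  define M :: "nat \<Rightarrow> nat measure" where "M = (\<lambda>_. count_space {..<d})"
  define P where "P n w = point_measure {..<d} (\<lambda>j. ennreal (p (w(n := j)) (Suc n) / p w n))" for n w
  have PiM: "PiM {0..<n} M = count_space (PiE {0..<n} (\<lambda>_. {..<d}))" for n
    unfolding M_def by (intro count_space_PiM_finite) auto
  have digits: "w k < d" if "w \<in> PiE {0..<n} (\<lambda>_. {..<d})" "k < n" for w and n k :: nat
    using PiE_mem[OF that(1), of k] that(2) by simp
  have P_prob: "prob_space (P n w)" if "w \<in> PiE {0..<n} (\<lambda>_. {..<d})" for n w
  proof (rule prob_spaceI)
    have w: "\<And>k. k < n \<Longrightarrow> w k < d" using digits that by blast
    have "emeasure (P n w) (space (P n w)) = (\<Sum>j<d. ennreal (p (w(n := j)) (Suc n) / p w n))"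
      by (simp add: P_def space_point_measure emeasure_point_measure_finite)
    also have "\<dots> = ennreal (\<Sum>j<d. p (w(n := j)) (Suc n) / p w n)"
    proof (rule sum_ennreal)
      fix j assume "j \<in> {..<d}"
      then have "0 < p (w(n := j)) (Suc n)" using w by (intro pos) (auto simp: less_Suc_eq)
      then show "0 \<le> p (w(n := j)) (Suc n) / p w n" using pos[of n w, OF w] by simp
    qed
    also have "(\<Sum>j<d. p (w(n := j)) (Suc n) / p w n) = p w n / p w n"
      unfolding sum_divide_distrib[symmetric] using split[of n w, OF w, symmetric] by simp
    also have "ennreal (p w n / p w n) = 1"
      using pos[of n w, OF w] by (simp add: less_imp_neq[THEN not_sym])
    finally show "emeasure (P n w) (space (P n w)) = 1" .
  qed
  interpret Ionescu_Tulcea P M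
  proof (rule Ionescu_Tulcea.intro)
    show "P i \<in> PiM {0..<i} M \<rightarrow>\<^sub>M subprob_algebra (M i)" for i
      unfolding PiM measurable_count_space_eq1
      using P_prob by (auto simp: space_subprob_algebra P_def M_def sets_point_measure
          intro: prob_space_imp_subprob_space)
    show "prob_space (P i x)" if "x \<in> space (PiM {0..<i} M)" for i x
      using P_prob that by (simp add: PiM)
  qed
  \<comment> \<open>The conditional probabilities of the successive digits multiply to a telescoping
    product starting from \<open>p w 0 = 1\<close>.\<close>
  have C_eq: "emeasure (C 0 n (\<lambda>_. undefined)) {w} = ennreal (p w n)"
    if "w \<in> PiE {0..<n} (\<lambda>_. {..<d})" for n w
    using that
  proof (induction n arbitrary: w)
    case 0
    then show ?case by (simp add: PiM_empty p_0)
  next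
    case (Suc n)
    let ?v = "restrict w {0..<n}"
    have v: "?v \<in> PiE {0..<n} (\<lambda>_. {..<d})" using Suc.prems by (auto simp: PiE_iff)
    have w: "\<And>k. k < Suc n \<Longrightarrow> w k < d" using digits Suc.prems by blast
    have meas: "{w} \<in> sets (PiM {0..<Suc n} M)" using Suc.prems by (simp add: PiM)
    have "emeasure (C 0 (Suc n) (\<lambda>_. undefined)) {w}
        = (\<integral>\<^sup>+x. emeasure (eP n x) {w} \<partial>C 0 n (\<lambda>_. undefined))"
    proof -
      have "space (C 0 n (\<lambda>_. undefined)) = PiE {0..<n} (\<lambda>_. {..<d})"
        by (simp add: space_C PiM PiM_empty)
      then have ne: "space (C 0 n (\<lambda>_. undefined)) \<noteq> {}"
        using v by (metis empty_iff)
      have "sets (C 0 n (\<lambda>_. undefined)) = sets (PiM {0..<n} M)"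
        by (simp add: sets_C PiM_empty)
      then have "eP n \<in> C 0 n (\<lambda>_. undefined) \<rightarrow>\<^sub>M subprob_algebra (PiM {0..<Suc n} M)"
        using measurable_eP[of n] measurable_cong_sets by blast
      from emeasure_bind[OF ne this meas] show ?thesis by simp
    qed
    \<comment> \<open>Only the restriction of w can become w by adding one digit, so a single prefix
      contributes.\<close>
    also have "\<dots> = (\<integral>\<^sup>+x. ennreal (p w (Suc n) / p w n) * indicator {?v} x \<partial>C 0 n (\<lambda>_. undefined))"
    proof (rule nn_integral_cong)
      fix x assume "x \<in> space (C 0 n (\<lambda>_. undefined))"
      then have x: "x \<in> PiE {0..<n} (\<lambda>_. {..<d})" by (simp add: space_C PiM PiM_empty)
      have "emeasure (eP n x) {w} = emeasure (P n x) ((\<lambda>j. x(n := j)) -` {w} \<inter> space (M n))"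
        using x meas by (intro emeasure_eP) (simp_all add: PiM)
      also have "(\<lambda>j. x(n := j)) -` {w} \<inter> space (M n) = (if x = ?v then {w n} else {})"
      proof -
        have 1: "x = ?v" "j = w n" if "w = x(n := j)" for j
          unfolding that using x by (auto simp: PiE_iff extensional_def fun_eq_iff)
        have 2: "?v(n := w n) = w"
          using Suc.prems by (auto simp: PiE_iff extensional_def fun_eq_iff)
        show ?thesis
        proof (cases "x = ?v")
          case True
          have "x(n := j) = w \<longleftrightarrow> j = w n" for j
            using 1(2)[of j] 2 True by auto
          then show ?thesis using w[of n] True by (auto simp: M_def simp del: fun_upd_apply)
        next
          case False
          then have "x(n := j) \<noteq> w" for j using 1(1)[of j] by blast
          then show ?thesis using False by auto
        qed
      qed
      also have "emeasure (P n x) \<dots> = ennreal (p w (Suc n) / p w n) * indicator {?v} x"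
      proof -
        have "p (?v(n := w n)) (Suc n) = p w (Suc n)" "p ?v n = p w n"
          by (auto intro!: cong simp: less_Suc_eq)
        then show ?thesis
          using w[of n] by (simp add: P_def emeasure_point_measure_finite)
      qed
      finally show "emeasure (eP n x) {w} = ennreal (p w (Suc n) / p w n) * indicator {?v} x" .
    qed
    also have "\<dots> = ennreal (p w (Suc n) / p w n) * emeasure (C 0 n (\<lambda>_. undefined)) {?v}"
      using v by (intro nn_integral_cmult_indicator) (simp add: sets_C PiM PiM_empty)
    also have "\<dots> = ennreal (p w (Suc n) / p w n) * ennreal (p w n)"
    proof -
      have "p ?v n = p w n" by (rule cong) simp
      then show ?thesis by (simp only: Suc.IH[OF v])
    qed
    also have "\<dots> = ennreal (p w (Suc n))"
      using pos[of "Suc n" w] pos[of n w] w by (simp add: less_imp_le flip: ennreal_mult)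
    finally show ?case .
  qed
  have sp: "space PF.lim = dual_space d"
    unfolding PF.space_lim by (auto simp: space_PiM M_def in_dual_space_iff PiE_iff)
  have cyl: "right_cylinder d w n = PF.emb UNIV {0..<n} {restrict w {0..<n}}"
    if "w \<in> dual_space d" for w n
    using that
    by (auto simp: prod_emb_def space_PiM M_def right_cylinder_def in_dual_space_iff fun_eq_iff restrict_def)
      metis
  have cyl_sets: "right_cylinder d w n \<in> sets PF.lim" if "w \<in> dual_space d" for w n
    unfolding cyl[OF that] using that by (auto simp: PiM in_dual_space_iff)
  \<comment> \<open>The identity transports the limit measure from its product sigma-algebra to
    \<open>dual_borel d\<close>.\<close>
  define \<mu> where "\<mu> = distr PF.lim (dual_borel d) (\<lambda>x. x)"
  have id: "(\<lambda>x. x) \<in> PF.lim \<rightarrow>\<^sub>M dual_borel d"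
  proof -
    have "(\<lambda>x. x) \<in> PF.lim \<rightarrow>\<^sub>M sigma (dual_space d) (cylinders d)"
    proof (rule measurable_measure_of[OF cylinders_subset])
      show "(\<lambda>x. x) \<in> space PF.lim \<rightarrow> dual_space d" by (simp only: sp) simp
      show "(\<lambda>x. x) -` A \<inter> space PF.lim \<in> sets PF.lim" if "A \<in> cylinders d" for A
        using that cyl_sets sets.Int_space_eq2[of A PF.lim] unfolding cylinders_def by auto
    qed
    moreover have "sets (sigma (dual_space d) (cylinders d)) = sets (dual_borel d)"
      by (simp add: sets_dual_borel sets_measure_of[OF cylinders_subset])
    ultimately show ?thesis using measurable_cong_sets by blast
  qed
  have em: "emeasure \<mu> (right_cylinder d w n) = ennreal (p w n)" if w: "w \<in> dual_space d" for w n
  proof -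
    have r: "restrict w {0..<n} \<in> PiE {0..<n} (\<lambda>_. {..<d})"
      using w by (auto simp: in_dual_space_iff)
    have "emeasure \<mu> (right_cylinder d w n)
        = emeasure PF.lim (right_cylinder d w n \<inter> space PF.lim)"
      unfolding \<mu>_def by (subst emeasure_distr[OF id]) auto
    also have "right_cylinder d w n \<inter> space PF.lim = right_cylinder d w n"
      unfolding sp by (auto simp: right_cylinder_def)
    also have "emeasure PF.lim (right_cylinder d w n) = emeasure (CI {0..<n}) {restrict w {0..<n}}"
      unfolding cyl[OF w] by (rule lim) (use r in \<open>auto simp: PiM\<close>)
    also have "\<dots> = emeasure (C 0 n (\<lambda>_. undefined)) (PF.emb {0..<n} {0..<n} {restrict w {0..<n}})"
      by (rule emeasure_CI) (use r in \<open>auto simp: PiM\<close>)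
    also have "PF.emb {0..<n} {0..<n} {restrict w {0..<n}} = {restrict w {0..<n}}"
      using r by (intro prod_emb_id) (auto simp: M_def)
    also have "emeasure (C 0 n (\<lambda>_. undefined)) {restrict w {0..<n}} = ennreal (p w n)"
    proof -
      have "p (restrict w {0..<n}) n = p w n" by (rule cong) simp
      then show ?thesis by (simp only: C_eq[OF r])
    qed
    finally show ?thesis .
  qed
  have "measure \<mu> (right_cylinder d w n) = p w n" if w: "w \<in> dual_space d" for w n
    using em[OF w, of n] pos[of n w] w by (simp add: measure_def in_dual_space_iff less_imp_le)
  moreover have "is_dual_prob d \<mu>"
    unfolding is_dual_prob_def
  proof
    have "(\<lambda>_. 0) \<in> dual_space d" using d by (simp add: in_dual_space_iff)
    from em[OF this, of 0] show "prob_space \<mu>"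
      by (intro prob_spaceI) (simp add: \<mu>_def p_0)
  qed (simp add: \<mu>_def)
  ultimately show ?thesis using that by blast
qed

lemma case_nat_in_right_cylinder:
  assumes "j < d" "x \<in> dual_space d"
  shows "case_nat j x \<in> right_cylinder d w (Suc n) \<longleftrightarrow> j = w 0 \<and> x \<in> right_cylinder d (right_shift w) n"
  using case_nat_in_dual_space[OF assms] assms(2)
  unfolding right_cylinder_def right_shift_def
  by (auto simp: all_conj_distrib split: nat.split)

lemma shift_quotient_Suc:
  "w \<in> dual_space d \<Longrightarrow> shift_quotient d \<mu> w (Suc n)
    = measure \<mu> (right_cylinder d (right_shift w) n) / measure \<mu> (right_cylinder d w (Suc n))"
  by (simp add: shift_quotient_def right_shift_cylinder)

lemma sum_measure_cylinder_split:
  assumes "is_dual_prob d \<mu>"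
  shows "(\<Sum>j<d. measure \<mu> (right_cylinder d (w(n := j)) (Suc n))) = measure \<mu> (right_cylinder d w n)"
proof -
  interpret prob_space \<mu> using assms by (simp add: is_dual_prob_def)
  show ?thesis
    unfolding right_cylinder_split[of d w n]
    using finite_measure_finite_Union[of "{..<d}" "\<lambda>j. right_cylinder d (w(n := j)) (Suc n)"]
      disjoint_right_cylinder_split[of d w n "{..<d}"] cylinder_in_sets_prob[OF assms]
    by (simp add: image_subset_iff)
qed

text \<open>At a large rank every cylinder has less mass than a supposed atom, so the atom meets
  each of them in a null set. Countably many such cylinders cover the space, and the atom would be
  null.\<close>

lemma non_atomic_if_cylinders_small:
  assumes \<mu>: "is_dual_prob d \<mu>" and q: "0 \<le> q" "q < 1"
    and small: "\<And>w n. w \<in> dual_space d \<Longrightarrow> measure \<mu> (right_cylinder d w n) \<le> q ^ n"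
  shows "non_atomic \<mu>"
  unfolding non_atomic_def
proof
  interpret prob_space \<mu> using \<mu> by (simp add: is_dual_prob_def)
  assume "\<exists>A. atom \<mu> A"
  then obtain A where A: "A \<in> sets \<mu>" "0 < measure \<mu> A"
    and at: "\<And>B. B \<in> sets \<mu> \<Longrightarrow> B \<subseteq> A \<Longrightarrow> measure \<mu> B = 0 \<or> measure \<mu> B = measure \<mu> A"
    by (auto simp: atom_def emeasure_eq_measure)
  have "(\<lambda>n. q ^ n) \<longlonglongrightarrow> 0" using q by (intro LIMSEQ_power_zero) auto
  then have "eventually (\<lambda>n. q ^ n < measure \<mu> A) sequentially"
    using A(2) by (rule order_tendstoD)
  then obtain n where n: "q ^ n < measure \<mu> A"
    using eventually_happens'[OF sequentially_bot] by blast
  define I where "I = {c \<in> cylinders d. \<exists>w\<in>dual_space d. c = right_cylinder d w n}"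
  have "countable I" using countable_cylinders by (rule countable_subset[rotated]) (auto simp: I_def)
  have "A \<inter> c \<in> null_sets \<mu>" if "c \<in> I" for c
  proof -
    obtain w where w: "w \<in> dual_space d" "c = right_cylinder d w n" using \<open>c \<in> I\<close> by (auto simp: I_def)
    have c: "c \<in> sets \<mu>" using cylinder_in_sets_prob[OF \<mu>] w by simp
    have "measure \<mu> (A \<inter> c) \<le> measure \<mu> c" using c by (intro finite_measure_mono) auto
    also have "\<dots> < measure \<mu> A" using small[OF w(1), of n] n w(2) by simp
    finally have "measure \<mu> (A \<inter> c) = 0" using at[of "A \<inter> c"] A(1) c by auto
    then show ?thesis using A(1) c by (auto simp: null_sets_def emeasure_eq_measure)
  qed
  then have "(\<Union>c\<in>I. A \<inter> c) \<in> null_sets \<mu>"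
    using \<open>countable I\<close> by (intro null_sets_UN') auto
  moreover have "A \<subseteq> (\<Union>c\<in>I. A \<inter> c)"
  proof
    fix w assume w: "w \<in> A"
    then have "w \<in> dual_space d"
      using sets.sets_into_space[OF A(1)] space_dual_prob[OF \<mu>] by blast
    then have "right_cylinder d w n \<in> I" "w \<in> right_cylinder d w n"
      by (auto simp: I_def cylinders_def self_in_cylinder)
    then show "w \<in> (\<Union>c\<in>I. A \<inter> c)" using w by blast
  qed
  ultimately have "A \<in> null_sets \<mu>" using A(1) null_sets_subset by blast
  then show False using A(2) by (simp add: null_sets_def emeasure_eq_measure)
qed

text \<open>If the comparison failed on a cylinder, it would fail on one of its parts, and so on down
  to a point.\<close>

lemma cylinder_descent:
  fixes a b :: "(nat \<Rightarrow> nat) \<Rightarrow> nat \<Rightarrow> real"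
  assumes cong: "\<And>u v n. (\<And>k. k < n \<Longrightarrow> u k = v k) \<Longrightarrow> a u n = a v n \<and> b u n = b v n"
    and split_a: "\<And>w n. w \<in> dual_space d \<Longrightarrow> a w n = (\<Sum>j<d. a (w(n := j)) (Suc n))"
    and split_b: "\<And>w n. w \<in> dual_space d \<Longrightarrow> b w n = (\<Sum>j<d. b (w(n := j)) (Suc n))"
    and ev: "\<And>v. v \<in> dual_space d \<Longrightarrow> eventually (\<lambda>m. a v m \<le> q * b v m) sequentially"
    and w: "w \<in> dual_space d"
  shows "a w n \<le> q * b w n"
proof (rule ccontr)
  assume bad: "\<not> a w n \<le> q * b w n"
  have "\<exists>f. \<forall>k. (f k \<in> dual_space d \<and> \<not> a (f k) (n + k) \<le> q * b (f k) (n + k))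
      \<and> (\<exists>j. f (Suc k) = (f k)(n + k := j))"
  proof (rule dependent_nat_choice)
    show "\<exists>x. x \<in> dual_space d \<and> \<not> a x (n + 0) \<le> q * b x (n + 0)"
      using bad w by auto
    fix x k assume x: "x \<in> dual_space d \<and> \<not> a x (n + k) \<le> q * b x (n + k)"
    have "\<exists>j<d. \<not> a (x(n + k := j)) (Suc (n + k)) \<le> q * b (x(n + k := j)) (Suc (n + k))"
    proof (rule ccontr)
      assume "\<not> ?thesis"
      then have "(\<Sum>j<d. a (x(n + k := j)) (Suc (n + k)))
          \<le> (\<Sum>j<d. q * b (x(n + k := j)) (Suc (n + k)))"
        by (intro sum_mono) auto
      then show False
        using x split_a[of x "n + k"] split_b[of x "n + k"] by (simp add: sum_distrib_left)
    qed
    then obtain j where "j < d"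
      "\<not> a (x(n + k := j)) (Suc (n + k)) \<le> q * b (x(n + k := j)) (Suc (n + k))" by blast
    then show "\<exists>y. (y \<in> dual_space d \<and> \<not> a y (n + Suc k) \<le> q * b y (n + Suc k))
        \<and> (\<exists>j. y = x(n + k := j))"
      using x by (intro exI[of _ "x(n + k := j)"]) (auto simp: in_dual_space_iff)
  qed
  then obtain f where f: "\<And>k. f k \<in> dual_space d"
    "\<And>k. \<not> a (f k) (n + k) \<le> q * b (f k) (n + k)"
    "\<And>k. \<exists>j. f (Suc k) = (f k)(n + k := j)"
    by blast
  have stable: "f l i = f k i" if "k \<le> l" "i < n + k" for i k l
    using that(1)
  proof (induction rule: dec_induct)
    case (step l)
    obtain j where "f (Suc l) = (f l)(n + l := j)" using f(3) by blast
    then show ?case using step that(2) by auto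
  qed simp
  \<comment> \<open>The k-th sequence of the chain is never altered again below position n + k, so
    digit i of the limit can be read off at stage \<open>Suc i\<close>.\<close>
  define v where "v i = f (Suc i) i" for i
  have v: "v i = f k i" if "i < n + k" for i k
    using stable[of k "Suc i" i] stable[of "Suc i" k i] that unfolding v_def
    by (cases "k \<le> Suc i") auto
  have "v \<in> dual_space d" using f(1) by (auto simp: v_def in_dual_space_iff)
  from eventually_happens'[OF sequentially_bot eventually_conj[OF ev[OF this] eventually_ge_at_top[of n]]]
  obtain m where m: "a v m \<le> q * b v m" "n \<le> m" by blast
  have "a v m = a (f (m - n)) m \<and> b v m = b (f (m - n)) m"
    using m(2) v by (intro cong) auto
  then show False using f(2)[of "m - n"] m by simp
qed

section \<open>Cylinder weights obtained from the transfer operator\<close>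

context g_system
begin

lemma mean_tendsto:
  "regular a b \<phi> \<Longrightarrow> x \<in> X \<Longrightarrow> (\<lambda>n. (transfer ^^ n) \<phi> x) \<longlonglongrightarrow> mean \<phi>"
  using tendsto_uniform_limitI[OF mean_limit] .

lemma regular_indicator: "regular (1 / \<tau> ^ n) 1 (indicator (right_cylinder d w n))"
  unfolding regular_def
proof (intro conjI ballI allI impI)
  fix u v m assume uv: "u \<in> X" "v \<in> X" "\<forall>k<m. u k = v k"
  show "\<bar>indicator (right_cylinder d w n) u - indicator (right_cylinder d w n) v\<bar> \<le> 1 / \<tau> ^ n * \<tau> ^ m"
  proof (cases "n \<le> m")
    case True
    then have "u \<in> right_cylinder d w n \<longleftrightarrow> v \<in> right_cylinder d w n"
      using uv by (auto simp: right_cylinder_def)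
    then show ?thesis using \<tau> by (simp add: indicator_def)
  next
    case False
    then have "\<tau> ^ n \<le> \<tau> ^ m" using \<tau> by (intro power_decreasing) auto
    then have "1 \<le> 1 / \<tau> ^ n * \<tau> ^ m" using \<tau> by (simp add: field_simps)
    moreover have "\<bar>indicator (right_cylinder d w n) u - indicator (right_cylinder d w n) v\<bar> \<le> (1::real)"
      by (auto simp: indicator_def)
    ultimately show ?thesis by linarith
  qed
qed (auto simp: indicator_def)

text \<open>The only possible mass of the cylinder: a probability measure fixed by the dual operator
  integrates all iterates alike, and these tend uniformly to this constant.\<close>

definition weight :: "(nat \<Rightarrow> nat) \<Rightarrow> nat \<Rightarrow> real" where
  "weight w n = mean (indicator (right_cylinder d w n))"

lemma weight_tendsto:
  "x \<in> X \<Longrightarrow> (\<lambda>m. (transfer ^^ m) (indicator (right_cylinder d w n)) x) \<longlonglongrightarrow> weight w n"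
  unfolding weight_def by (rule mean_tendsto[OF regular_indicator])

lemma weight_cong: "(\<And>k. k < n \<Longrightarrow> u k = v k) \<Longrightarrow> weight u n = weight v n"
  using right_cylinder_cong[of n u v d] by (simp add: weight_def)

lemma weight_0: "weight w 0 = 1"
proof -
  have "(transfer ^^ m) (indicator X) (\<lambda>_. 0) = 1" for m
    using transfer_pow_mono[of "indicator X" "\<lambda>_. 1" "\<lambda>_. 0" m] zero_in_X
      transfer_pow_mono[of "\<lambda>_. 1" "indicator X" "\<lambda>_. 0" m]
      transfer_pow_const[of "\<lambda>_. 0" m 1] by simp
  then show ?thesis
    using weight_tendsto[OF zero_in_X, of w 0] by (simp add: LIMSEQ_const_iff)
qed

lemma weight_split: "weight w n = (\<Sum>j<d. weight (w(n := j)) (Suc n))"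
proof (rule LIMSEQ_unique)
  have "indicator (right_cylinder d w n)
      = (\<lambda>x. \<Sum>j<d. indicator (right_cylinder d (w(n := j)) (Suc n)) x :: real)"
    unfolding right_cylinder_split[of d w n]
    by (rule ext, rule indicator_UN_disjoint) (auto intro: disjoint_right_cylinder_split)
  then have "(transfer ^^ m) (indicator (right_cylinder d w n)) (\<lambda>_. 0)
      = (\<Sum>j<d. (transfer ^^ m) (indicator (right_cylinder d (w(n := j)) (Suc n))) (\<lambda>_. 0))" for m
    using transfer_pow_sum[of m "\<lambda>j. indicator (right_cylinder d (w(n := j)) (Suc n))" "{..<d}"] by simp
  then show "(\<lambda>m. (transfer ^^ m) (indicator (right_cylinder d w n)) (\<lambda>_. 0))
      \<longlonglongrightarrow> (\<Sum>j<d. weight (w(n := j)) (Suc n))"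
    using tendsto_sum[of "{..<d}", OF weight_tendsto[OF zero_in_X]] by simp
qed (rule weight_tendsto[OF zero_in_X])

lemma transfer_indicator:
  assumes "w 0 < d" "x \<in> X"
  shows "transfer (indicator (right_cylinder d w (Suc n))) x
    = g (case_nat (w 0) x) * indicator (right_cylinder d (right_shift w) n) x"
proof -
  have "indicator (right_cylinder d w (Suc n)) (case_nat j x)
      = (if j = w 0 then indicator (right_cylinder d (right_shift w) n) x else 0 :: real)"
    if "j < d" for j
    using case_nat_in_right_cylinder[OF that assms(2)] by (simp add: indicator_def)
  then have "transfer (indicator (right_cylinder d w (Suc n))) x
      = (\<Sum>j<d. if j = w 0 then g (case_nat (w 0) x) * indicator (right_cylinder d (right_shift w) n) x else 0)"
    unfolding transfer_def by (intro sum.cong) auto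
  then show ?thesis using assms(1) by simp
qed

text \<open>One application of \<open>transfer\<close> strips the last digit from the indicator and
  multiplies it by g along that branch. The bound on g passes through the remaining iterates by
  monotonicity and then to the limit; \<open>weight_Suc_ge\<close> is the same from below.\<close>

lemma weight_Suc_le:
  assumes w: "w 0 < d" and g: "\<And>v. v \<in> right_cylinder d w (Suc n) \<Longrightarrow> g v \<le> b"
  shows "weight w (Suc n) \<le> b * weight (right_shift w) n"
proof (rule LIMSEQ_le)
  show "(\<lambda>m. (transfer ^^ Suc m) (indicator (right_cylinder d w (Suc n))) (\<lambda>_. 0)) \<longlonglongrightarrow> weight w (Suc n)"
    by (rule LIMSEQ_Suc[OF weight_tendsto[OF zero_in_X]])
  show "(\<lambda>m. b * (transfer ^^ m) (indicator (right_cylinder d (right_shift w) n)) (\<lambda>_. 0))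
      \<longlonglongrightarrow> b * weight (right_shift w) n"
    by (intro tendsto_intros weight_tendsto[OF zero_in_X])
  have "transfer (indicator (right_cylinder d w (Suc n))) x
      \<le> b * indicator (right_cylinder d (right_shift w) n) x" if "x \<in> X" for x
  proof -
    have "g (case_nat (w 0) x) \<le> b" if x: "x \<in> right_cylinder d (right_shift w) n"
      using \<open>x \<in> X\<close> w x
      by (intro g) (auto simp: right_cylinder_def right_shift_def case_nat_in_dual_space split: nat.split)
    then show ?thesis
      unfolding transfer_indicator[where w = w, OF w that] by (auto simp: indicator_def)
  qed
  then have "(transfer ^^ Suc m) (indicator (right_cylinder d w (Suc n))) (\<lambda>_. 0)
      \<le> b * (transfer ^^ m) (indicator (right_cylinder d (right_shift w) n)) (\<lambda>_. 0)" for m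
    unfolding funpow_Suc_right o_apply fun_cong[OF transfer_pow_scale, symmetric]
    by (intro transfer_pow_mono zero_in_X)
  then show "\<exists>N. \<forall>m\<ge>N. (transfer ^^ Suc m) (indicator (right_cylinder d w (Suc n))) (\<lambda>_. 0)
      \<le> b * (transfer ^^ m) (indicator (right_cylinder d (right_shift w) n)) (\<lambda>_. 0)" by blast
qed

lemma weight_Suc_ge:
  assumes w: "w 0 < d" and g: "\<And>v. v \<in> right_cylinder d w (Suc n) \<Longrightarrow> a \<le> g v"
  shows "a * weight (right_shift w) n \<le> weight w (Suc n)"
proof (rule LIMSEQ_le)
  show "(\<lambda>m. (transfer ^^ Suc m) (indicator (right_cylinder d w (Suc n))) (\<lambda>_. 0)) \<longlonglongrightarrow> weight w (Suc n)"
    by (rule LIMSEQ_Suc[OF weight_tendsto[OF zero_in_X]])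
  show "(\<lambda>m. a * (transfer ^^ m) (indicator (right_cylinder d (right_shift w) n)) (\<lambda>_. 0))
      \<longlonglongrightarrow> a * weight (right_shift w) n"
    by (intro tendsto_intros weight_tendsto[OF zero_in_X])
  have "a * indicator (right_cylinder d (right_shift w) n) x
      \<le> transfer (indicator (right_cylinder d w (Suc n))) x" if "x \<in> X" for x
  proof -
    have "a \<le> g (case_nat (w 0) x)" if x: "x \<in> right_cylinder d (right_shift w) n"
      using \<open>x \<in> X\<close> w x
      by (intro g) (auto simp: right_cylinder_def right_shift_def case_nat_in_dual_space split: nat.split)
    then show ?thesis
      unfolding transfer_indicator[where w = w, OF w that] by (auto simp: indicator_def)
  qed
  then have "a * (transfer ^^ m) (indicator (right_cylinder d (right_shift w) n)) (\<lambda>_. 0)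
      \<le> (transfer ^^ Suc m) (indicator (right_cylinder d w (Suc n))) (\<lambda>_. 0)" for m
    unfolding funpow_Suc_right o_apply fun_cong[OF transfer_pow_scale, symmetric]
    by (intro transfer_pow_mono zero_in_X)
  then show "\<exists>N. \<forall>m\<ge>N. a * (transfer ^^ m) (indicator (right_cylinder d (right_shift w) n)) (\<lambda>_. 0)
      \<le> (transfer ^^ Suc m) (indicator (right_cylinder d w (Suc n))) (\<lambda>_. 0)" by blast
qed

lemma weight_pos: "(\<And>k. k < n \<Longrightarrow> w k < d) \<Longrightarrow> 0 < weight w n"
proof (induction n arbitrary: w)
  case (Suc n)
  have "0 < \<delta> * weight (right_shift w) n"
    using Suc.IH[of "right_shift w"] Suc.prems \<delta> by (simp add: right_shift_def)
  also have "\<dots> \<le> weight w (Suc n)"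
    using Suc.prems[of 0] g_ge by (intro weight_Suc_ge) (auto simp: right_cylinder_def)
  finally show ?case .
qed (simp add: weight_0)

lemma weight_le: "w \<in> X \<Longrightarrow> weight w n \<le> (1 - \<delta>) ^ n"
proof (induction n arbitrary: w)
  case (Suc n)
  have "weight w (Suc n) \<le> (1 - \<delta>) * weight (right_shift w) n"
    using Suc.prems g_le by (intro weight_Suc_le) (auto simp: right_cylinder_def in_dual_space_iff)
  also have "\<dots> \<le> (1 - \<delta>) * (1 - \<delta>) ^ n"
    using Suc.IH[OF right_shift_in_dual_space[OF Suc.prems]] \<delta>_less_1
    by (intro mult_left_mono) auto
  finally show ?case by simp
qed (simp add: weight_0)

lemma g_cylinder_bounds:
  assumes "w \<in> X" "v \<in> right_cylinder d w n"
  shows "exp (- (C * \<tau> ^ n)) * g w \<le> g v" "g v \<le> exp (C * \<tau> ^ n) * g w"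
proof -
  have v: "v \<in> X" using assms(2) by (simp add: right_cylinder_def)
  have "\<bar>ln (g v) - ln (g w)\<bar> \<le> C * \<tau> ^ n"
    using assms v by (intro g_Holder) (auto simp: right_cylinder_def)
  then have "ln (g w) - C * \<tau> ^ n \<le> ln (g v)" "ln (g v) \<le> ln (g w) + C * \<tau> ^ n" by linarith+
  then have "exp (ln (g w) - C * \<tau> ^ n) \<le> exp (ln (g v))"
    "exp (ln (g v)) \<le> exp (ln (g w) + C * \<tau> ^ n)" by (simp_all only: exp_le_cancel_iff)
  then show "exp (- (C * \<tau> ^ n)) * g w \<le> g v" "g v \<le> exp (C * \<tau> ^ n) * g w"
    using g_pos[OF v] g_pos[OF assms(1)] by (simp_all add: exp_add exp_diff exp_minus field_simps)
qed

lemma distortion_tendsto: "(\<lambda>n. exp (s * (C * \<tau> ^ n))) \<longlonglongrightarrow> 1"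
proof -
  have "(\<lambda>n. exp (s * (C * \<tau> ^ n))) \<longlonglongrightarrow> exp (s * (C * 0))"
    using \<tau> by (intro tendsto_intros LIMSEQ_power_zero) auto
  then show ?thesis by simp
qed

text \<open>On a cylinder of rank n + 1 around w the function g stays within a factor
  \<open>exp (C * \<tau> ^ Suc n)\<close> of \<open>g w\<close>, which squeezes the quotient between
  bounds with the same limit.\<close>

lemma weight_quotient_tendsto:
  assumes w: "w \<in> X"
  shows "(\<lambda>n. weight (right_shift w) n / weight w (Suc n)) \<longlonglongrightarrow> 1 / g w"
proof (rule tendsto_sandwich)
  have w0: "w 0 < d" using w by (simp add: in_dual_space_iff)
  have pos: "0 < weight w (Suc n)" for n using w by (intro weight_pos) (auto simp: in_dual_space_iff)
  have "weight w (Suc n) \<le> exp (C * \<tau> ^ Suc n) * g w * weight (right_shift w) n" for n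
    by (rule weight_Suc_le[where w = w, OF w0]) (rule g_cylinder_bounds(2)[OF w])
  then show "eventually (\<lambda>n. exp (- 1 * (C * \<tau> ^ Suc n)) * (1 / g w)
      \<le> weight (right_shift w) n / weight w (Suc n)) sequentially"
    using pos g_pos[OF w] by (intro always_eventually allI) (simp add: exp_minus field_simps del: power_Suc)
  have "exp (- (C * \<tau> ^ Suc n)) * g w * weight (right_shift w) n \<le> weight w (Suc n)" for n
    by (rule weight_Suc_ge[where w = w, OF w0]) (rule g_cylinder_bounds(1)[OF w])
  then show "eventually (\<lambda>n. weight (right_shift w) n / weight w (Suc n)
      \<le> exp (1 * (C * \<tau> ^ Suc n)) * (1 / g w)) sequentially"
    using pos g_pos[OF w] by (intro always_eventually allI) (simp add: exp_minus field_simps del: power_Suc)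
  show "(\<lambda>n. exp (- 1 * (C * \<tau> ^ Suc n)) * (1 / g w)) \<longlonglongrightarrow> 1 / g w"
    "(\<lambda>n. exp (1 * (C * \<tau> ^ Suc n)) * (1 / g w)) \<longlonglongrightarrow> 1 / g w"
    using tendsto_mult[OF LIMSEQ_Suc[OF distortion_tendsto[of "- 1"]] tendsto_const[of "1 / g w"]]
      tendsto_mult[OF LIMSEQ_Suc[OF distortion_tendsto[of 1]] tendsto_const[of "1 / g w"]]
    by (simp_all only: mult_1)
qed

lemma inverse_g_Holder:
  assumes \<Psi>: "\<And>w. w \<in> X \<Longrightarrow> \<Psi> w = 1 / g w"
  shows "dual_Holder d \<Psi>"
  unfolding dual_Holder_def
\<comment> \<open>Inverting g divides its variation by at most \<open>\<delta> * \<delta>\<close>;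
  the added 1 keeps the constant positive when C is 0.\<close>
proof (rule exI[of _ "C / \<delta>\<^sup>2 + 1"], rule exI[of _ \<tau>], intro conjI ballI allI impI)
  show "0 < C / \<delta>\<^sup>2 + 1" using C by (simp add: add_nonneg_pos)
  fix u v n assume uv: "u \<in> X" "v \<in> X" "\<forall>k<n. u k = v k"
  have "\<bar>\<Psi> u - \<Psi> v\<bar> = \<bar>g u - g v\<bar> / (g u * g v)"
    using g_pos[OF uv(1)] g_pos[OF uv(2)]
    by (simp add: \<Psi> uv diff_frac_eq abs_minus_commute abs_mult)
  also have "\<dots> \<le> C * \<tau> ^ n / (\<delta> * \<delta>)"
    using uv g_ge \<delta> by (intro frac_le g_diff mult_mono) (use C \<tau> in \<open>auto intro: order_trans[OF less_imp_le]\<close>)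
  also have "\<dots> \<le> (C / \<delta>\<^sup>2 + 1) * \<tau> ^ n"
    using \<tau> by (simp add: power2_eq_square algebra_simps)
  finally show "\<bar>\<Psi> u - \<Psi> v\<bar> \<le> (C / \<delta>\<^sup>2 + 1) * \<tau> ^ n" .
qed (use \<tau> in auto)

lemma realizes_shift_derivative_exists:
  assumes \<Psi>: "\<And>w. w \<in> X \<Longrightarrow> \<Psi> w = 1 / g w"
  shows "\<exists>\<mu>. realizes_shift_derivative d \<Psi> \<mu>"
proof -
  obtain \<mu> where \<mu>: "is_dual_prob d \<mu>"
    and cyl: "\<And>w n. w \<in> X \<Longrightarrow> measure \<mu> (right_cylinder d w n) = weight w n"
    using measure_from_cylinders[of d weight, OF _ weight_cong weight_pos weight_0 weight_split] d
    by (metis gr_zeroI not_numeral_le_zero)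
  interpret prob_space \<mu> using \<mu> by (simp add: is_dual_prob_def)
  have lim: "shift_quotient d \<mu> w \<longlonglongrightarrow> 1 / g w" if w: "w \<in> X" for w
    using weight_quotient_tendsto[OF w]
    by (intro LIMSEQ_imp_Suc[of "shift_quotient d \<mu> w"])
      (simp add: shift_quotient_Suc w cyl right_shift_in_dual_space)
  then have deriv: "shift_derivative d \<mu> w = 1 / g w" if "w \<in> X" for w
    using that unfolding shift_derivative_def by (intro limI) auto
  have "measure_support (dual_topology d) \<mu> = X"
  proof -
    have "0 < emeasure \<mu> U" if U: "openin (dual_topology d) U" "w \<in> U" "w \<in> X" for w U
    proof -
      obtain n where n: "right_cylinder d w n \<subseteq> U" by (rule openin_dual_topologyD[OF U(1,2)])
      have "0 < emeasure \<mu> (right_cylinder d w n)"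
        using weight_pos[of n w] U(3) cyl by (simp add: emeasure_eq_measure in_dual_space_iff)
      also have "\<dots> \<le> emeasure \<mu> U"
        using n open_in_dual_borel[OF U(1)] \<mu> by (intro emeasure_mono) (auto simp: is_dual_prob_def)
      finally show ?thesis .
    qed
    then show ?thesis unfolding measure_support_def by blast
  qed
  moreover have "non_atomic \<mu>"
    using \<delta> \<delta>_less_1 by (intro non_atomic_if_cylinders_small[OF \<mu>, of "1 - \<delta>"]) (auto simp: cyl weight_le)
  moreover have "shift_C1_plus d \<mu>"
    unfolding shift_C1_plus_def
    using lim inverse_g_Holder[of "shift_derivative d \<mu>"] deriv by (auto simp: convergent_def)
  ultimately have "realizes_shift_derivative d \<Psi> \<mu>"
    unfolding realizes_shift_derivative_def using \<mu> deriv \<Psi> by auto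
  then show ?thesis by blast
qed

end

section \<open>Uniqueness and invariance\<close>

lemma right_cylinder_Int_space [simp]: "right_cylinder d w n \<inter> dual_space d = right_cylinder d w n"
  by (auto simp: right_cylinder_def)

lemma le_if_le_1_plus_eps:
  fixes a b :: real
  assumes "\<And>e. 0 < e \<Longrightarrow> a \<le> (1 + e) * b"
  shows "a \<le> b"
proof (rule tendsto_lowerbound)
  show "((\<lambda>e. (1 + e) * b) \<longlongrightarrow> b) (at_right 0)"
    by (auto intro!: tendsto_eq_intros)
  show "eventually (\<lambda>e. a \<le> (1 + e) * b) (at_right 0)"
    using assms by (auto simp: eventually_at_right_field intro!: exI[of _ 1])
qed simp

text \<open>Full support and the derivative condition, restated on cylinders. The limit
  \<open>quotient\<close> comes with no rate and no uniformity in w.\<close>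

locale g_measure = g_system +
  fixes \<mu> :: "(nat \<Rightarrow> nat) measure"
  assumes prob: "is_dual_prob d \<mu>"
    and cylinder_pos: "w \<in> dual_space d \<Longrightarrow> 0 < measure \<mu> (right_cylinder d w n)"
    and quotient: "w \<in> dual_space d \<Longrightarrow> shift_quotient d \<mu> w \<longlonglongrightarrow> 1 / g w"
begin

sublocale prob_space \<mu>
  using prob by (simp add: is_dual_prob_def)

lemma sets_\<mu> [measurable_cong, simp]: "sets \<mu> = sets (dual_borel d)"
  using prob by (simp add: is_dual_prob_def)

lemma space_\<mu> [simp]: "space \<mu> = X"
  by (rule space_dual_prob[OF prob])

lemma g_continuous: "continuous_map (dual_topology d) euclideanreal g"
  using \<tau> g_diff by (intro continuous_map_dualI[of \<tau>]) auto

lemma g_measurable [measurable]: "g \<in> borel_measurable (dual_borel d)"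
  by (rule borel_measurable_continuous_dual[OF g_continuous])

lemma g_case_nat_measurable:
  "j < d \<Longrightarrow> (\<lambda>x. g (case_nat j x)) \<in> borel_measurable (dual_borel d)"
  by (rule measurable_compose[OF measurable_case_nat g_measurable])

section \<open>Comparison of the measure with its image under the dual operator\<close>

lemma integrable_bounded:
  assumes "f \<in> borel_measurable (dual_borel d)" "\<And>x. x \<in> X \<Longrightarrow> \<bar>f x\<bar> \<le> (B :: real)"
  shows "integrable \<mu> f"
  using assms by (intro integrable_const_bound[of _ B]) (auto intro!: AE_I2)

text \<open>The mass that the dual transfer operator applied to \<mu> gives to the cylinder of
  \<open>case_nat j v\<close> of rank m + 1, written out with
  \<open>transfer_indicator\<close>.\<close>

definition branch_weight :: "nat \<Rightarrow> (nat \<Rightarrow> nat) \<Rightarrow> nat \<Rightarrow> real" where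
  "branch_weight j v m = (\<integral>x. g (case_nat j x) * indicator (right_cylinder d v m) x \<partial>\<mu>)"

lemma branch_integrable:
  "j < d \<Longrightarrow> integrable \<mu> (\<lambda>x. g (case_nat j x) * indicator (right_cylinder d v m) x)"
proof (rule integrable_bounded[of _ 1])
  assume j: "j < d"
  note g_case_nat_measurable[OF this, measurable]
  show "(\<lambda>x. g (case_nat j x) * indicator (right_cylinder d v m) x) \<in> borel_measurable (dual_borel d)"
    by measurable
  show "\<bar>g (case_nat j x) * indicator (right_cylinder d v m) x\<bar> \<le> 1" if "x \<in> X" for x
    using g_pos[OF case_nat_in_dual_space[OF j that]] g_le[OF case_nat_in_dual_space[OF j that]] \<delta>
    by (simp add: indicator_def)
qed

lemma branch_weight_split:
  assumes "j < d"
  shows "branch_weight j v m = (\<Sum>i<d. branch_weight j (v(m := i)) (Suc m))"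
proof -
  have "g (case_nat j x) * indicator (right_cylinder d v m) x
      = (\<Sum>i<d. g (case_nat j x) * indicator (right_cylinder d (v(m := i)) (Suc m)) x)" for x
    unfolding right_cylinder_split[of d v m] sum_distrib_left[symmetric]
    by (subst indicator_UN_disjoint) (auto intro: disjoint_right_cylinder_split)
  then show ?thesis
    unfolding branch_weight_def
    by (simp only:) (rule Bochner_Integration.integral_sum, rule branch_integrable[OF assms])
qed

text \<open>After the common last digit j has been added, points of the cylinder share m + 1 digits,
  so g is constant up to the factor \<open>exp (C * \<tau> ^ Suc m)\<close> under the
  integral.\<close>

lemma branch_weight_bounds:
  assumes j: "j < d" and v: "v \<in> X"
  shows "exp (- 1 * (C * \<tau> ^ Suc m)) * g (case_nat j v) * measure \<mu> (right_cylinder d v m)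
      \<le> branch_weight j v m" (is "?a * _ \<le> _")
    and "branch_weight j v m
      \<le> exp (1 * (C * \<tau> ^ Suc m)) * g (case_nat j v) * measure \<mu> (right_cylinder d v m)" (is "_ \<le> ?b * _")
proof -
  have jv: "case_nat j v \<in> X" using j v by (rule case_nat_in_dual_space)
  have bounds: "?a \<le> g (case_nat j x)" "g (case_nat j x) \<le> ?b" if "x \<in> right_cylinder d v m" for x
  proof -
    have "x \<in> X" using that by (simp add: right_cylinder_def)
    have "case_nat j x \<in> right_cylinder d (case_nat j v) (Suc m)"
      using that case_nat_in_dual_space[OF j \<open>x \<in> X\<close>]
      by (auto simp: right_cylinder_def split: nat.split)
    then show "?a \<le> g (case_nat j x)" "g (case_nat j x) \<le> ?b"
      using g_cylinder_bounds[OF jv, of _ "Suc m"] by (simp_all only: mult_minus1 mult_1)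
  qed
  have int: "integrable \<mu> (\<lambda>x. c * indicator (right_cylinder d v m) x)" for c :: real
    by (auto simp: emeasure_eq_measure)
  have eq: "(\<integral>x. c * indicator (right_cylinder d v m) x \<partial>\<mu>) = c * measure \<mu> (right_cylinder d v m)"
    for c :: real by simp
  have "(\<integral>x. ?a * indicator (right_cylinder d v m) x \<partial>\<mu>) \<le> branch_weight j v m"
    unfolding branch_weight_def
    by (rule integral_mono[OF int branch_integrable[OF j]])
      (use bounds in \<open>auto simp del: mult_minus1 power_Suc split: split_indicator\<close>)
  then show "?a * measure \<mu> (right_cylinder d v m) \<le> branch_weight j v m"
    unfolding eq .
  have "branch_weight j v m \<le> (\<integral>x. ?b * indicator (right_cylinder d v m) x \<partial>\<mu>)"
    unfolding branch_weight_def
    by (rule integral_mono[OF branch_integrable[OF j] int])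
      (use bounds in \<open>auto simp del: mult_1 power_Suc split: split_indicator\<close>)
  then show "branch_weight j v m \<le> ?b * measure \<mu> (right_cylinder d v m)"
    unfolding eq .
qed

lemma branch_ratio_tendsto:
  assumes j: "j < d" and v: "v \<in> X"
  shows "(\<lambda>m. branch_weight j v m / measure \<mu> (right_cylinder d (case_nat j v) (Suc m))) \<longlonglongrightarrow> 1"
proof (rule tendsto_sandwich)
  let ?w = "case_nat j v"
  have w: "?w \<in> X" using j v by (rule case_nat_in_dual_space)
  have pos: "0 < measure \<mu> (right_cylinder d ?w (Suc m))" for m by (rule cylinder_pos[OF w])
  have sh: "right_shift ?w = v" by (simp add: right_shift_def)
  have q: "(\<lambda>m. measure \<mu> (right_cylinder d v m) / measure \<mu> (right_cylinder d ?w (Suc m))) \<longlonglongrightarrow> 1 / g ?w"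
    using LIMSEQ_Suc[OF quotient[OF w]] by (simp add: shift_quotient_Suc[OF w] sh)
  have lim: "(\<lambda>m. exp (s * (C * \<tau> ^ Suc m)) * g ?w *
      (measure \<mu> (right_cylinder d v m) / measure \<mu> (right_cylinder d ?w (Suc m)))) \<longlonglongrightarrow> 1" for s
  proof -
    have "(\<lambda>m. exp (s * (C * \<tau> ^ Suc m)) * g ?w *
        (measure \<mu> (right_cylinder d v m) / measure \<mu> (right_cylinder d ?w (Suc m)))) \<longlonglongrightarrow> 1 * g ?w * (1 / g ?w)"
      by (intro tendsto_mult tendsto_const q LIMSEQ_Suc[OF distortion_tendsto])
    then show ?thesis using g_pos[OF w] by simp
  qed
  show "(\<lambda>m. exp (- 1 * (C * \<tau> ^ Suc m)) * g ?w *
      (measure \<mu> (right_cylinder d v m) / measure \<mu> (right_cylinder d ?w (Suc m)))) \<longlonglongrightarrow> 1"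
    "(\<lambda>m. exp (1 * (C * \<tau> ^ Suc m)) * g ?w *
      (measure \<mu> (right_cylinder d v m) / measure \<mu> (right_cylinder d ?w (Suc m)))) \<longlonglongrightarrow> 1"
    by (rule lim)+
  show "eventually (\<lambda>m. exp (- 1 * (C * \<tau> ^ Suc m)) * g ?w *
      (measure \<mu> (right_cylinder d v m) / measure \<mu> (right_cylinder d ?w (Suc m)))
      \<le> branch_weight j v m / measure \<mu> (right_cylinder d ?w (Suc m))) sequentially"
    using branch_weight_bounds(1)[OF j v] pos
    by (intro always_eventually allI)
      (simp only: times_divide_eq_right divide_right_mono less_imp_le)
  show "eventually (\<lambda>m. branch_weight j v m / measure \<mu> (right_cylinder d ?w (Suc m))
      \<le> exp (1 * (C * \<tau> ^ Suc m)) * g ?w *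
      (measure \<mu> (right_cylinder d v m) / measure \<mu> (right_cylinder d ?w (Suc m)))) sequentially"
    using branch_weight_bounds(2)[OF j v] pos
    by (intro always_eventually allI)
      (simp only: times_divide_eq_right divide_right_mono less_imp_le)
qed

text \<open>Both sides are additive under refinement of v, and \<open>branch_ratio_tendsto\<close>
  makes their ratio tend to 1 at every sequence, at an unknown speed. The descent turns this into an
  inequality with factor \<open>1 + e\<close> on every cylinder, in either direction; then e tends
  to 0.\<close>

lemma measure_cylinder_eq_branch_weight:
  assumes j: "j < d" and v: "v \<in> X"
  shows "measure \<mu> (right_cylinder d (case_nat j v) (Suc m)) = branch_weight j v m"
proof -
  let ?a = "\<lambda>v m. measure \<mu> (right_cylinder d (case_nat j v) (Suc m))" and ?b = "branch_weight j"
  have upd: "case_nat j (v(m := i)) = (case_nat j v)(Suc m := i)" for v :: "nat \<Rightarrow> nat" and m i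
    by (auto simp: fun_eq_iff split: nat.split)
  have cong: "?a u n = ?a v n \<and> ?b u n = ?b v n" if "\<And>k. k < n \<Longrightarrow> u k = v k" for u v n
    using right_cylinder_cong[of n u v d] that
      right_cylinder_cong[of "Suc n" "case_nat j u" "case_nat j v" d]
    by (simp add: branch_weight_def split: nat.split)
  have split: "?a w n = (\<Sum>i<d. ?a (w(n := i)) (Suc n))" for w n
    unfolding upd by (rule sum_measure_cylinder_split[OF prob, symmetric])
  have pos_a: "0 < ?a w n" if "w \<in> X" for w n
    by (rule cylinder_pos[OF case_nat_in_dual_space[OF j that]])
  have pos_b: "0 < ?b w n" if "w \<in> X" for w n
    using branch_weight_bounds(1)[OF j that, of n]
      mult_pos_pos[OF mult_pos_pos[OF exp_gt_zero g_pos[OF case_nat_in_dual_space[OF j that]]] cylinder_pos[OF that]]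
    by (rule less_le_trans[rotated])
  show ?thesis
  proof (rule antisym; rule le_if_le_1_plus_eps)
    fix e :: real assume e: "0 < e"
    show "?a v m \<le> (1 + e) * ?b v m"
    proof (rule cylinder_descent[of ?a ?b d, OF cong split branch_weight_split[OF j] _ v])
      fix w assume w: "w \<in> X"
      have "(\<lambda>m. inverse (?b w m / ?a w m)) \<longlonglongrightarrow> inverse 1"
        by (intro tendsto_inverse branch_ratio_tendsto j w) simp
      then have "eventually (\<lambda>m. inverse (?b w m / ?a w m) < 1 + e) sequentially"
        using e by (intro order_tendstoD) auto
      then show "eventually (\<lambda>m. ?a w m \<le> (1 + e) * ?b w m) sequentially"
        by eventually_elim (use pos_b[OF w] in \<open>simp add: field_simps less_imp_le\<close>)
    qed auto
    show "?b v m \<le> (1 + e) * ?a v m"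
    proof (rule cylinder_descent[of ?b ?a d, OF _ branch_weight_split[OF j] split _ v])
      fix w assume w: "w \<in> X"
      have "eventually (\<lambda>m. ?b w m / ?a w m < 1 + e) sequentially"
        using e branch_ratio_tendsto[OF j w] by (intro order_tendstoD) auto
      then show "eventually (\<lambda>m. ?b w m \<le> (1 + e) * ?a w m) sequentially"
        by eventually_elim (use pos_a[OF w] in \<open>simp add: field_simps less_imp_le\<close>)
    qed (use cong in blast)
  qed
qed

lemma cylinder_bounds:
  assumes w: "w \<in> X"
  shows "exp (- 1 * (C * \<tau> ^ Suc n)) * g w * measure \<mu> (right_cylinder d (right_shift w) n)
      \<le> measure \<mu> (right_cylinder d w (Suc n))"
    and "measure \<mu> (right_cylinder d w (Suc n))
      \<le> exp (1 * (C * \<tau> ^ Suc n)) * g w * measure \<mu> (right_cylinder d (right_shift w) n)"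
proof -
  have w0: "w 0 < d" using w by (simp add: in_dual_space_iff)
  note sh = right_shift_in_dual_space[OF w]
  show "exp (- 1 * (C * \<tau> ^ Suc n)) * g w * measure \<mu> (right_cylinder d (right_shift w) n)
      \<le> measure \<mu> (right_cylinder d w (Suc n))"
    "measure \<mu> (right_cylinder d w (Suc n))
      \<le> exp (1 * (C * \<tau> ^ Suc n)) * g w * measure \<mu> (right_cylinder d (right_shift w) n)"
    using branch_weight_bounds[OF w0 sh, of n] measure_cylinder_eq_branch_weight[OF w0 sh, of n]
    by (simp_all only: case_nat_right_shift)
qed

text \<open>The preimage of a cylinder splits by its last digit into d cylinders whose masses are
  branch weights. Their integrands add up to the indicator of the cylinder, since g sums to 1 over
  the branches.\<close>

lemma invariant: "invariant_measure right_shift \<mu>"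
proof -
  have meas: "right_shift \<in> measurable \<mu> \<mu>"
    using measurable_right_shift measurable_cong_sets[OF sets_\<mu> sets_\<mu>] by blast
  have "distr \<mu> \<mu> right_shift = \<mu>"
  proof (rule measure_eqI_cylinders[of _ d])
    fix w n assume w: "w \<in> X"
    have "right_shift -` right_cylinder d w n \<inter> X = (\<Union>j<d. right_cylinder d (case_nat j w) (Suc n))"
      by (auto simp: right_cylinder_def right_shift_in_dual_space split: nat.split)
        (auto simp: right_shift_def in_dual_space_iff)
    then have "measure (distr \<mu> \<mu> right_shift) (right_cylinder d w n)
        = measure \<mu> (\<Union>j<d. right_cylinder d (case_nat j w) (Suc n))"
      by (subst measure_distr[OF meas]) simp_all
    also have "\<dots> = (\<Sum>j<d. measure \<mu> (right_cylinder d (case_nat j w) (Suc n)))"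
    proof (rule finite_measure_finite_Union)
      have "x 0 = j" if "x \<in> right_cylinder d (case_nat j w) (Suc n)" for x j
        using that by (simp add: right_cylinder_def)
      then show "disjoint_family_on (\<lambda>j. right_cylinder d (case_nat j w) (Suc n)) {..<d}"
        unfolding disjoint_family_on_def by blast
    qed auto
    also have "\<dots> = (\<Sum>j<d. branch_weight j w n)"
      using w by (intro sum.cong measure_cylinder_eq_branch_weight) auto
    also have "\<dots> = (\<integral>x. (\<Sum>j<d. g (case_nat j x) * indicator (right_cylinder d w n) x) \<partial>\<mu>)"
      unfolding branch_weight_def by (rule Bochner_Integration.integral_sum[symmetric]) (auto intro: branch_integrable)
    also have "\<dots> = (\<integral>x. indicator (right_cylinder d w n) x \<partial>\<mu>)"
      by (rule Bochner_Integration.integral_cong) (auto simp: sum_g simp flip: sum_distrib_right)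
    finally show "measure (distr \<mu> \<mu> right_shift) (right_cylinder d w n) = measure \<mu> (right_cylinder d w n)"
      by simp
  qed (use d meas in \<open>auto intro: finite_measure_distr finite_measure_axioms\<close>)
  then have "emeasure \<mu> (right_shift -` A \<inter> space \<mu>) = emeasure \<mu> A" if "A \<in> sets \<mu>" for A
    using emeasure_distr[OF meas that] by simp
  then show ?thesis using meas by (simp add: invariant_measure_def)
qed

text \<open>The identity for cylinder masses, promoted to measures so that arbitrary integrands can
  be treated. The density on the right is the restriction of \<mu> to the range of the branch
  j.\<close>

lemma branch_measure:
  assumes j: "j < d"
  shows "distr (density \<mu> (\<lambda>x. ennreal (g (case_nat j x)))) (dual_borel d) (case_nat j)
      = density \<mu> (indicator (right_cylinder d (\<lambda>_. j) 1))" (is "?l = ?r")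
proof (rule measure_eqI_cylinders[of _ d])
  note g_case_nat_measurable[OF j, measurable] measurable_case_nat[OF j, measurable]
  have l: "emeasure ?l A = (\<integral>\<^sup>+x. ennreal (g (case_nat j x) * indicator A (case_nat j x)) \<partial>\<mu>)"
    if [measurable]: "A \<in> sets (dual_borel d)" for A
  proof -
    have "emeasure ?l A = emeasure (density \<mu> (\<lambda>x. ennreal (g (case_nat j x)))) (case_nat j -` A \<inter> X)"
      by (subst emeasure_distr) auto
    also have "\<dots> = (\<integral>\<^sup>+x. ennreal (g (case_nat j x)) * indicator (case_nat j -` A \<inter> X) x \<partial>\<mu>)"
      using measurable_sets[OF measurable_case_nat[OF j] that]
      by (subst emeasure_density) auto
    also have "\<dots> = (\<integral>\<^sup>+x. ennreal (g (case_nat j x) * indicator A (case_nat j x)) \<partial>\<mu>)"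
      by (rule nn_integral_cong) (auto split: split_indicator)
    finally show ?thesis .
  qed
  have r: "emeasure ?r A = measure \<mu> (right_cylinder d (\<lambda>_. j) 1 \<inter> A)"
    if "A \<in> sets (dual_borel d)" for A
    using that by (subst emeasure_density)
      (auto simp: nn_integral_indicator[symmetric] indicator_inter_arith emeasure_eq_measure[symmetric] simp del: nn_integral_indicator)
  have cyl: "emeasure ?l A = ennreal (branch_weight j v m)"
    if A: "A \<in> sets (dual_borel d)" "\<And>x. x \<in> X \<Longrightarrow> case_nat j x \<in> A \<longleftrightarrow> x \<in> right_cylinder d v m" for A v m
  proof -
    have "emeasure ?l A = (\<integral>\<^sup>+x. ennreal (g (case_nat j x) * indicator (right_cylinder d v m) x) \<partial>\<mu>)"
      unfolding l[OF A(1)] by (rule nn_integral_cong) (auto simp: A(2) split: split_indicator)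
    also have "\<dots> = ennreal (branch_weight j v m)"
      unfolding branch_weight_def
      by (rule nn_integral_eq_integral[OF branch_integrable[OF j]])
        (auto intro!: AE_I2 less_imp_le g_pos case_nat_in_dual_space j split: split_indicator)
    finally show ?thesis .
  qed
  show "finite_measure ?r"
    using r[of X] sets.top[of "dual_borel d"] by (intro finite_measureI) simp
  show "finite_measure ?l"
    using cyl[of X "\<lambda>_. 0" 0] j case_nat_in_dual_space sets.top[of "dual_borel d"]
    by (intro finite_measureI) auto
  fix w n assume w: "w \<in> X"
  have "emeasure ?l (right_cylinder d w n) = emeasure ?r (right_cylinder d w n)"
  \<comment> \<open>The cylinder of rank 0 does not constrain the last digit, so it is replaced by
    the cylinder of \<open>case_nat j w\<close> of rank 1.\<close>
  proof (cases "n = 0")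
    case True
    have "emeasure ?l X = ennreal (branch_weight j w 0)"
      using j case_nat_in_dual_space sets.top[of "dual_borel d"] by (intro cyl) auto
    also have "\<dots> = measure \<mu> (right_cylinder d (case_nat j w) (Suc 0))"
      using measure_cylinder_eq_branch_weight[OF j w, of 0] by simp
    also have "right_cylinder d (case_nat j w) (Suc 0) = right_cylinder d (\<lambda>_. j) 1 \<inter> X"
      by (auto simp: right_cylinder_def)
    also have "ennreal (measure \<mu> \<dots>) = emeasure ?r X"
      using sets.top[of "dual_borel d"] by (intro r[symmetric]) simp
    finally show ?thesis using True by simp
  next
    case False
    then obtain m where n: "n = Suc m" by (cases n) auto
    show ?thesis
    proof (cases "w 0 = j")
      case True
      have "emeasure ?l (right_cylinder d w n) = ennreal (branch_weight j (right_shift w) m)"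
        using case_nat_in_right_cylinder[OF j] by (intro cyl) (auto simp: n True)
      also have "\<dots> = measure \<mu> (right_cylinder d w n)"
        using measure_cylinder_eq_branch_weight[OF j right_shift_in_dual_space[OF w], of m]
          case_nat_right_shift[of w] True n by simp
      also have "measure \<mu> (right_cylinder d w n)
          = measure \<mu> (right_cylinder d (\<lambda>_. j) 1 \<inter> right_cylinder d w n)"
        using True by (intro arg_cong[where f = "measure \<mu>"]) (auto simp: right_cylinder_def n)
      finally show ?thesis by (simp only: r[OF cylinder_in_sets])
    next
      case False
      have "emeasure ?l (right_cylinder d w n) = (\<integral>\<^sup>+x. 0 \<partial>\<mu>)"
        unfolding l[OF cylinder_in_sets] using False case_nat_in_right_cylinder[OF j]
        by (intro nn_integral_cong) (auto simp: n)
      moreover have "right_cylinder d (\<lambda>_. j) 1 \<inter> right_cylinder d w n = {}"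
        using False by (auto simp: right_cylinder_def n)
      ultimately show ?thesis using r[OF cylinder_in_sets] by simp
    qed
  qed
  then show "measure ?l (right_cylinder d w n) = measure ?r (right_cylinder d w n)"
    by (simp add: measure_def)
qed (use d in auto)

section \<open>Invariance of integrals under the transfer operator\<close>

lemma transfer_measurable:
  assumes "\<phi> \<in> borel_measurable (dual_borel d)"
  shows "transfer \<phi> \<in> borel_measurable (dual_borel d)"
  unfolding transfer_def[abs_def]
  using measurable_compose[OF measurable_case_nat assms] g_case_nat_measurable
  by (intro borel_measurable_sum borel_measurable_times) auto

text \<open>Each branch contributes, after the change of variables \<open>branch_measure\<close>,
  the integral over its range; the ranges partition the space according to the last digit.\<close>

lemma integral_transfer:
  assumes \<phi> [measurable]: "\<phi> \<in> borel_measurable (dual_borel d)" and b: "\<And>x. x \<in> X \<Longrightarrow> \<bar>\<phi> x\<bar> \<le> b"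
  shows "integral\<^sup>L \<mu> (transfer \<phi>) = integral\<^sup>L \<mu> \<phi>"
proof -
  have branch: "(\<integral>x. g (case_nat j x) * \<phi> (case_nat j x) \<partial>\<mu>)
      = (\<integral>x. indicator (right_cylinder d (\<lambda>_. j) 1) x * \<phi> x \<partial>\<mu>)" if j: "j < d" for j
  proof -
    note g_case_nat_measurable[OF j, measurable] measurable_case_nat[OF j, measurable]
    have "(\<integral>x. g (case_nat j x) * \<phi> (case_nat j x) \<partial>\<mu>)
        = (\<integral>x. \<phi> (case_nat j x) \<partial>density \<mu> (\<lambda>x. ennreal (g (case_nat j x))))"
      by (subst integral_density)
        (auto intro!: AE_I2 less_imp_le g_pos case_nat_in_dual_space j)
    also have "\<dots> = integral\<^sup>L (distr (density \<mu> (\<lambda>x. ennreal (g (case_nat j x)))) (dual_borel d) (case_nat j)) \<phi>"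
      by (subst integral_distr) auto
    also have "\<dots> = integral\<^sup>L (density \<mu> (\<lambda>x. ennreal (indicator (right_cylinder d (\<lambda>_. j) 1) x))) \<phi>"
      unfolding branch_measure[OF j] by (simp add: ennreal_indicator)
    also have "\<dots> = (\<integral>x. indicator (right_cylinder d (\<lambda>_. j) 1) x * \<phi> x \<partial>\<mu>)"
      by (subst integral_density) (auto intro!: AE_I2)
    finally show ?thesis .
  qed
  have bound: "\<bar>indicator A x * \<phi> x\<bar> \<le> b" if "x \<in> X" for A x
    using b[OF that] by (auto simp: indicator_def)
  have "integral\<^sup>L \<mu> (transfer \<phi>) = (\<Sum>j<d. \<integral>x. g (case_nat j x) * \<phi> (case_nat j x) \<partial>\<mu>)"
    unfolding transfer_def[abs_def]
  proof (rule Bochner_Integration.integral_sum)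
    fix j assume "j \<in> {..<d}"
    then have j: "j < d" by simp
    note g_case_nat_measurable[OF j, measurable] measurable_case_nat[OF j, measurable]
    show "integrable \<mu> (\<lambda>x. g (case_nat j x) * \<phi> (case_nat j x))"
    proof (rule integrable_bounded[of _ b])
      fix x assume "x \<in> X"
      then have jx: "case_nat j x \<in> X" by (rule case_nat_in_dual_space[OF j])
      have "g (case_nat j x) * \<bar>\<phi> (case_nat j x)\<bar> \<le> 1 * b"
        using g_le[OF jx] g_pos[OF jx] \<delta> b[OF jx] by (intro mult_mono) auto
      then show "\<bar>g (case_nat j x) * \<phi> (case_nat j x)\<bar> \<le> b"
        using g_pos[OF jx] by (simp add: abs_mult)
    qed measurable
  qed
  also have "\<dots> = (\<Sum>j<d. \<integral>x. indicator (right_cylinder d (\<lambda>_. j) 1) x * \<phi> x \<partial>\<mu>)"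
    by (intro sum.cong branch) auto
  also have "\<dots> = (\<integral>x. (\<Sum>j<d. indicator (right_cylinder d (\<lambda>_. j) 1) x * \<phi> x) \<partial>\<mu>)"
    by (rule Bochner_Integration.integral_sum[symmetric])
      (rule integrable_bounded[OF _ bound], auto)
  also have "\<dots> = integral\<^sup>L \<mu> \<phi>"
  proof (rule Bochner_Integration.integral_cong)
    fix x assume "x \<in> space \<mu>"
    then have x: "x \<in> X" by simp
    have "(\<Sum>j<d. indicator (right_cylinder d (\<lambda>_. j) 1) x * \<phi> x) = (\<Sum>j<d. if j = x 0 then \<phi> x else 0)"
      using x by (intro sum.cong) (auto simp: indicator_def right_cylinder_def)
    then show "(\<Sum>j<d. indicator (right_cylinder d (\<lambda>_. j) 1) x * \<phi> x) = \<phi> x"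
      using x by (simp add: in_dual_space_iff)
  qed simp
  finally show ?thesis .
qed

text \<open>The integrals of all iterates of the indicator equal the left-hand side, while the
  iterates tend uniformly to the constant on the right, which does not depend on \<mu>. This settles
  uniqueness.\<close>

lemma measure_cylinder_eq_weight: "measure \<mu> (right_cylinder d w n) = weight w n"
proof -
  let ?\<phi> = "indicator (right_cylinder d w n) :: _ \<Rightarrow> real"
  have T: "(transfer ^^ m) ?\<phi> \<in> borel_measurable (dual_borel d) \<and>
      (\<forall>x\<in>X. \<bar>(transfer ^^ m) ?\<phi> x\<bar> \<le> 1) \<and> integral\<^sup>L \<mu> ((transfer ^^ m) ?\<phi>) = measure \<mu> (right_cylinder d w n)" for m
  proof (induction m)
    case (Suc m)
    then show ?case
      using integral_transfer[of "(transfer ^^ m) ?\<phi>" 1] abs_transfer_le[of "(transfer ^^ m) ?\<phi>" 1]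
      by (auto intro: transfer_measurable)
  next
    case 0
    have "\<bar>?\<phi> x\<bar> \<le> 1" for x by (simp add: indicator_def)
    then show ?case by simp
  qed
  have "\<bar>measure \<mu> (right_cylinder d w n) - weight w n\<bar> \<le> e" if e: "0 < e" for e
  proof -
    have "eventually (\<lambda>m. \<forall>x\<in>X. dist ((transfer ^^ m) ?\<phi> x) (weight w n) < e) sequentially"
      using mean_limit[OF regular_indicator[of n w]] e unfolding weight_def by (rule uniform_limitD)
    then obtain m where m: "\<And>x. x \<in> X \<Longrightarrow> \<bar>(transfer ^^ m) ?\<phi> x - weight w n\<bar> < e"
      using eventually_happens'[OF sequentially_bot] unfolding dist_real_def by blast
    have int: "integrable \<mu> ((transfer ^^ m) ?\<phi>)"
      using T[of m] by (intro integrable_bounded[of _ 1]) auto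
    have "\<bar>measure \<mu> (right_cylinder d w n) - weight w n\<bar>
        = \<bar>\<integral>x. (transfer ^^ m) ?\<phi> x - weight w n \<partial>\<mu>\<bar>"
      using T[of m] int prob_space by simp
    also have "\<dots> \<le> (\<integral>x. \<bar>(transfer ^^ m) ?\<phi> x - weight w n\<bar> \<partial>\<mu>)"
      by (rule integral_abs_bound)
    also have "\<dots> \<le> (\<integral>x. e \<partial>\<mu>)"
      using int m by (intro integral_mono) (auto intro: less_imp_le)
    finally show ?thesis using prob_space by simp
  qed
  then have "\<bar>measure \<mu> (right_cylinder d w n) - weight w n\<bar> \<le> 0"
    by (rule field_le_epsilon) simp
  then show ?thesis by simp
qed

end

lemma (in g_system) realizes_imp_g_measure:
  assumes \<Psi>: "\<And>w. w \<in> X \<Longrightarrow> \<Psi> w = 1 / g w" and \<mu>: "realizes_shift_derivative d \<Psi> \<mu>"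
  shows "g_measure d g C \<tau> \<delta> \<mu>"
proof
  show prob: "is_dual_prob d \<mu>" using \<mu> by (simp add: realizes_shift_derivative_def)
  interpret prob_space \<mu> using prob by (simp add: is_dual_prob_def)
  show "0 < measure \<mu> (right_cylinder d w n)" if "w \<in> X" for w n
  proof -
    have "w \<in> measure_support (dual_topology d) \<mu>"
      using \<mu> that by (simp add: realizes_shift_derivative_def)
    then have "0 < emeasure \<mu> (right_cylinder d w n)"
      using openin_right_cylinder self_in_cylinder[OF that] by (auto simp: measure_support_def)
    then show ?thesis by (simp add: emeasure_eq_measure)
  qed
  show "shift_quotient d \<mu> w \<longlonglongrightarrow> 1 / g w" if "w \<in> X" for w
    using \<mu> that \<Psi>[OF that] unfolding realizes_shift_derivative_def shift_C1_plus_def shift_derivative_def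
    by (metis convergent_LIMSEQ_iff)
qed

lemma (in g_system) realizes_shift_derivative_unique:
  assumes "\<And>w. w \<in> X \<Longrightarrow> \<Psi> w = 1 / g w"
    and "realizes_shift_derivative d \<Psi> \<mu>" "realizes_shift_derivative d \<Psi> \<nu>"
  shows "\<mu> = \<nu>"
proof -
  interpret \<mu>: g_measure d g C \<tau> \<delta> \<mu> by (rule realizes_imp_g_measure[OF assms(1,2)])
  interpret \<nu>: g_measure d g C \<tau> \<delta> \<nu> by (rule realizes_imp_g_measure[OF assms(1,3)])
  show ?thesis
    using d by (intro measure_eqI_cylinders[of \<mu> d \<nu>])
      (auto simp: \<mu>.measure_cylinder_eq_weight \<nu>.measure_cylinder_eq_weight
        intro: \<mu>.finite_measure_axioms \<nu>.finite_measure_axioms)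
qed

section \<open>Entropy of finite partitions\<close>

text \<open>Fekete's lemma: the limit is the infimum of the quotients.\<close>

lemma subadditive_convergent:
  fixes a :: "nat \<Rightarrow> real"
  assumes nonneg: "\<And>n. 0 \<le> a n" and sub: "\<And>m n. a (m + n) \<le> a m + a n"
  shows "convergent (\<lambda>n. a n / real n)"
proof -
  define L where "L = (INF n\<in>{1..}. a n / real n)"
  have bdd: "bdd_below ((\<lambda>n. a n / real n) ` {1..})"
    using nonneg by (intro bdd_belowI2[of _ 0]) auto
  have L_le: "L \<le> a n / real n" if "1 \<le> n" for n
    unfolding L_def using that by (intro cINF_lower[OF bdd]) auto
  have mult: "a (q * m) \<le> real q * a m" if "1 \<le> q" for q m
    using that
  proof (induction q rule: dec_induct)
    case (step q)
    then show ?case using sub[of m "q * m"] by (simp add: algebra_simps)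
  qed simp
  have "(\<lambda>n. a n / real n) \<longlonglongrightarrow> L"
  proof (rule LIMSEQ_I)
    fix e :: real assume e: "0 < e"
    have "\<exists>m\<in>{1..}. a m / real m < L + e / 2"
      using e cINF_less_iff[OF _ bdd, of "L + e / 2"] by (auto simp: L_def)
    then obtain m where m: "1 \<le> m" "a m / real m < L + e / 2" by auto
    define B where "B = (\<Sum>r<m. a r)"
    have B: "0 \<le> B" using nonneg by (simp add: B_def sum_nonneg)
    \<comment> \<open>Division with remainder by a nearly optimal m; B bounds the terms of all
      possible remainders and disappears after division by n.\<close>
    have upper: "a n / real n \<le> a m / real m + B / real n" if n: "m \<le> n" for n
    proof -
      have q: "1 \<le> n div m" using n m(1) by (simp add: Suc_le_eq div_greater_zero_iff)
      have "a (n mod m) \<le> B"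
        unfolding B_def using m(1) nonneg by (intro member_le_sum) auto
      then have "a n \<le> real (n div m) * a m + B"
        using sub[of "n div m * m" "n mod m"] mult[OF q, of m] by simp
      also have "real (n div m) * a m \<le> real n / real m * a m"
        using nonneg by (intro mult_right_mono of_nat_div_le_of_nat) auto
      finally have "a n \<le> real n / real m * a m + B" by simp
      then have "a n / real n \<le> (real n / real m * a m + B) / real n"
        by (rule divide_right_mono) simp
      also have "\<dots> = a m / real m + B / real n"
        using n m(1) by (simp add: add_divide_distrib)
      finally show ?thesis .
    qed
    have "(\<lambda>n. B / real n) \<longlonglongrightarrow> 0" by (rule lim_const_over_n)
    then have "eventually (\<lambda>n. B / real n < e / 2) sequentially"
      using e by (intro order_tendstoD) auto
    then obtain N where N: "\<And>n. N \<le> n \<Longrightarrow> B / real n < e / 2"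
      by (auto simp: eventually_sequentially)
    show "\<exists>no. \<forall>n\<ge>no. norm (a n / real n - L) < e"
    proof (intro exI[of _ "max m N"] allI impI)
      fix n assume n: "max m N \<le> n"
      then have "L \<le> a n / real n" using m(1) by (intro L_le) simp
      moreover have "a n / real n < L + e"
        using upper[of n] N[of n] m(2) n by linarith
      ultimately show "norm (a n / real n - L) < e" by simp
    qed
  qed
  then show ?thesis by (rule convergentI)
qed

text \<open>Through the cell of a point, sums over a partition become integrals, and its entropy the
  integral of the information function \<open>- ln (prob (cell R x))\<close>.\<close>

definition cell :: "'a set set \<Rightarrow> 'a \<Rightarrow> 'a set" where
  "cell R x = (THE A. A \<in> R \<and> x \<in> A)"

lemma cell_eq:
  assumes "partition_on S R" "A \<in> R" "x \<in> A"
  shows "cell R x = A"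
  unfolding cell_def
  using assms by (intro the_equality) (auto simp: partition_on_def disjoint_def)

lemma cell_in:
  assumes "partition_on S R" "x \<in> S"
  shows "cell R x \<in> R" "x \<in> cell R x"
proof -
  obtain A where "A \<in> R" "x \<in> A" using assms by (auto simp: partition_on_def)
  then show "cell R x \<in> R" "x \<in> cell R x" using cell_eq[OF assms(1)] by auto
qed

section \<open>Finite partitions and Gibbs' inequality\<close>

context prob_space
begin

lemma finite_partitionD:
  assumes "finite_partition M R"
  shows "finite R" "partition_on (space M) R" "\<And>A. A \<in> R \<Longrightarrow> A \<in> events"
  using assms by (auto simp: finite_partition_def)

lemma measurable_cell:
  assumes R: "finite_partition M R"
  shows "cell R \<in> measurable M (count_space R)"
proof (subst measurable_count_space_eq2[OF finite_partitionD(1)[OF R]], intro conjI ballI)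
  show "cell R \<in> space M \<rightarrow> R" using cell_in(1)[OF finite_partitionD(2)[OF R]] by blast
  fix A assume A: "A \<in> R"
  then have "cell R -` {A} \<inter> space M = A"
    using cell_in[OF finite_partitionD(2)[OF R]] cell_eq[OF finite_partitionD(2)[OF R]]
      sets.sets_into_space[OF finite_partitionD(3)[OF R A]] by blast
  then show "cell R -` {A} \<inter> space M \<in> events" using finite_partitionD(3)[OF R A] by simp
qed

lemma integrable_finite_valued:
  fixes h :: "'b \<Rightarrow> real"
  assumes X: "X \<in> measurable M (count_space S)" and S: "finite S"
  shows "integrable M (\<lambda>x. h (X x))"
proof (rule integrable_const_bound[of _ "\<Sum>s\<in>S. \<bar>h s\<bar>"])
  show "AE x in M. norm (h (X x)) \<le> (\<Sum>s\<in>S. \<bar>h s\<bar>)"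
    using measurable_space[OF X] S by (intro AE_I2) (auto intro!: member_le_sum)
  show "(\<lambda>x. h (X x)) \<in> borel_measurable M"
    by (rule measurable_compose[OF X]) simp
qed

lemma integral_cell:
  fixes h :: "'a set \<Rightarrow> real"
  assumes R: "finite_partition M R"
  shows "(\<integral>x. h (cell R x) \<partial>M) = (\<Sum>A\<in>R. h A * prob A)"
proof -
  have "(\<integral>x. h (cell R x) \<partial>M) = (\<integral>x. (\<Sum>A\<in>R. h A * indicator A x) \<partial>M)"
  proof (rule Bochner_Integration.integral_cong)
    fix x assume x: "x \<in> space M"
    have iff: "x \<in> A \<longleftrightarrow> A = cell R x" if "A \<in> R" for A
      using cell_eq[OF finite_partitionD(2)[OF R] that, of x]
        cell_in(2)[OF finite_partitionD(2)[OF R] x] by auto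
    have "(\<Sum>A\<in>R. h A * indicator A x) = (\<Sum>A\<in>R. if A = cell R x then h A else 0)"
      by (intro sum.cong) (simp_all add: iff indicator_def)
    then show "h (cell R x) = (\<Sum>A\<in>R. h A * indicator A x)"
      using cell_in(1)[OF finite_partitionD(2)[OF R] x] finite_partitionD(1)[OF R] by simp
  qed simp
  also have "\<dots> = (\<Sum>A\<in>R. \<integral>x. h A * indicator A x \<partial>M)"
    using finite_partitionD(3)[OF R]
    by (intro Bochner_Integration.integral_sum) (auto simp: emeasure_eq_measure)
  also have "\<dots> = (\<Sum>A\<in>R. h A * prob A)"
    using finite_partitionD(3)[OF R] sets.Int_space_eq2 by (intro sum.cong) auto
  finally show ?thesis .
qed

lemma partition_entropy_eq_integral:
  assumes "finite_partition M R"
  shows "partition_entropy M R = (\<integral>x. - ln (prob (cell R x)) \<partial>M)"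
  unfolding integral_cell[OF assms, of "\<lambda>A. - ln (prob A)"] partition_entropy_def
  by (simp add: sum_negf mult.commute)

lemma partition_entropy_nonneg: "0 \<le> partition_entropy M R"
proof -
  have "prob A * ln (prob A) \<le> 0" for A
    using prob_le_1[of A] by (cases "prob A = 0") (auto intro!: mult_nonneg_nonpos simp: zero_less_measure_iff)
  then show ?thesis unfolding partition_entropy_def by (simp add: sum_nonpos)
qed

lemma AE_cell_pos:
  assumes R: "finite_partition M R"
  shows "AE x in M. 0 < prob (cell R x)"
proof (rule AE_I')
  show "\<Union>{A \<in> R. prob A = 0} \<in> null_sets M"
    using finite_partitionD[OF R] null_sets_UN'[of "{A \<in> R. prob A = 0}" "\<lambda>A. A" M]
    by (auto simp: countable_finite emeasure_eq_measure null_sets_def)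
  show "{x \<in> space M. \<not> 0 < prob (cell R x)} \<subseteq> \<Union>{A \<in> R. prob A = 0}"
    using cell_in[OF finite_partitionD(2)[OF R]] by (auto simp: not_less measure_le_0_iff)
qed

text \<open>This is Gibbs' inequality, applied to the sums of \<open>q\<close> over the values of \<open>X\<close> on each cell.\<close>

lemma partition_entropy_le:
  assumes R: "finite_partition M R"
    and X: "X \<in> measurable M (count_space S)" and S: "finite S"
    and det: "\<And>x y. x \<in> space M \<Longrightarrow> y \<in> space M \<Longrightarrow> X x = X y \<Longrightarrow> cell R x = cell R y"
    and q: "\<And>s. s \<in> S \<Longrightarrow> 0 \<le> q s" "(\<Sum>s\<in>S. q s) \<le> 1" "AE x in M. 0 < q (X x)"
  shows "partition_entropy M R \<le> (\<integral>x. - ln (q (X x)) \<partial>M)"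
proof -
  \<comment> \<open>Because X determines the cell, distinct cells have disjoint images, so Q again
    has total mass at most 1.\<close>
  define Q where "Q A = (\<Sum>s\<in>X ` A. q s)" for A
  note part = finite_partitionD(2)[OF R]
  have A_space: "A \<subseteq> space M" if "A \<in> R" for A
    using sets.sets_into_space[OF finite_partitionD(3)[OF R that]] .
  have XA: "X ` A \<subseteq> S" if "A \<in> R" for A
    using A_space[OF that] measurable_space[OF X] by auto
  have fin: "finite (X ` A)" if "A \<in> R" for A
    using XA[OF that] S by (rule finite_subset)
  have disj: "X ` A \<inter> X ` B = {}" if "A \<in> R" "B \<in> R" "A \<noteq> B" for A B
  proof (rule ccontr)
    assume "X ` A \<inter> X ` B \<noteq> {}"
    then obtain x y where xy: "x \<in> A" "y \<in> B" "X x = X y" by auto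
    then have "cell R x = cell R y" using det A_space that by blast
    then show False using cell_eq[OF part that(1) xy(1)] cell_eq[OF part that(2) xy(2)] that(3) by simp
  qed
  have "(\<Sum>A\<in>R. Q A) = (\<Sum>s\<in>(\<Union>A\<in>R. X ` A). q s)"
    unfolding Q_def using finite_partitionD(1)[OF R] fin disj by (intro sum.UNION_disjoint[symmetric]) auto
  also have "\<dots> \<le> (\<Sum>s\<in>S. q s)"
    using S XA q(1) by (intro sum_mono2) auto
  finally have sum_Q: "(\<Sum>A\<in>R. Q A) \<le> 1" using q(2) by simp
  have Q_nonneg: "0 \<le> Q A" if "A \<in> R" for A
    unfolding Q_def using q(1) XA[OF that] by (intro sum_nonneg) auto
  have int1: "integrable M (\<lambda>x. - ln (prob (cell R x)))"
    using integrable_finite_valued[OF measurable_cell[OF R] finite_partitionD(1)[OF R]] .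
  have int2: "integrable M (\<lambda>x. - ln (q (X x)))"
    using integrable_finite_valued[OF X S, of "\<lambda>s. - ln (q s)"] .
  have int3: "integrable M (\<lambda>x. Q (cell R x) / prob (cell R x) - 1)"
    using integrable_finite_valued[OF measurable_cell[OF R] finite_partitionD(1)[OF R], of "\<lambda>A. Q A / prob A - 1"] .
  have "partition_entropy M R - (\<integral>x. - ln (q (X x)) \<partial>M)
      = (\<integral>x. - ln (prob (cell R x)) - - ln (q (X x)) \<partial>M)"
    unfolding partition_entropy_eq_integral[OF R] by (rule Bochner_Integration.integral_diff[OF int1 int2, symmetric])
  also have "\<dots> \<le> (\<integral>x. Q (cell R x) / prob (cell R x) - 1 \<partial>M)"
  proof (rule integral_mono_AE[OF Bochner_Integration.integrable_diff[OF int1 int2] int3])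
    show "AE x in M. - ln (prob (cell R x)) - - ln (q (X x)) \<le> Q (cell R x) / prob (cell R x) - 1"
      using q(3) AE_cell_pos[OF R] AE_space
    proof eventually_elim
      case (elim x)
      have "q (X x) \<le> Q (cell R x)"
        unfolding Q_def using cell_in[OF part elim(3)] fin XA q(1)
        by (intro member_le_sum) auto
      then have "- ln (prob (cell R x)) - - ln (q (X x)) \<le> ln (Q (cell R x) / prob (cell R x))"
        using elim(1,2) by (simp add: ln_div)
      also have "\<dots> \<le> Q (cell R x) / prob (cell R x) - 1"
        using elim(1,2) \<open>q (X x) \<le> Q (cell R x)\<close> by (intro ln_le_minus_one) auto
      finally show ?case .
    qed
  qed
  also have "\<dots> = (\<Sum>A\<in>R. (Q A / prob A - 1) * prob A)"
    by (rule integral_cell[OF R])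
  \<comment> \<open>On a null cell the quotient is 0 by convention and the left term vanishes;
    nonnegativity of Q then gives the inequality.\<close>
  also have "\<dots> \<le> (\<Sum>A\<in>R. Q A - prob A)"
    using Q_nonneg by (intro sum_mono) (auto simp: algebra_simps)
  also have "\<dots> = (\<Sum>A\<in>R. Q A) - 1"
    using integral_cell[OF R, of "\<lambda>_. 1"] prob_space by (simp add: sum_subtractf)
  also have "\<dots> \<le> 0" using sum_Q by simp
  finally show ?thesis by simp
qed

end

section \<open>Iterated joins under a measure-preserving map\<close>

locale invariant_prob_space = prob_space +
  fixes T :: "'a \<Rightarrow> 'a"
  assumes invariant: "invariant_measure T M"
begin

lemma funpow_measurable: "T ^^ n \<in> measurable M M"
  by (induction n) (use invariant in \<open>auto simp: invariant_measure_def intro: measurable_comp\<close>)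

lemma distr_funpow: "distr M M (T ^^ n) = M"
proof (induction n)
  case 0
  show ?case using distr_id[of M] by (simp add: id_def)
next
  case (Suc n)
  have T: "T \<in> measurable M M" using invariant by (simp add: invariant_measure_def)
  have "distr M M T = M"
    using invariant T by (intro measure_eqI) (auto simp: invariant_measure_def emeasure_distr)
  then show ?case
    using distr_distr[OF T funpow_measurable, of n] by (simp only: Suc funpow.simps)
qed

lemma integral_funpow:
  fixes f :: "'a \<Rightarrow> real"
  assumes "f \<in> borel_measurable M"
  shows "(\<integral>x. f ((T ^^ n) x) \<partial>M) = integral\<^sup>L M f"
  using integral_distr[OF funpow_measurable assms, of n] by (simp add: distr_funpow)

lemma AE_funpow: "AE x in M. Q x \<Longrightarrow> AE x in M. Q ((T ^^ n) x)"
  by (rule AE_distrD[OF funpow_measurable, unfolded distr_funpow])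

lemma funpow_space: "x \<in> space M \<Longrightarrow> (T ^^ n) x \<in> space M"
  by (rule measurable_space[OF funpow_measurable])

lemma join_cell_in:
  assumes P: "finite_partition M P" and x: "x \<in> space M"
  shows "space M \<inter> (\<Inter>k<n. (T ^^ k) -` cell P ((T ^^ k) x)) \<in> iterated_join M T P n"
    (is "?A \<in> _")
proof -
  have "x \<in> ?A"
    using x cell_in(2)[OF finite_partitionD(2)[OF P] funpow_space[OF x]] by auto
  moreover have "\<forall>k<n. cell P ((T ^^ k) x) \<in> P"
    using cell_in(1)[OF finite_partitionD(2)[OF P] funpow_space[OF x]] by blast
  ultimately show ?thesis
    unfolding iterated_join_def by (auto intro!: exI[of _ "\<lambda>k. cell P ((T ^^ k) x)"])
qed

lemma iterated_join_cells:
  assumes P: "finite_partition M P" and A: "A \<in> iterated_join M T P n" and x: "x \<in> A"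
  shows "A = space M \<inter> (\<Inter>k<n. (T ^^ k) -` cell P ((T ^^ k) x))" and "x \<in> space M"
proof -
  obtain B where B: "A = space M \<inter> (\<Inter>k<n. (T ^^ k) -` B k)" "\<And>k. k < n \<Longrightarrow> B k \<in> P"
    using A by (auto simp: iterated_join_def)
  have "cell P ((T ^^ k) x) = B k" if "k < n" for k
    using x that B by (intro cell_eq[OF finite_partitionD(2)[OF P]]) auto
  then show "A = space M \<inter> (\<Inter>k<n. (T ^^ k) -` cell P ((T ^^ k) x))" unfolding B(1) by auto
  show "x \<in> space M" using x B(1) by simp
qed

lemma finite_partition_iterated_join:
  assumes P: "finite_partition M P"
  shows "finite_partition M (iterated_join M T P n)"
  unfolding finite_partition_def
proof (intro conjI)
  have "iterated_join M T P n \<subseteq> (\<lambda>A. space M \<inter> (\<Inter>k<n. (T ^^ k) -` A k)) ` PiE {..<n} (\<lambda>_. P)"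
  proof
    fix B assume "B \<in> iterated_join M T P n"
    then obtain A where A: "B = space M \<inter> (\<Inter>k<n. (T ^^ k) -` A k)" "\<forall>k<n. A k \<in> P"
      by (auto simp: iterated_join_def)
    then show "B \<in> (\<lambda>A. space M \<inter> (\<Inter>k<n. (T ^^ k) -` A k)) ` PiE {..<n} (\<lambda>_. P)"
      by (intro image_eqI[of _ _ "restrict A {..<n}"]) auto
  qed
  then show "finite (iterated_join M T P n)"
    by (rule finite_subset) (use finite_partitionD(1)[OF P] in \<open>auto intro: finite_PiE\<close>)
  show "iterated_join M T P n \<subseteq> events"
  proof
    fix B assume "B \<in> iterated_join M T P n"
    then obtain A where A: "B = space M \<inter> (\<Inter>k<n. (T ^^ k) -` A k)" "\<forall>k<n. A k \<in> P"
      by (auto simp: iterated_join_def)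
    have "B = {x \<in> space M. \<forall>k\<in>{..<n}. (T ^^ k) x \<in> A k}" unfolding A(1) by auto
    moreover have "{x \<in> space M. (T ^^ k) x \<in> A k} \<in> events" if "k < n" for k
      using measurable_sets[OF funpow_measurable, of "A k" k] A(2) that finite_partitionD(3)[OF P]
      by (simp add: vimage_def Int_def conj_commute)
    ultimately show "B \<in> events" by (auto intro!: sets.sets_Collect_finite_All)
  qed
  show "partition_on (space M) (iterated_join M T P n)"
  proof (rule partition_onI)
    show "\<Union>(iterated_join M T P n) = space M"
    proof
      show "space M \<subseteq> \<Union>(iterated_join M T P n)"
      proof
        fix x assume x: "x \<in> space M"
        have "x \<in> space M \<inter> (\<Inter>k<n. (T ^^ k) -` cell P ((T ^^ k) x))"
          using x cell_in(2)[OF finite_partitionD(2)[OF P] funpow_space[OF x]] by auto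
        then show "x \<in> \<Union>(iterated_join M T P n)" using join_cell_in[OF P x, of n] by blast
      qed
    qed (auto simp: iterated_join_def)
    show "disjnt A B" if "A \<in> iterated_join M T P n" "B \<in> iterated_join M T P n" "A \<noteq> B" for A B
    proof (rule ccontr)
      assume "\<not> disjnt A B"
      then obtain x where x: "x \<in> A" "x \<in> B" by (auto simp: disjnt_def)
      show False
        using iterated_join_cells(1)[OF P that(1) x(1)] iterated_join_cells(1)[OF P that(2) x(2)] that(3)
        by simp
    qed
    show "{} \<notin> iterated_join M T P n" by (simp add: iterated_join_def)
  qed
qed

lemma cell_iterated_join:
  assumes P: "finite_partition M P" and x: "x \<in> space M"
  shows "cell (iterated_join M T P n) x = space M \<inter> (\<Inter>k<n. (T ^^ k) -` cell P ((T ^^ k) x))"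
proof (rule cell_eq[OF finite_partitionD(2)[OF finite_partition_iterated_join[OF P]] join_cell_in[OF P x]])
  show "x \<in> space M \<inter> (\<Inter>k<n. (T ^^ k) -` cell P ((T ^^ k) x))"
    using x cell_in(2)[OF finite_partitionD(2)[OF P] funpow_space[OF x]] by auto
qed

text \<open>Gibbs' inequality with product weights: the cell of the long join is coded by the cell
  of x in the first m steps and that of \<open>(T ^^ m) x\<close> in the next n. The logarithm
  splits the product, and invariance removes \<open>T ^^ m\<close> from the second integral.\<close>

lemma partition_entropy_join_add:
  assumes P: "finite_partition M P"
  shows "partition_entropy M (iterated_join M T P (m + n))
    \<le> partition_entropy M (iterated_join M T P m) + partition_entropy M (iterated_join M T P n)"
proof -
  let ?J = "iterated_join M T P"
  let ?X = "\<lambda>x. (cell (?J m) x, cell (?J n) ((T ^^ m) x))"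
  let ?q = "\<lambda>(A, B). prob A * prob B"
  note J = finite_partition_iterated_join[OF P]
  note meas = measurable_cell[OF J] measurable_compose[OF funpow_measurable measurable_cell[OF J]]
  have fin: "finite (?J m \<times> ?J n)" using finite_partitionD(1)[OF J] by blast
  have sum_prob: "(\<Sum>A\<in>?J k. prob A) = 1" for k
    using integral_cell[OF J, of "\<lambda>_. 1" k] prob_space by simp
  have pos: "AE x in M. 0 < prob (cell (?J m) x) \<and> 0 < prob (cell (?J n) ((T ^^ m) x))"
    using AE_cell_pos[OF J] AE_funpow[OF AE_cell_pos[OF J]] by eventually_elim simp
  have int: "integrable M (\<lambda>x. - ln (prob (cell (?J m) x)))"
      "integrable M (\<lambda>x. - ln (prob (cell (?J n) ((T ^^ m) x))))"
    using integrable_finite_valued[OF meas(1) finite_partitionD(1)[OF J], of "\<lambda>A. - ln (prob A)"]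
      integrable_finite_valued[OF meas(2) finite_partitionD(1)[OF J], of "\<lambda>A. - ln (prob A)"] by auto
  have "partition_entropy M (?J (m + n)) \<le> (\<integral>x. - ln (?q (?X x)) \<partial>M)"
  proof (rule partition_entropy_le[OF J _ fin])
    have "?X \<in> M \<rightarrow>\<^sub>M count_space (?J m) \<Otimes>\<^sub>M count_space (?J n)"
      by (rule measurable_Pair[OF meas])
    also have "count_space (?J m) \<Otimes>\<^sub>M count_space (?J n) = count_space (?J m \<times> ?J n)"
      using finite_partitionD(1)[OF J] by (intro pair_measure_count_space) auto
    finally show "?X \<in> M \<rightarrow>\<^sub>M count_space (?J m \<times> ?J n)" .
    fix x y assume xy: "x \<in> space M" "y \<in> space M" "?X x = ?X y"
    have split: "cell (?J (m + n)) z = cell (?J m) z \<inter> (T ^^ m) -` cell (?J n) ((T ^^ m) z)"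
      if z: "z \<in> space M" for z
    proof -
      have lt: "k < m + n \<longleftrightarrow> k < m \<or> (\<exists>i<n. k = i + m)" for k
        by presburger
      have "cell (?J (m + n)) z = {u \<in> space M. \<forall>k<m + n. (T ^^ k) u \<in> cell P ((T ^^ k) z)}"
        unfolding cell_iterated_join[OF P z] by auto
      also have "\<dots> = {u \<in> space M. (\<forall>k<m. (T ^^ k) u \<in> cell P ((T ^^ k) z)) \<and>
          (\<forall>k<n. (T ^^ k) ((T ^^ m) u) \<in> cell P ((T ^^ k) ((T ^^ m) z)))}"
        unfolding lt by (auto simp: funpow_add)
      also have "\<dots> = cell (?J m) z \<inter> (T ^^ m) -` cell (?J n) ((T ^^ m) z)"
        unfolding cell_iterated_join[OF P z] cell_iterated_join[OF P funpow_space[OF z]]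
        using funpow_space by auto
      finally show ?thesis .
    qed
    show "cell (?J (m + n)) x = cell (?J (m + n)) y"
      using xy unfolding split[OF xy(1)] split[OF xy(2)] by simp
  next
    show "(\<Sum>s\<in>?J m \<times> ?J n. ?q s) \<le> 1"
      by (simp add: sum_prob sum.cartesian_product[symmetric] flip: sum_distrib_left)
    show "AE x in M. 0 < ?q (?X x)" using pos by eventually_elim simp
  qed auto
  also have "\<dots> = (\<integral>x. - ln (prob (cell (?J m) x)) + - ln (prob (cell (?J n) ((T ^^ m) x))) \<partial>M)"
  proof (rule integral_cong_AE)
    show "(\<lambda>x. - ln (?q (?X x))) \<in> borel_measurable M"
      using borel_measurable_times[OF measurable_compose[OF meas(1), where g = prob and L = borel]
          measurable_compose[OF meas(2), where g = prob and L = borel]]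
      by simp
    show "(\<lambda>x. - ln (prob (cell (?J m) x)) + - ln (prob (cell (?J n) ((T ^^ m) x)))) \<in> borel_measurable M"
      using int by auto
    show "AE x in M. - ln (?q (?X x)) = - ln (prob (cell (?J m) x)) + - ln (prob (cell (?J n) ((T ^^ m) x)))"
      using pos by eventually_elim (simp add: ln_mult)
  qed
  also have "\<dots> = (\<integral>x. - ln (prob (cell (?J m) x)) \<partial>M) + (\<integral>x. - ln (prob (cell (?J n) ((T ^^ m) x))) \<partial>M)"
    by (rule Bochner_Integration.integral_add[OF int])
  also have "(\<integral>x. - ln (prob (cell (?J n) ((T ^^ m) x))) \<partial>M) = (\<integral>x. - ln (prob (cell (?J n) x)) \<partial>M)"
    by (rule integral_funpow) (rule measurable_compose[OF meas(1)], simp)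
  finally show ?thesis
    by (simp only: partition_entropy_eq_integral[OF J])
qed

text \<open>Turns the \<open>lim\<close> in \<open>entropy_wrt\<close> into a genuine limit, so that
  estimates for each n pass to the entropy.\<close>

lemma entropy_wrt_tendsto:
  assumes "finite_partition M P"
  shows "(\<lambda>n. partition_entropy M (iterated_join M T P n) / real n) \<longlonglongrightarrow> entropy_wrt M T P"
  unfolding entropy_wrt_def convergent_LIMSEQ_iff[symmetric]
  using partition_entropy_nonneg partition_entropy_join_add[OF assms] by (rule subadditive_convergent)

end

section \<open>Birkhoff sums and approximation by cylinders\<close>

definition word :: "nat \<Rightarrow> (nat \<Rightarrow> nat) \<Rightarrow> nat \<Rightarrow> nat" where
  "word n x = restrict x {..<n}"

abbreviation words :: "nat \<Rightarrow> nat \<Rightarrow> (nat \<Rightarrow> nat) set" where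
  "words d n \<equiv> PiE {..<n} (\<lambda>_. {..<d})"

lemma finite_words: "finite (words d n)"
  by (intro finite_PiE) auto

lemma word_in_words: "x \<in> dual_space d \<Longrightarrow> word n x \<in> words d n"
  by (auto simp: word_def in_dual_space_iff)

lemma word_apply: "k < n \<Longrightarrow> word n x k = x k"
  by (simp add: word_def)

lemma word_vimage: "b \<in> words d n \<Longrightarrow> word n -` {b} \<inter> dual_space d = right_cylinder d b n"
  by (fastforce simp: word_def right_cylinder_def PiE_iff extensional_def fun_eq_iff)

lemma right_cylinder_word: "right_cylinder d (word n x) n = right_cylinder d x n"
  by (rule right_cylinder_cong) (simp add: word_apply)

lemma measurable_word: "word n \<in> measurable (dual_borel d) (count_space (words d n))"
  by (subst measurable_count_space_eq2[OF finite_words]) (auto simp: word_vimage word_in_words)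

text \<open>The unions of cylinders of rank N. In this form closure under complements and the
  passage to a larger N are immediate.\<close>

definition determined :: "nat \<Rightarrow> nat \<Rightarrow> (nat \<Rightarrow> nat) set \<Rightarrow> bool" where
  "determined d N B \<longleftrightarrow> B \<subseteq> dual_space d \<and>
    (\<forall>x\<in>dual_space d. \<forall>y\<in>dual_space d. (\<forall>k<N. x k = y k) \<longrightarrow> x \<in> B \<longrightarrow> y \<in> B)"

lemma determinedD:
  "determined d N B \<Longrightarrow> x \<in> dual_space d \<Longrightarrow> y \<in> dual_space d \<Longrightarrow> \<forall>k<N. x k = y k \<Longrightarrow> x \<in> B \<Longrightarrow> y \<in> B"
  unfolding determined_def by blast

lemma determined_in_sets:
  assumes "determined d N B"
  shows "B \<in> sets (dual_borel d)"
proof -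
  have B: "B \<subseteq> dual_space d"
    and det: "\<And>x y. x \<in> dual_space d \<Longrightarrow> y \<in> dual_space d \<Longrightarrow> \<forall>k<N. x k = y k \<Longrightarrow> x \<in> B \<Longrightarrow> y \<in> B"
    using assms unfolding determined_def by blast+
  have "B = (\<Union>b\<in>word N ` B. right_cylinder d b N)"
  proof
    show "B \<subseteq> (\<Union>b\<in>word N ` B. right_cylinder d b N)"
    proof
      fix x assume x: "x \<in> B"
      then have "x \<in> right_cylinder d (word N x) N"
        using B self_in_cylinder[of x d N] by (auto simp only: right_cylinder_word)
      then show "x \<in> (\<Union>b\<in>word N ` B. right_cylinder d b N)" using x by blast
    qed
    show "(\<Union>b\<in>word N ` B. right_cylinder d b N) \<subseteq> B"
    proof
      fix y assume "y \<in> (\<Union>b\<in>word N ` B. right_cylinder d b N)"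
      then obtain x where x: "x \<in> B" "y \<in> right_cylinder d x N"
        by (auto simp only: right_cylinder_word)
      show "y \<in> B"
        by (rule det[of x y]) (use x B in \<open>auto simp: right_cylinder_def\<close>)
    qed
  qed
  moreover have "word N ` B \<subseteq> words d N" using B word_in_words by blast
  then have "finite (word N ` B)" using finite_words by (rule finite_subset)
  then have "(\<Union>b\<in>word N ` B. right_cylinder d b N) \<in> sets (dual_borel d)"
    by (rule sets.finite_UN) (rule cylinder_in_sets)
  ultimately show ?thesis by simp
qed

text \<open>Induction over the generation of the sigma-algebra: complements keep the symmetric
  difference, and a countable union is first cut to finitely many members at a cost of e / 2, each
  of which is then approximated.\<close>

lemma cylinder_approximation:
  assumes \<nu>: "is_dual_prob d \<nu>" and A: "A \<in> sets \<nu>" and e: "0 < e"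
  shows "\<exists>N B. determined d N B \<and>
    measure \<nu> ((A - B) \<union> (B - A)) < e"
proof -
  interpret prob_space \<nu> using \<nu> by (simp add: is_dual_prob_def)
  have sets: "sets \<nu> = sets (dual_borel d)" using \<nu> by (simp add: is_dual_prob_def)
  let ?X = "dual_space d"
  have det_sets: "B \<in> events" if "determined d N B" for N B
    unfolding sets using that by (rule determined_in_sets)
  have det_mono: "determined d N' B" if "determined d N B" "N \<le> N'" for N N' B
    unfolding determined_def
  proof (intro conjI ballI impI)
    show "B \<subseteq> ?X" using that(1) by (simp add: determined_def)
    fix x y assume xy: "x \<in> ?X" "y \<in> ?X" "\<forall>k<N'. x k = y k" "x \<in> B"
    have "\<forall>k<N. x k = y k" using xy(3) that(2) by simp
    with that(1) xy(1,2) show "y \<in> B" using xy(4) by (rule determinedD)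
  qed
  have "A \<in> sigma_sets ?X (cylinders d)" using A by (simp add: sets sets_dual_borel)
  then have "\<forall>e>0. \<exists>N B. determined d N B \<and> prob ((A - B) \<union> (B - A)) < e"
  proof induction
    case (Basic a)
    then obtain w n where a: "a = right_cylinder d w n" by (auto simp: cylinders_def)
    have "determined d n a" by (auto simp: determined_def a right_cylinder_def)
    then show ?case by (intro allI impI exI[of _ n] exI[of _ a]) simp
  next
    case Empty
    have "determined d 0 {}" by (simp add: determined_def)
    then show ?case by (intro allI impI exI[of _ 0] exI[of _ "{}"]) simp
  next
    case (Compl a)
    have a: "a \<subseteq> ?X" using sigma_sets_into_sp[OF cylinders_subset Compl.hyps] .
    show ?case
    proof (intro allI impI)
      fix e :: real assume "0 < e"
      then obtain N B where B: "determined d N B" "prob ((a - B) \<union> (B - a)) < e" using Compl.IH by blast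
      have "(?X - a - (?X - B)) \<union> (?X - B - (?X - a)) = (a - B) \<union> (B - a)"
        using a B(1) by (auto simp: determined_def)
      moreover have "determined d N (?X - B)"
        unfolding determined_def
      proof (intro conjI ballI impI)
        fix x y assume xy: "x \<in> ?X" "y \<in> ?X" "\<forall>k<N. x k = y k" "x \<in> ?X - B"
        have "\<forall>k<N. y k = x k" using xy(3) by simp
        then show "y \<in> ?X - B" using determinedD[OF B(1) xy(2,1)] xy(2,4) by blast
      qed auto
      ultimately show "\<exists>N B. determined d N B \<and> prob ((?X - a - B) \<union> (B - (?X - a))) < e"
        using B(2) by (intro exI[of _ N] exI[of _ "?X - B"]) simp
    qed
  next
    case (Union a)
    have a: "a i \<in> events" for i
      using Union.hyps by (simp add: sets sets_dual_borel)
    show ?case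
    proof (intro allI impI)
      fix e :: real assume e: "0 < e"
      have "(\<lambda>k. prob (\<Union>i<k. a i)) \<longlonglongrightarrow> prob (\<Union>k. \<Union>i<k. a i)"
      proof (rule finite_Lim_measure_incseq)
        show "incseq (\<lambda>k. \<Union>i<k. a i)" by (intro incseq_SucI) (auto simp: less_Suc_eq)
      qed (use a in auto)
      also have "(\<Union>k. \<Union>i<k. a i) = (\<Union>i. a i)" by auto
      finally have "eventually (\<lambda>k. prob (\<Union>i. a i) - e / 2 < prob (\<Union>i<k. a i)) sequentially"
        using e by (intro order_tendstoD) auto
      then obtain k where k: "prob (\<Union>i. a i) - e / 2 < prob (\<Union>i<k. a i)"
        using eventually_happens'[OF sequentially_bot] by blast
      \<comment> \<open>The k errors together stay below e / 2; \<open>Suc\<close> keeps the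
        denominator positive for k = 0.\<close>
      define c where "c = e / (2 * real (Suc k))"
      have c: "0 < c" using e by (simp add: c_def)
      have "\<forall>i. \<exists>N B. determined d N B \<and> prob ((a i - B) \<union> (B - a i)) < c"
        using Union.IH c by blast
      then obtain N B where B: "\<And>i. determined d (N i) (B i)" "\<And>i. prob ((a i - B i) \<union> (B i - a i)) < c"
        by metis
      define N' where "N' = (\<Sum>i<k. N i)"
      define B' where "B' = (\<Union>i<k. B i)"
      have "determined d N' (B i)" if "i < k" for i
        using that by (intro det_mono[OF B(1)]) (auto simp: N'_def intro!: member_le_sum)
      then have det': "determined d N' B'" unfolding determined_def B'_def by blast
      have ev: "(a i - B i) \<union> (B i - a i) \<in> events" for i using a det_sets[OF B(1)] by auto
      have "prob (((\<Union>i. a i) - B') \<union> (B' - (\<Union>i. a i)))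
          \<le> prob (((\<Union>i. a i) - (\<Union>i<k. a i)) \<union> (\<Union>i<k. (a i - B i) \<union> (B i - a i)))"
        using a ev by (intro finite_measure_mono) (auto simp: B'_def)
      also have "\<dots> \<le> prob ((\<Union>i. a i) - (\<Union>i<k. a i)) + prob (\<Union>i<k. (a i - B i) \<union> (B i - a i))"
        using a ev by (intro measure_Un_le) auto
      also have "prob ((\<Union>i. a i) - (\<Union>i<k. a i)) = prob (\<Union>i. a i) - prob (\<Union>i<k. a i)"
        using a by (intro finite_measure_Diff) auto
      also have "prob (\<Union>i<k. (a i - B i) \<union> (B i - a i)) \<le> (\<Sum>i<k. prob ((a i - B i) \<union> (B i - a i)))"
        using ev by (intro finite_measure_subadditive_finite) auto
      also have "\<dots> \<le> (\<Sum>i<k. c)" using B(2) by (intro sum_mono less_imp_le)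
      also have "\<dots> \<le> e / 2" using e by (simp add: c_def field_simps)
      finally have "prob (((\<Union>i. a i) - B') \<union> (B' - (\<Union>i. a i))) < e" using k by simp
      then show "\<exists>N B. determined d N B \<and> prob (((\<Union>i. a i) - B) \<union> (B - (\<Union>i. a i))) < e"
        using det' by blast
    qed
  qed
  then show ?thesis using e by blast
qed

text \<open>Each cell A is approximated by a set \<open>B A\<close> reading finitely many digits,
  with error below \<open>e / card P\<close>. A wrong label at x forces x into one of the symmetric
  differences: either x misses the set of its own cell, or it lies in the set of a wrong
  one.\<close>

lemma partition_labelling:
  assumes \<nu>: "is_dual_prob d \<nu>" and P: "finite_partition \<nu> P" and e: "0 < e"
  obtains N \<ll> where "\<And>x y. x \<in> dual_space d \<Longrightarrow> y \<in> dual_space d \<Longrightarrow> (\<And>k. k < N \<Longrightarrow> x k = y k) \<Longrightarrow> \<ll> x = \<ll> y"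
    and "\<And>x. \<ll> x \<in> P" and "{x \<in> dual_space d. \<ll> x \<noteq> cell P x} \<in> sets \<nu>"
    and "measure \<nu> {x \<in> dual_space d. \<ll> x \<noteq> cell P x} < e"
proof -
  interpret prob_space \<nu> using \<nu> by (simp add: is_dual_prob_def)
  have sets: "sets \<nu> = sets (dual_borel d)" using \<nu> by (simp add: is_dual_prob_def)
  have space: "space \<nu> = dual_space d" by (rule space_dual_prob[OF \<nu>])
  let ?X = "dual_space d"
  note fin = finite_partitionD(1)[OF P] and part = finite_partitionD(2)[OF P, unfolded space]
    and ev = finite_partitionD(3)[OF P]
  obtain x0 where "x0 \<in> ?X" using not_empty space by blast
  then obtain A0 where A0: "A0 \<in> P" using cell_in(1)[OF part] by blast
  then have cP: "0 < real (card P)" using fin by (auto simp: card_gt_0_iff)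
  have "\<forall>A\<in>P. \<exists>N B. determined d N B \<and> prob ((A - B) \<union> (B - A)) < e / card P"
    using cylinder_approximation[OF \<nu> ev, of _ "e / card P"] e cP by simp
  then obtain N B where B: "\<And>A. A \<in> P \<Longrightarrow> determined d (N A) (B A)"
    "\<And>A. A \<in> P \<Longrightarrow> prob ((A - B A) \<union> (B A - A)) < e / card P"
    by metis
  define N' where "N' = (\<Sum>A\<in>P. N A)"
  \<comment> \<open>The sets \<open>B A\<close> may overlap and need not cover the space, hence the
    choice and the default \<open>A0\<close>. The choice depends only on which of them contain x, so
    it reads no further digits.\<close>
  define \<ll> where "\<ll> x = (if \<exists>A\<in>P. x \<in> B A then SOME A. A \<in> P \<and> x \<in> B A else A0)" for x
  have iff: "x \<in> B A \<longleftrightarrow> y \<in> B A"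
    if "A \<in> P" "x \<in> ?X" "y \<in> ?X" "\<And>k. k < N' \<Longrightarrow> x k = y k" for A x y
  proof -
    have "N A \<le> N'" unfolding N'_def using fin that(1) by (intro member_le_sum) auto
    then have "\<forall>k<N A. x k = y k" "\<forall>k<N A. y k = x k" using that(4) by simp_all
    then show ?thesis
      using determinedD[OF B(1)[OF that(1)] that(2,3)] determinedD[OF B(1)[OF that(1)] that(3,2)] by blast
  qed
  have det: "\<ll> x = \<ll> y" if "x \<in> ?X" "y \<in> ?X" "\<And>k. k < N' \<Longrightarrow> x k = y k" for x y
  proof -
    have "(A \<in> P \<and> x \<in> B A) = (A \<in> P \<and> y \<in> B A)" for A using iff[OF _ that] by blast
    then show ?thesis unfolding \<ll>_def Bex_def by (simp only:)
  qed
  have some: "\<ll> x \<in> P \<and> x \<in> B (\<ll> x)" if "\<exists>A\<in>P. x \<in> B A" for x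
    using that someI_ex[of "\<lambda>A. A \<in> P \<and> x \<in> B A"] by (auto simp: \<ll>_def)
  have in_P: "\<ll> x \<in> P" for x
    using some[of x] A0 by (cases "\<exists>A\<in>P. x \<in> B A") (auto simp: \<ll>_def)
  have B_ev: "B A \<in> events" if "A \<in> P" for A
    unfolding sets using B(1)[OF that] by (rule determined_in_sets)
  have level: "{x \<in> ?X. \<ll> x = A} \<in> events" for A
  proof -
    have "determined d N' {x \<in> ?X. \<ll> x = A}"
      unfolding determined_def
    proof (intro conjI ballI impI)
      fix x y assume xy: "x \<in> ?X" "y \<in> ?X" "\<forall>k<N'. x k = y k" "x \<in> {x \<in> ?X. \<ll> x = A}"
      then have "\<ll> x = \<ll> y" by (intro det) auto
      then show "y \<in> {x \<in> ?X. \<ll> x = A}" using xy by simp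
    qed auto
    then show ?thesis unfolding sets by (rule determined_in_sets)
  qed
  have "{x \<in> ?X. \<ll> x \<noteq> cell P x} = (\<Union>A\<in>P. A - {x \<in> ?X. \<ll> x = A})"
  proof
    show "{x \<in> ?X. \<ll> x \<noteq> cell P x} \<subseteq> (\<Union>A\<in>P. A - {x \<in> ?X. \<ll> x = A})"
      using cell_in[OF part] by blast
    show "(\<Union>A\<in>P. A - {x \<in> ?X. \<ll> x = A}) \<subseteq> {x \<in> ?X. \<ll> x \<noteq> cell P x}"
      using cell_eq[OF part] sets.sets_into_space[OF ev] space by blast
  qed
  then have bad_ev: "{x \<in> ?X. \<ll> x \<noteq> cell P x} \<in> events"
    using fin ev level by auto
  have "{x \<in> ?X. \<ll> x \<noteq> cell P x} \<subseteq> (\<Union>A\<in>P. (A - B A) \<union> (B A - A))"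
  proof
    fix x assume "x \<in> {x \<in> ?X. \<ll> x \<noteq> cell P x}"
    then have x: "x \<in> ?X" "\<ll> x \<noteq> cell P x" by auto
    show "x \<in> (\<Union>A\<in>P. (A - B A) \<union> (B A - A))"
    proof (cases "x \<in> B (cell P x)")
      case True
      then have "\<ll> x \<in> P" "x \<in> B (\<ll> x)" using some cell_in(1)[OF part x(1)] by blast+
      moreover have "x \<notin> \<ll> x" using cell_eq[OF part, of "\<ll> x" x] calculation x(2) by metis
      ultimately show ?thesis by blast
    next
      case False
      then show ?thesis using cell_in[OF part x(1)] by blast
    qed
  qed
  then have "prob {x \<in> ?X. \<ll> x \<noteq> cell P x} \<le> prob (\<Union>A\<in>P. (A - B A) \<union> (B A - A))"
    using fin ev B_ev by (intro finite_measure_mono) auto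
  also have "\<dots> \<le> (\<Sum>A\<in>P. prob ((A - B A) \<union> (B A - A)))"
    using fin ev B_ev by (intro finite_measure_subadditive_finite) auto
  also have "\<dots> < (\<Sum>A\<in>P. e / card P)"
    using fin A0 B(2) by (intro sum_strict_mono) auto
  also have "\<dots> = e" using cP by simp
  finally show ?thesis by (rule that[OF det in_P bad_ev, rotated -1])
qed

lemma right_shift_funpow: "(right_shift ^^ k) x i = x (i + k)"
  by (induction k arbitrary: i) (simp_all add: right_shift_def)

lemma right_shift_funpow_in: "x \<in> dual_space d \<Longrightarrow> (right_shift ^^ k) x \<in> dual_space d"
  by (auto simp: in_dual_space_iff right_shift_funpow)

section \<open>Cylinder masses and Birkhoff sums of the potential\<close>

context g_measure
begin

lemma ln_cylinder_Suc:
  assumes "x \<in> X"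
  shows "\<bar>ln (measure \<mu> (right_cylinder d x (Suc n))) - ln (g x)
    - ln (measure \<mu> (right_cylinder d (right_shift x) n))\<bar> \<le> C * \<tau> ^ Suc n"
proof -
  let ?a = "measure \<mu> (right_cylinder d x (Suc n))"
  let ?b = "measure \<mu> (right_cylinder d (right_shift x) n)"
  have pos: "0 < ?a" "0 < ?b" "0 < g x"
    using assms cylinder_pos right_shift_in_dual_space g_pos by auto
  have "ln (exp (- 1 * (C * \<tau> ^ Suc n)) * g x * ?b) \<le> ln ?a"
    using cylinder_bounds(1)[OF assms, of n] pos by (subst ln_le_cancel_iff) auto
  moreover have "ln ?a \<le> ln (exp (1 * (C * \<tau> ^ Suc n)) * g x * ?b)"
    using cylinder_bounds(2)[OF assms, of n] pos by (subst ln_le_cancel_iff) auto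
  moreover have "ln (exp y * g x * ?b) = y + ln (g x) + ln ?b" for y
    using pos by (simp add: ln_mult)
  ultimately show ?thesis by (simp only: abs_le_iff) linarith
qed

text \<open>The Gibbs property of \<mu>. Digits are stripped from the right; the error at remaining
  length k + 1 is \<open>C * \<tau> ^ Suc k\<close>, and the geometric sum makes the total
  independent of n.\<close>

lemma ln_cylinder_sum:
  assumes "x \<in> X"
  shows "\<bar>ln (measure \<mu> (right_cylinder d x n)) - (\<Sum>k<n. ln (g ((right_shift ^^ k) x)))\<bar> \<le> C / (1 - \<tau>)"
proof -
  have "\<bar>ln (measure \<mu> (right_cylinder d x n)) - (\<Sum>k<n. ln (g ((right_shift ^^ k) x)))\<bar>
      \<le> (\<Sum>k<n. C * \<tau> ^ Suc k)"
    using assms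
  proof (induction n arbitrary: x)
    case 0
    then show ?case using prob_space by simp
  next
    case (Suc n)
    have "(\<Sum>k<Suc n. ln (g ((right_shift ^^ k) x)))
        = ln (g x) + (\<Sum>k<n. ln (g ((right_shift ^^ k) (right_shift x))))"
      by (simp add: sum.lessThan_Suc_shift funpow_swap1 del: sum.lessThan_Suc)
    then show ?case
      using Suc.IH[OF right_shift_in_dual_space[OF Suc.prems]] ln_cylinder_Suc[OF Suc.prems, of n]
      by simp
  qed
  also have "\<dots> \<le> C * (\<Sum>k<n. \<tau> ^ k)"
    unfolding sum_distrib_left
    using C \<tau> by (intro sum_mono mult_left_mono power_decreasing) auto
  also have "\<dots> \<le> C * (1 / (1 - \<tau>))"
    using C \<tau> sum_le_suminf[of "\<lambda>i. \<tau> ^ i" "{..<n}"] suminf_geometric[of \<tau>]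
    by (intro mult_left_mono) (auto simp: summable_geometric)
  finally show ?thesis by simp
qed

lemma ln_g_bounded: "x \<in> X \<Longrightarrow> \<bar>ln (g x)\<bar> \<le> - ln \<delta>"
  using g_ge[of x] g_le[of x] \<delta> g_pos[of x] ln_le_zero_iff[of "g x"] by simp

end

text \<open>Here \<mu> supplies the coding weights and \<nu> is the measure whose entropy is
  estimated. Taking \<nu> to be \<mu> itself gives the estimate for the lower bound.\<close>

locale g_measure_invariant = g_measure + \<nu>: invariant_prob_space \<nu> right_shift for \<nu> +
  assumes \<nu>: "is_dual_prob d \<nu>"
begin

lemma sets_\<nu> [measurable_cong, simp]: "sets \<nu> = sets (dual_borel d)"
  using \<nu> by (simp add: is_dual_prob_def)

lemma space_\<nu> [simp]: "space \<nu> = X"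
  by (rule space_dual_prob[OF \<nu>])

lemma word_measurable_\<nu>: "word n \<in> measurable \<nu> (count_space (words d n))"
  using measurable_word measurable_cong_sets[OF sets_\<nu> refl] by blast

lemma integrable_ln_cylinder: "integrable \<nu> (\<lambda>x. ln (measure \<mu> (right_cylinder d x n)))"
  using \<nu>.integrable_finite_valued[OF word_measurable_\<nu> finite_words,
      of "\<lambda>b. ln (measure \<mu> (right_cylinder d b n))" n]
  by (simp add: right_cylinder_word)

lemma ln_g_measurable: "(\<lambda>x. ln (g x)) \<in> borel_measurable \<nu>"
  by (simp add: measurable_cong_sets[OF sets_\<nu> refl])

lemma integrable_ln_g: "integrable \<nu> (\<lambda>x. ln (g ((right_shift ^^ k) x)))"
  using ln_g_bounded right_shift_funpow_in measurable_compose[OF \<nu>.funpow_measurable ln_g_measurable]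
  by (intro \<nu>.integrable_const_bound[of _ "- ln \<delta>"]) (auto intro!: AE_I2)

text \<open>All terms of the Birkhoff sum have the same \<nu>-integral by invariance, and the Gibbs
  error is uniform.\<close>

lemma integral_ln_cylinder:
  "\<bar>(\<integral>x. ln (measure \<mu> (right_cylinder d x n)) \<partial>\<nu>) - real n * (\<integral>x. ln (g x) \<partial>\<nu>)\<bar> \<le> C / (1 - \<tau>)"
proof -
  have "(\<integral>x. (\<Sum>k<n. ln (g ((right_shift ^^ k) x))) \<partial>\<nu>) = (\<Sum>k<n. \<integral>x. ln (g ((right_shift ^^ k) x)) \<partial>\<nu>)"
    by (rule Bochner_Integration.integral_sum) (rule integrable_ln_g)
  also have "\<dots> = real n * (\<integral>x. ln (g x) \<partial>\<nu>)"
    by (simp add: \<nu>.integral_funpow[OF ln_g_measurable])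
  finally have "\<bar>(\<integral>x. ln (measure \<mu> (right_cylinder d x n)) \<partial>\<nu>) - real n * (\<integral>x. ln (g x) \<partial>\<nu>)\<bar>
      = \<bar>\<integral>x. ln (measure \<mu> (right_cylinder d x n)) - (\<Sum>k<n. ln (g ((right_shift ^^ k) x))) \<partial>\<nu>\<bar>"
    using integrable_ln_cylinder integrable_ln_g by simp
  also have "\<dots> \<le> (\<integral>x. \<bar>ln (measure \<mu> (right_cylinder d x n)) - (\<Sum>k<n. ln (g ((right_shift ^^ k) x)))\<bar> \<partial>\<nu>)"
    by (rule integral_abs_bound)
  also have "\<dots> \<le> (\<integral>x. C / (1 - \<tau>) \<partial>\<nu>)"
    using integrable_ln_cylinder integrable_ln_g ln_cylinder_sum
    by (intro integral_mono) auto
  finally show ?thesis using \<nu>.prob_space by simp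
qed

end

section \<open>The variational principle\<close>

context g_measure_invariant
begin

text \<open>The cells of the join are encoded by the word of a point, weighted by \<open>\<mu>\<close>, and by its
  itinerary, predicted by the labelling up to a relative error \<open>\<epsilon>\<close>.\<close>

lemma partition_entropy_join_le:
  assumes P: "finite_partition \<nu> P"
    and det: "\<And>x y. x \<in> X \<Longrightarrow> y \<in> X \<Longrightarrow> (\<And>k. k < N \<Longrightarrow> x k = y k) \<Longrightarrow> \<ll> x = \<ll> y"
    and \<ll>: "\<And>x. \<ll> x \<in> P" and bad: "{x \<in> X. \<ll> x \<noteq> cell P x} \<in> sets \<nu>"
    and \<epsilon>: "0 < \<epsilon>" "\<epsilon> < 1"
  shows "partition_entropy \<nu> (iterated_join \<nu> right_shift P n)
    \<le> C / (1 - \<tau>) - real (n + N) * (\<integral>x. ln (g x) \<partial>\<nu>)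
      + real n * (- ln (1 - \<epsilon>) + ln (card P / \<epsilon>) * measure \<nu> {x \<in> X. \<ll> x \<noteq> cell P x})"
proof -
  let ?bad = "{x \<in> X. \<ll> x \<noteq> cell P x}" and ?e1 = "- ln (1 - \<epsilon>)" and ?e2 = "ln (card P / \<epsilon>)"
  note fin = \<nu>.finite_partitionD(1)[OF P] and part = \<nu>.finite_partitionD(2)[OF P]
  have card: "1 \<le> card P" using fin \<ll> by (metis One_nat_def Suc_leI card_gt_0_iff empty_iff)
  \<comment> \<open>A probability vector on P that favours the predicted label \<open>A0\<close>: a
    correct prediction costs at most \<open>- ln (1 - \<epsilon>)\<close>, and a wrong one costs
    \<open>ln (card P / \<epsilon>)\<close>, which stays finite.\<close>
  define \<kappa> where "\<kappa> A0 A = (if A = A0 then 1 - \<epsilon> else 0) + \<epsilon> / card P" for A0 A :: "(nat \<Rightarrow> nat) set"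
  have \<kappa>_pos: "0 < \<kappa> A0 A" for A0 A
    using \<epsilon> card by (auto simp: \<kappa>_def add_pos_pos)
  have sum_\<kappa>: "(\<Sum>A\<in>P. \<kappa> A0 A) = 1" if "A0 \<in> P" for A0
    using that fin card by (auto simp: \<kappa>_def sum.distrib)
  have e1: "0 \<le> ?e1" using \<epsilon> by simp
  have e2: "0 \<le> ?e2" using \<epsilon> card by (intro ln_ge_zero) (simp add: pos_le_divide_eq)
  have ln_\<kappa>: "- ln (\<kappa> (\<ll> x) (cell P x)) \<le> ?e1 + ?e2 * indicator ?bad x" if "x \<in> X" for x
  proof (cases "\<ll> x = cell P x")
    case True
    have "ln (1 - \<epsilon>) \<le> ln (\<kappa> (\<ll> x) (cell P x))"
      using \<epsilon> card True by (intro ln_mono) (auto simp: \<kappa>_def)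
    then show ?thesis using True by simp
  next
    case False
    then have "\<kappa> (\<ll> x) (cell P x) = \<epsilon> / card P" by (auto simp: \<kappa>_def)
    then have "- ln (\<kappa> (\<ll> x) (cell P x)) = ?e2"
      using \<epsilon> card by (simp add: ln_div)
    then show ?thesis using False that e1 by simp
  qed
  \<comment> \<open>The label at time k < n reads the digits from k up to k + N - 1, so the last n +
    N digits predict the whole itinerary.\<close>
  define m where "m = n + N"
  \<comment> \<open>A word is padded by zeros to a point of X, to which the labelling applies; for
    the times k < n the padding is never read.\<close>
  define ext where "ext b i = (if i < m then b i else 0 :: nat)" for b i
  define q where "q = (\<lambda>(a, b). measure \<mu> (right_cylinder d b m) *
    (\<Prod>k<n. \<kappa> (\<ll> ((right_shift ^^ k) (ext b))) (a k)))"
  define Y where "Y x = (restrict (\<lambda>k. cell P ((right_shift ^^ k) x)) {..<n}, word m x)" for x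
  define S where "S = PiE {..<n} (\<lambda>_. P) \<times> words d m"
  have fin_S: "finite S"
    unfolding S_def using fin finite_words by (intro finite_cartesian_product finite_PiE) auto
  have "Y \<in> measurable \<nu> (count_space (PiE {..<n} (\<lambda>_. P)) \<Otimes>\<^sub>M count_space (words d m))"
    unfolding Y_def
  proof (rule measurable_Pair[OF _ word_measurable_\<nu>])
    have "(\<lambda>x. restrict (\<lambda>k. cell P ((right_shift ^^ k) x)) {..<n})
        \<in> measurable \<nu> (PiM {..<n} (\<lambda>_. count_space P))"
      by (rule measurable_restrict)
        (rule measurable_compose[OF \<nu>.funpow_measurable \<nu>.measurable_cell[OF P]])
    also have "PiM {..<n} (\<lambda>_. count_space P) = count_space (PiE {..<n} (\<lambda>_. P))"
      using fin by (intro count_space_PiM_finite) (auto intro: countable_finite)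
    finally show "(\<lambda>x. restrict (\<lambda>k. cell P ((right_shift ^^ k) x)) {..<n})
        \<in> measurable \<nu> (count_space (PiE {..<n} (\<lambda>_. P)))" .
  qed
  also have "count_space (PiE {..<n} (\<lambda>_. P)) \<Otimes>\<^sub>M count_space (words d m) = count_space S"
    unfolding S_def using fin finite_words by (intro pair_measure_count_space finite_PiE) auto
  finally have Y: "Y \<in> measurable \<nu> (count_space S)" .
  have q_Y: "q (Y x) = measure \<mu> (right_cylinder d x m) *
      (\<Prod>k<n. \<kappa> (\<ll> ((right_shift ^^ k) x)) (cell P ((right_shift ^^ k) x)))" if x: "x \<in> X" for x
  proof -
    have "ext (word m x) \<in> X" using x d by (auto simp: ext_def word_apply in_dual_space_iff)
    then have "\<ll> ((right_shift ^^ k) (ext (word m x))) = \<ll> ((right_shift ^^ k) x)" if "k < n" for k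
      using x that
      by (intro det right_shift_funpow_in) (auto simp: right_shift_funpow ext_def word_apply m_def)
    then show ?thesis by (simp add: q_def Y_def right_cylinder_word)
  qed
  have q_pos: "0 < q (Y x)" if "x \<in> X" for x
    unfolding q_Y[OF that] using cylinder_pos[OF that] \<kappa>_pos by (intro mult_pos_pos prod_pos) auto
  have "(\<Sum>b\<in>words d m. measure \<mu> (right_cylinder d b m)) \<le> 1"
  proof -
    have "disjoint_family_on (\<lambda>b. right_cylinder d b m) (words d m)"
      unfolding disjoint_family_on_def
    proof (intro ballI impI)
      fix b c assume bc: "b \<in> words d m" "c \<in> words d m" "b \<noteq> c"
      then obtain k where "k < m" "b k \<noteq> c k" using PiE_ext[OF bc(1,2)] by auto
      then show "right_cylinder d b m \<inter> right_cylinder d c m = {}"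
        by (auto simp: right_cylinder_def)
    qed
    then have "(\<Sum>b\<in>words d m. measure \<mu> (right_cylinder d b m)) = prob (\<Union>b\<in>words d m. right_cylinder d b m)"
      by (intro finite_measure_finite_Union[symmetric, OF finite_words]) (simp_all add: image_subset_iff)
    then show ?thesis using prob_le_1 by simp
  qed
  \<comment> \<open>For a fixed word the sum over itineraries factors into a product of sums of
    \<open>\<kappa>\<close>, each equal to 1.\<close>
  moreover have "(\<Sum>s\<in>S. q s) = (\<Sum>b\<in>words d m. measure \<mu> (right_cylinder d b m))"
  proof -
    have "(\<Sum>s\<in>S. q s) = (\<Sum>a\<in>PiE {..<n} (\<lambda>_. P). \<Sum>b\<in>words d m. q (a, b))"
      unfolding S_def by (simp add: sum.cartesian_product)
    also have "\<dots> = (\<Sum>b\<in>words d m. measure \<mu> (right_cylinder d b m) *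
        (\<Sum>a\<in>PiE {..<n} (\<lambda>_. P). \<Prod>k<n. \<kappa> (\<ll> ((right_shift ^^ k) (ext b))) (a k)))"
      by (subst sum.swap) (simp add: q_def sum_distrib_left)
    also have "\<dots> = (\<Sum>b\<in>words d m. measure \<mu> (right_cylinder d b m))"
    proof -
      have "(\<Sum>a\<in>PiE {..<n} (\<lambda>_. P). \<Prod>k<n. \<kappa> (\<ll> ((right_shift ^^ k) (ext b))) (a k)) = 1" for b
        using fin prod_sum_PiE[of "{..<n}" "\<lambda>_. P" "\<lambda>k. \<kappa> (\<ll> ((right_shift ^^ k) (ext b)))"]
        by (simp add: sum_\<kappa> \<ll>)
      then show ?thesis by simp
    qed
    finally show ?thesis .
  qed
  ultimately have sum_q: "(\<Sum>s\<in>S. q s) \<le> 1" by simp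
  have int: "integrable \<nu> (\<lambda>x. indicator ?bad ((right_shift ^^ k) x) :: real)" for k
    using measurable_compose[OF \<nu>.funpow_measurable borel_measurable_indicator[OF bad]]
    by (intro \<nu>.integrable_const_bound[of _ 1]) (auto simp: indicator_def)
  have "partition_entropy \<nu> (iterated_join \<nu> right_shift P n) \<le> (\<integral>x. - ln (q (Y x)) \<partial>\<nu>)"
  proof (rule \<nu>.partition_entropy_le[OF \<nu>.finite_partition_iterated_join[OF P] Y fin_S])
    fix x y assume xy: "x \<in> space \<nu>" "y \<in> space \<nu>" "Y x = Y y"
    have "cell P ((right_shift ^^ k) x) = cell P ((right_shift ^^ k) y)" if "k < n" for k
    proof -
      have "fst (Y x) k = fst (Y y) k" by (simp only: xy(3))
      then show ?thesis using that by (simp add: Y_def)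
    qed
    then show "cell (iterated_join \<nu> right_shift P n) x = cell (iterated_join \<nu> right_shift P n) y"
      unfolding \<nu>.cell_iterated_join[OF P xy(1)] \<nu>.cell_iterated_join[OF P xy(2)] by simp
  next
    show "0 \<le> q s" for s
      by (auto simp: q_def split: prod.split
          intro!: mult_nonneg_nonneg prod_nonneg less_imp_le[OF \<kappa>_pos])
    show "AE x in \<nu>. 0 < q (Y x)" using q_pos by (intro AE_I2) simp
  qed (rule sum_q)
  also have "\<dots> \<le> (\<integral>x. - ln (measure \<mu> (right_cylinder d x m))
      + (\<Sum>k<n. ?e1 + ?e2 * indicator ?bad ((right_shift ^^ k) x)) \<partial>\<nu>)"
  proof (rule integral_mono)
    show "integrable \<nu> (\<lambda>x. - ln (q (Y x)))"
      using \<nu>.integrable_finite_valued[OF Y fin_S, of "\<lambda>s. - ln (q s)"] .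
    fix x assume "x \<in> space \<nu>"
    then have x: "x \<in> X" by simp
    have "- ln (q (Y x)) = - ln (measure \<mu> (right_cylinder d x m))
        + (\<Sum>k<n. - ln (\<kappa> (\<ll> ((right_shift ^^ k) x)) (cell P ((right_shift ^^ k) x))))"
    proof -
      let ?k = "\<lambda>k. \<kappa> (\<ll> ((right_shift ^^ k) x)) (cell P ((right_shift ^^ k) x))"
      have "0 < (\<Prod>k<n. ?k k)" using \<kappa>_pos by (intro prod_pos) simp
      moreover have "ln (\<Prod>k<n. ?k k) = (\<Sum>k<n. ln (?k k))"
      proof (rule ln_prod)
        show "?k k \<noteq> 0" for k
          using \<kappa>_pos[of "\<ll> ((right_shift ^^ k) x)" "cell P ((right_shift ^^ k) x)"] by linarith
      qed simp
      moreover have "ln (a * b) = ln a + ln b" if "0 < a" "0 < b" for a b :: real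
        using that by (simp add: ln_mult)
      ultimately show ?thesis
        unfolding q_Y[OF x] sum_negf using cylinder_pos[OF x, of m] by (simp only: minus_add_distrib)
    qed
    also have "\<dots> \<le> - ln (measure \<mu> (right_cylinder d x m))
        + (\<Sum>k<n. ?e1 + ?e2 * indicator ?bad ((right_shift ^^ k) x))"
      using ln_\<kappa> right_shift_funpow_in[OF x] by (intro add_left_mono sum_mono) auto
    finally show "- ln (q (Y x)) \<le> - ln (measure \<mu> (right_cylinder d x m))
        + (\<Sum>k<n. ?e1 + ?e2 * indicator ?bad ((right_shift ^^ k) x))" .
  next
    show "integrable \<nu> (\<lambda>x. - ln (measure \<mu> (right_cylinder d x m))
        + (\<Sum>k<n. ?e1 + ?e2 * indicator ?bad ((right_shift ^^ k) x)))"
      using integrable_ln_cylinder int by auto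
  qed
  also have "\<dots> = - (\<integral>x. ln (measure \<mu> (right_cylinder d x m)) \<partial>\<nu>)
      + real n * (?e1 + ?e2 * measure \<nu> ?bad)"
  proof -
    have "(\<integral>x. indicator ?bad ((right_shift ^^ k) x) \<partial>\<nu>) = measure \<nu> ?bad" for k
      using \<nu>.integral_funpow[OF borel_measurable_indicator[OF bad], of k]
        sets.sets_into_space[OF bad] by (simp add: Int_absorb2)
    then show ?thesis
      using int integrable_ln_cylinder \<nu>.prob_space by simp
  qed
  also have "\<dots> \<le> C / (1 - \<tau>) - real m * (\<integral>x. ln (g x) \<partial>\<nu>) + real n * (?e1 + ?e2 * measure \<nu> ?bad)"
    using integral_ln_cylinder[of m] by linarith
  finally show ?thesis unfolding m_def .
qed

text \<open>In the bound for the join, the Gibbs error and the N extra digits do not grow with n and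
  vanish after division by n. What remains beyond the integral is the cost of prediction per step,
  which is made at most e.\<close>

lemma entropy_wrt_le:
  assumes P: "finite_partition \<nu> P"
  shows "entropy_wrt \<nu> right_shift P \<le> - (\<integral>x. ln (g x) \<partial>\<nu>)"
proof (rule field_le_epsilon)
  fix e :: real assume e: "0 < e"
  \<comment> \<open>Chosen so that \<open>- ln (1 - \<epsilon>)\<close> is exactly e / 2. The
    labelling error is chosen afterwards, small against \<open>?e2\<close>, which involves
    \<epsilon>; the 1 added there keeps the denominator positive.\<close>
  define \<epsilon> where "\<epsilon> = 1 - exp (- e / 2)"
  have \<epsilon>: "0 < \<epsilon>" "\<epsilon> < 1" using e by (auto simp: \<epsilon>_def)
  let ?e2 = "ln (card P / \<epsilon>)" and ?I = "\<integral>x. ln (g x) \<partial>\<nu>"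
  obtain x0 where "x0 \<in> space \<nu>" using \<nu>.not_empty by blast
  then have "P \<noteq> {}" using cell_in(1)[OF \<nu>.finite_partitionD(2)[OF P]] by blast
  then have "1 \<le> card P" using \<nu>.finite_partitionD(1)[OF P] by (simp add: Suc_leI card_gt_0_iff)
  then have e2: "0 \<le> ?e2" using \<epsilon> by (intro ln_ge_zero) (simp add: pos_le_divide_eq)
  obtain N \<ll> where L: "\<And>x y. x \<in> X \<Longrightarrow> y \<in> X \<Longrightarrow> (\<And>k. k < N \<Longrightarrow> x k = y k) \<Longrightarrow> \<ll> x = \<ll> y"
    "\<And>x. \<ll> x \<in> P" "{x \<in> X. \<ll> x \<noteq> cell P x} \<in> sets \<nu>"
    "measure \<nu> {x \<in> X. \<ll> x \<noteq> cell P x} < e / (2 * (?e2 + 1))"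
    using partition_labelling[OF \<nu> P, of "e / (2 * (?e2 + 1))"] e e2 by auto
  let ?b = "measure \<nu> {x \<in> X. \<ll> x \<noteq> cell P x}"
  have "?e2 * ?b \<le> (?e2 + 1) * (e / (2 * (?e2 + 1)))"
    using L(4) e2 by (intro mult_mono) auto
  also have "\<dots> = e / 2" using e2 by (simp add: field_simps)
  finally have b: "- ln (1 - \<epsilon>) + ?e2 * ?b \<le> e" by (simp add: \<epsilon>_def)
  show "entropy_wrt \<nu> right_shift P \<le> - ?I + e"
  proof (rule LIMSEQ_le[OF \<nu>.entropy_wrt_tendsto[OF P]])
    show "(\<lambda>n. (C / (1 - \<tau>) - real N * ?I) / real n + (- ?I + e)) \<longlonglongrightarrow> - ?I + e"
      using tendsto_add[OF lim_const_over_n[of "C / (1 - \<tau>) - real N * ?I"] tendsto_const[of "- ?I + e"]]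
      by simp
    have "partition_entropy \<nu> (iterated_join \<nu> right_shift P n) / real n
        \<le> (C / (1 - \<tau>) - real N * ?I) / real n + (- ?I + e)" if "1 \<le> n" for n
    proof -
      have "partition_entropy \<nu> (iterated_join \<nu> right_shift P n)
          \<le> C / (1 - \<tau>) - real (n + N) * ?I + real n * (- ln (1 - \<epsilon>) + ?e2 * ?b)"
        by (rule partition_entropy_join_le[OF P L(1-3) \<epsilon>])
      also have "\<dots> \<le> C / (1 - \<tau>) - real (n + N) * ?I + real n * e"
        using b by (intro add_left_mono mult_left_mono) auto
      also have "\<dots> = (C / (1 - \<tau>) - real N * ?I) + (- ?I + e) * real n"
        by (simp add: algebra_simps)
      also have "\<dots> = ((C / (1 - \<tau>) - real N * ?I) / real n + (- ?I + e)) * real n"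
        using that by (simp add: distrib_right)
      finally show ?thesis using that by (simp add: pos_divide_le_eq)
    qed
    then show "\<exists>N'. \<forall>n\<ge>N'. partition_entropy \<nu> (iterated_join \<nu> right_shift P n) / real n
        \<le> (C / (1 - \<tau>) - real N * ?I) / real n + (- ?I + e)" by blast
  qed
qed

lemma KS_entropy_le: "KS_entropy \<nu> right_shift \<le> ereal (- (\<integral>x. ln (g x) \<partial>\<nu>))"
  unfolding KS_entropy_def using entropy_wrt_le by (intro SUP_least) auto

end

section \<open>Lower bound for the entropy and the equilibrium state\<close>

context g_measure
begin

lemma self_invariant: "g_measure_invariant d g C \<tau> \<delta> \<mu> \<mu>"
  by (intro g_measure_invariant.intro g_measure_axioms invariant_prob_space.intro prob_space_axioms
      invariant_prob_space_axioms.intro invariant g_measure_invariant_axioms.intro prob)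

definition digit_partition :: "(nat \<Rightarrow> nat) set set" where
  "digit_partition = (\<lambda>j. right_cylinder d (\<lambda>_. j) 1) ` {..<d}"

lemma finite_partition_digit_partition: "finite_partition \<mu> digit_partition"
  unfolding finite_partition_def
proof (intro conjI)
  show "partition_on (space \<mu>) digit_partition"
  proof (rule partition_onI)
    show "\<Union>digit_partition = space \<mu>"
      by (auto simp: digit_partition_def right_cylinder_def in_dual_space_iff)
    show "disjnt p q" if "p \<in> digit_partition" "q \<in> digit_partition" "p \<noteq> q" for p q
      using that by (auto simp: digit_partition_def right_cylinder_def disjnt_def)
    have "(\<lambda>_. j) \<in> right_cylinder d (\<lambda>_. j) 1" if "j < d" for j
      using that by (intro self_in_cylinder) (simp add: in_dual_space_iff)
    then show "{} \<notin> digit_partition" unfolding digit_partition_def by blast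
  qed
qed (auto simp: digit_partition_def)

lemma cell_digit_partition:
  assumes "x \<in> X"
  shows "cell digit_partition x = {v \<in> X. v 0 = x 0}"
proof (rule cell_eq)
  show "partition_on X digit_partition"
    using finite_partitionD(2)[OF finite_partition_digit_partition] by simp
  have "{v \<in> X. v 0 = x 0} = right_cylinder d (\<lambda>_. x 0) 1" by (auto simp: right_cylinder_def)
  then show "{v \<in> X. v 0 = x 0} \<in> digit_partition"
    using assms by (simp add: digit_partition_def in_dual_space_iff)
qed (use assms in simp)

text \<open>The n-th join of the partition by the last digit consists of the cylinders of rank n, so
  its entropy is minus the integral of the logarithm of their masses. Against the Birkhoff sums this
  loses only the bounded Gibbs error, and one partition suffices below a supremum.\<close>

lemma KS_entropy_ge: "ereal (- (\<integral>x. ln (g x) \<partial>\<mu>)) \<le> KS_entropy \<mu> right_shift"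
proof -
  interpret I: g_measure_invariant d g C \<tau> \<delta> \<mu> \<mu> by (rule self_invariant)
  let ?J = "iterated_join \<mu> right_shift digit_partition" and ?I = "\<integral>x. ln (g x) \<partial>\<mu>"
  note P = finite_partition_digit_partition
  have "cell (?J n) x = right_cylinder d x n" if x: "x \<in> X" for x n
  proof -
    have "v \<in> (\<Inter>k<n. (right_shift ^^ k) -` cell digit_partition ((right_shift ^^ k) x))
        \<longleftrightarrow> (\<forall>k<n. v k = x k)" if "v \<in> X" for v
      using cell_digit_partition[OF right_shift_funpow_in[OF x]] right_shift_funpow_in[OF that]
      by (auto simp: right_shift_funpow)
    moreover have "cell (?J n) x
        = space \<mu> \<inter> (\<Inter>k<n. (right_shift ^^ k) -` cell digit_partition ((right_shift ^^ k) x))"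
      by (rule I.\<nu>.cell_iterated_join[OF P]) (simp add: x)
    ultimately show ?thesis
      unfolding right_cylinder_def by auto
  qed
  then have H: "partition_entropy \<mu> (?J n) = - (\<integral>x. ln (measure \<mu> (right_cylinder d x n)) \<partial>\<mu>)" for n
    unfolding partition_entropy_eq_integral[OF I.\<nu>.finite_partition_iterated_join[OF P]]
      Bochner_Integration.integral_minus[symmetric]
    by (intro Bochner_Integration.integral_cong) auto
  have "- ?I \<le> entropy_wrt \<mu> right_shift digit_partition"
  proof (rule LIMSEQ_le[OF _ I.\<nu>.entropy_wrt_tendsto[OF P]])
    show "(\<lambda>n. - (C / (1 - \<tau>)) / real n + - ?I) \<longlonglongrightarrow> - ?I"
      using tendsto_add[OF lim_const_over_n[of "- (C / (1 - \<tau>))"] tendsto_const[of "- ?I"]] by simp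
    have "- (C / (1 - \<tau>)) / real n + - ?I \<le> partition_entropy \<mu> (?J n) / real n" if "1 \<le> n" for n
    proof -
      have "(a / real n + b) * real n = a + b * real n" for a b
        using that by (simp add: distrib_right)
      then have "(- (C / (1 - \<tau>)) / real n + - ?I) * real n = - (C / (1 - \<tau>)) - real n * ?I"
        by (simp only:) simp
      also have "\<dots> \<le> partition_entropy \<mu> (?J n)"
        unfolding H using I.integral_ln_cylinder[of n] by linarith
      finally show ?thesis using that by (simp add: pos_le_divide_eq)
    qed
    then show "\<exists>N. \<forall>n\<ge>N. - (C / (1 - \<tau>)) / real n + - ?I \<le> partition_entropy \<mu> (?J n) / real n" by blast
  qed
  then show ?thesis
    unfolding KS_entropy_def using P by (intro SUP_upper2[of digit_partition]) auto
qed

text \<open>On the dual space the potential equals \<open>ln g\<close>, so its integral cancels the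
  entropy bound: every competitor contributes at most 0, and \<mu> reaches 0.\<close>

lemma equilibrium:
  assumes \<Psi>: "\<And>w. w \<in> X \<Longrightarrow> \<Psi> w = 1 / g w"
  shows "equilibrium_state d (\<lambda>w. - ln (\<Psi> w)) \<mu>"
proof -
  have ln_\<Psi>: "- ln (\<Psi> w) = ln (g w)" if "w \<in> X" for w
    using g_pos[OF that] by (simp add: \<Psi>[OF that] ln_div)
  have \<mu>: "\<mu> \<in> shift_invariant_probs d"
    using prob invariant by (simp add: shift_invariant_probs_def)
  have le: "KS_entropy \<nu> right_shift + ereal (\<integral>w. - ln (\<Psi> w) \<partial>\<nu>) \<le> 0"
    if \<nu>: "\<nu> \<in> shift_invariant_probs d" for \<nu>
  proof -
    have \<nu>': "is_dual_prob d \<nu>" "invariant_measure right_shift \<nu>"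
      using \<nu> by (auto simp: shift_invariant_probs_def)
    then interpret J: g_measure_invariant d g C \<tau> \<delta> \<mu> \<nu>
      by (intro g_measure_invariant.intro g_measure_axioms invariant_prob_space.intro
          invariant_prob_space_axioms.intro g_measure_invariant_axioms.intro)
        (auto simp: is_dual_prob_def)
    have "(\<integral>w. - ln (\<Psi> w) \<partial>\<nu>) = (\<integral>w. ln (g w) \<partial>\<nu>)"
      by (intro Bochner_Integration.integral_cong) (auto simp: ln_\<Psi>)
    then show ?thesis
      using add_right_mono[OF J.KS_entropy_le, of "ereal (\<integral>w. ln (g w) \<partial>\<nu>)"]
      by (simp add: zero_ereal_def)
  qed
  have "0 \<le> KS_entropy \<mu> right_shift + ereal (\<integral>w. - ln (\<Psi> w) \<partial>\<mu>)"
  proof -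
    have "(\<integral>w. - ln (\<Psi> w) \<partial>\<mu>) = (\<integral>w. ln (g w) \<partial>\<mu>)"
      by (intro Bochner_Integration.integral_cong) (auto simp: ln_\<Psi>)
    then show ?thesis
      using add_right_mono[OF KS_entropy_ge, of "ereal (\<integral>w. ln (g w) \<partial>\<mu>)"]
      by (simp add: zero_ereal_def)
  qed
  moreover have "pressure d (\<lambda>w. - ln (\<Psi> w)) \<le> 0"
    unfolding pressure_def using le by (rule SUP_least)
  moreover have "KS_entropy \<mu> right_shift + ereal (\<integral>w. - ln (\<Psi> w) \<partial>\<mu>)
      \<le> pressure d (\<lambda>w. - ln (\<Psi> w))"
    unfolding pressure_def using \<mu> by (rule SUP_upper)
  moreover have "continuous_map (dual_topology d) euclideanreal (\<lambda>w. - ln (\<Psi> w))"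
    using \<tau> g_Holder by (intro continuous_map_dualI[of \<tau> d _ C]) (auto simp: ln_\<Psi>)
  ultimately show ?thesis
    unfolding equilibrium_state_def using \<mu> by (auto intro: antisym order_trans)
qed

end

theorem theorem18:
  fixes d :: nat and \<Psi> :: "(nat \<Rightarrow> nat) \<Rightarrow> real"
  assumes "2 \<le> d" and "\<Psi> \<in> TC1_plus d"
  shows "(\<exists>!\<mu>. realizes_shift_derivative d \<Psi> \<mu>) \<and>
         (\<forall>\<mu>. realizes_shift_derivative d \<Psi> \<mu> \<longrightarrow>
              equilibrium_state d (\<lambda>w. - ln (\<Psi> w)) \<mu>)"
proof -
  from assms(2) obtain f where f: "f \<in> C1_plus d"
    and \<Psi>_f: "\<Psi> = restrict (dual_derivative d f) (dual_space d)"
    by (auto simp: TC1_plus_def)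
  obtain g C \<tau> \<delta> where "g_function d g C \<tau> \<delta>"
    and g: "\<And>w. w \<in> dual_space d \<Longrightarrow> dual_derivative d f w = 1 / g w"
    using dual_derivative_g_function[OF f] by metis
  then interpret g_system d g C \<tau> \<delta> using assms(1) by unfold_locales
  have \<Psi>: "\<Psi> w = 1 / g w" if "w \<in> dual_space d" for w
    using g[OF that] that by (simp add: \<Psi>_f)
  show ?thesis
  proof (intro conjI allI impI)
    show "\<exists>!\<mu>. realizes_shift_derivative d \<Psi> \<mu>"
      using realizes_shift_derivative_exists[OF \<Psi>] realizes_shift_derivative_unique[OF \<Psi>] by blast
    show "equilibrium_state d (\<lambda>w. - ln (\<Psi> w)) \<mu>" if "realizes_shift_derivative d \<Psi> \<mu>" for \<mu>
      using g_measure.equilibrium[OF realizes_imp_g_measure[OF \<Psi> that] \<Psi>] .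
  qed
qed

end
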